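(* Let $P\in\mathbb{F}_q[T]$ be a monic polynomial of degree one or two and let $n\ge 1$ be an integer. There exists a bivariate polynomial $f_P(X,Y)\in\mathbb{F}[X,Y]$ of $Y$-degree $q^{\deg P}$ such that the function field $G_n=\mathbb{F}(X_0(P^n))$ of the Drinfeld modular curve $X_0(P^n)$ is generated over $\mathbb{F}=\mathbb{F}_q(T)$ by elements $u_0,\dots,u_{n-1}$ satisfying $$f_P(u_{e-1},u_e)=0\quad\text{for } 1\le e<n.$$ Consequently, the tower of function fields $\mathcal{G}:=(G_n)_{n\ge 1}$ can be defined by a recursion of depth one (with $f_P$ depending only on $P$): $$G_1:=\mathbb{F}(u_0)$$ and for $n\ge 1$ $$G_{n+1}=G_n(u_n)\ \text{ where } f_P(u_{n-1},u_n)=0.$$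
   Context: Let $q$ be a prime power and $\mathbb{F}:=\mathbb{F}_q(T)$. For a monic polynomial $N\in\mathbb{F}_q[T]$, the Drinfeld modular polynomial $\Phi_N(X,Y)$ is the polynomial relating the $j$-invariant $j_0$ of a rank two Drinfeld $\mathbb{F}_q[T]$-module and the $j$-invariant $j_1$ of an $N$-isogenous Drinfeld module (an isogeny with kernel isomorphic to $\mathbb{F}_q[T]/(N)$). Taking $j_0$ transcendental over $\mathbb{F}$, the Drinfeld modular curve $X_0(N)$ is the curve over $\mathbb{F}$ with function field $\mathbb{F}(X_0(N))=\mathbb{F}(j_0,j_1(N))$, where $\Phi_N(j_0,j_1(N))=0$. The degree $[\mathbb{F}(X_0(N)):\mathbb{F}(j_0)]$ equals $q^{\deg N}\prod_{Q\mid N,\ Q\text{ prime}}(1+q^{-\deg Q})$. A $PQ$-isogeny is the composite of a $P$-isogeny and a $Q$-isogeny, giving a natural inclusion $\mathbb{F}(X_0(P))\subset\mathbb{F}(X_0(PQ))$; the fields $\mathbb{F}(X_0(P^n))$ form a tower via these inclusions. With $j_e:=j_1(P^e)$ for $e\ge 1$, one has $\Phi_P(j_e,j_{e+1})=0$ for $e\ge0$, and $\mathbb{F}(X_0(P^n))=\mathbb{F}(j_0,\dots,j_n)$. It is known (Schweizer) that $X_0(P)$ is rational over $\mathbb{F}$ if and only if $P$ has degree one or two; here $u_{e-1}$ denotes a generating element of $\mathbb{F}(j_{e-1},j_e)\cong\mathbb{F}(X_0(P))$ over $\mathbb{F}$, chosen so that $j_{e-1}=\psi(u_{e-1})$ and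 $j_e=\phi(u_{e-1})$ for rational functions $\psi,\phi$ over $\mathbb{F}$ not depending on $e$. A recursion has depth one if the equation defining the new variable involves only the previous variable. *)

theory Defs
  imports
    "Subresultants.More_Homomorphisms"
    "HOL-Computational_Algebra.Computational_Algebra"
    "HOL-Library.Cardinality"
begin

text \<open>
  The finite field \<open>\<F>\<^sub>q\<close> is a type \<open>'q\<close> with \<open>q = CARD('q)\<close>, and
  \<open>T\<close> is \<open>[:0, 1:] :: 'q poly\<close>. Twisted polynomials \<open>\<Sum>\<^sub>k c\<^sub>k \<tau>\<^sup>k\<close> are represented
  by the linearized polynomials \<open>\<Sum>\<^sub>k c\<^sub>k X\<^bsup>q^k\<^esup>\<close>; the twisted product is then composition.
\<close>

definition linearized :: "nat \<Rightarrow> 'l::zero poly \<Rightarrow> bool" where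
  "linearized q f \<longleftrightarrow> (\<forall>i. coeff f i \<noteq> 0 \<longrightarrow> (\<exists>k. i = q ^ k))"

text \<open>
  Drinfeld \<open>\<F>\<^sub>q[T]\<close>-modules of rank \<open>r\<close> over a field \<open>'l\<close> with structure map \<open>\<gamma>\<close>:
  homomorphisms of \<open>\<F>\<^sub>q\<close>-algebras into the twisted polynomials.
\<close>

definition drinfeld_module ::
  "('q::{finite,field} poly \<Rightarrow> 'l::field) \<Rightarrow> nat \<Rightarrow> ('q poly \<Rightarrow> 'l poly) \<Rightarrow> bool" where
  "drinfeld_module \<gamma> r \<phi> \<longleftrightarrow>
     (\<forall>a. linearized CARD('q) (\<phi> a)) \<and>
     (\<forall>c. \<phi> [:c:] = [:0, \<gamma> [:c:]:]) \<and>
     (\<forall>a b. \<phi> (a + b) = \<phi> a + \<phi> b) \<and>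
     (\<forall>a b. \<phi> (a * b) = pcompose (\<phi> a) (\<phi> b)) \<and>
     (\<forall>a. coeff (\<phi> a) 1 = \<gamma> a) \<and>
     (\<forall>a. a \<noteq> 0 \<longrightarrow> degree (\<phi> a) = CARD('q) ^ (r * degree a))"

text \<open>
  In rank two, \<open>\<phi>\<^sub>T = \<gamma>(T) + g \<tau> + \<Delta> \<tau>\<^sup>2\<close> has \<open>j\<close>-invariant \<open>g\<^bsup>q+1\<^esup> / \<Delta>\<close>.
\<close>

definition j_invariant :: "('q::{finite,field} poly \<Rightarrow> 'l::field poly) \<Rightarrow> 'l" where
  "j_invariant \<phi> =
     coeff (\<phi> [:0, 1:]) CARD('q) ^ (CARD('q) + 1) / coeff (\<phi> [:0, 1:]) (CARD('q) ^ 2)"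

definition drinfeld_isogeny ::
  "('q::{finite,field} poly \<Rightarrow> 'l::field poly) \<Rightarrow> ('q poly \<Rightarrow> 'l poly) \<Rightarrow> 'l poly \<Rightarrow> bool" where
  "drinfeld_isogeny \<phi> \<psi> h \<longleftrightarrow>
     h \<noteq> 0 \<and> linearized CARD('q) h \<and> (\<forall>a. pcompose h (\<phi> a) = pcompose (\<psi> a) h)"

definition residue_class :: "'a::comm_ring_1 \<Rightarrow> 'a \<Rightarrow> 'a set" where
  "residue_class N a = {b. N dvd b - a}"

text \<open>
  An isogeny whose kernel is isomorphic to \<open>\<F>\<^sub>q[T]/(N)\<close>, where \<open>\<F>\<^sub>q[T]\<close> acts on the
  kernel via \<open>\<phi>\<close>. Algebraic closedness of \<open>'l\<close> makes the set of zeros in \<open>'l\<close>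
  the full kernel; the isogenies used below live over fields containing \<open>\<F>\<^sub>q(T)\<close> and are
  therefore separable.
\<close>

definition cyclic_isogeny ::
  "'q::{finite,field} poly \<Rightarrow> ('q poly \<Rightarrow> 'l::alg_closed_field poly) \<Rightarrow> ('q poly \<Rightarrow> 'l poly)
    \<Rightarrow> 'l poly \<Rightarrow> bool" where
  "cyclic_isogeny N \<phi> \<psi> h \<longleftrightarrow>
     drinfeld_isogeny \<phi> \<psi> h \<and>
     (\<exists>\<theta>. bij_betw \<theta> (range (residue_class N)) {x. poly h x = 0} \<and>
        (\<forall>a b. \<theta> (residue_class N (a + b)) = \<theta> (residue_class N a) + \<theta> (residue_class N b)) \<and>
        (\<forall>a b. \<theta> (residue_class N (a * b)) = poly (\<phi> a) (\<theta> (residue_class N b))))"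

fun isogeny_comp :: "(nat \<Rightarrow> 'l::comm_semiring_1 poly) \<Rightarrow> nat \<Rightarrow> 'l poly" where
  "isogeny_comp \<mu> 0 = [:0, 1:]"
| "isogeny_comp \<mu> (Suc e) = pcompose (\<mu> e) (isogeny_comp \<mu> e)"

text \<open>
  A compatible choice of \<open>P\<^sup>e\<close>-isogenous modules for all \<open>e\<close>: rank two modules
  \<open>\<phi>\<^sub>0 \<rightarrow> \<phi>\<^sub>1 \<rightarrow> \<dots>\<close> linked by \<open>P\<close>-isogenies such that the composite
  \<open>\<phi>\<^sub>0 \<rightarrow> \<phi>\<^sub>e\<close> is a \<open>P\<^sup>e\<close>-isogeny.
\<close>

definition isogeny_tower ::
  "('q::{finite,field} poly \<Rightarrow> 'l::alg_closed_field) \<Rightarrow> 'q poly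
    \<Rightarrow> (nat \<Rightarrow> 'q poly \<Rightarrow> 'l poly) \<Rightarrow> (nat \<Rightarrow> 'l poly) \<Rightarrow> bool" where
  "isogeny_tower \<gamma> P \<phi> \<mu> \<longleftrightarrow>
     (\<forall>e. drinfeld_module \<gamma> 2 (\<phi> e)) \<and>
     (\<forall>e. cyclic_isogeny P (\<phi> e) (\<phi> (Suc e)) (\<mu> e)) \<and>
     (\<forall>e. cyclic_isogeny (P ^ e) (\<phi> 0) (\<phi> e) (isogeny_comp \<mu> e))"

definition is_subfield :: "'l::field set \<Rightarrow> bool" where
  "is_subfield K \<longleftrightarrow>
     0 \<in> K \<and> 1 \<in> K \<and> (\<forall>x\<in>K. \<forall>y\<in>K. x - y \<in> K \<and> x * y \<in> K) \<and> (\<forall>x\<in>K. inverse x \<in> K)"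

definition adjoin :: "'l::field set \<Rightarrow> 'l set \<Rightarrow> 'l set" where
  "adjoin K S = is_subfield hull (K \<union> S)"

definition transcendental_over :: "('k::field \<Rightarrow> 'l::field) \<Rightarrow> 'l \<Rightarrow> bool" where
  "transcendental_over \<iota> x \<longleftrightarrow> (\<forall>p. p \<noteq> 0 \<longrightarrow> poly (map_poly \<iota> p) x \<noteq> 0)"

text \<open>
  The function field \<open>\<F>\<^sub>q(T)(j(\<phi>), j(\<psi>))\<close> of \<open>X\<^sub>0(N)\<close>, to be used when \<open>j(\<phi>)\<close> is
  transcendental over \<open>\<F>\<^sub>q(T)\<close> and \<open>\<psi>\<close> is \<open>N\<close>-isogenous to \<open>\<phi>\<close>.
\<close>

definition X0_field ::
  "('q::{finite,field} poly fract \<Rightarrow> 'l::field) \<Rightarrow> ('q poly \<Rightarrow> 'l poly) \<Rightarrow> ('q poly \<Rightarrow> 'l poly)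
    \<Rightarrow> 'l set" where
  "X0_field \<iota> \<phi> \<psi> = adjoin (range \<iota>) {j_invariant \<phi>, j_invariant \<psi>}"

text \<open>
  A bivariate polynomial \<open>f(X, Y)\<close> is a polynomial in \<open>Y\<close> with coefficients in
  \<open>k[X]\<close>; in particular \<open>degree f\<close> is the \<open>Y\<close>-degree.
\<close>

definition eval2 :: "('k::field \<Rightarrow> 'l::field) \<Rightarrow> 'k poly poly \<Rightarrow> 'l \<Rightarrow> 'l \<Rightarrow> 'l" where
  "eval2 \<iota> f x y = poly (map_poly (\<lambda>p. poly (map_poly \<iota> p) x) f) y"

text \<open>The rational function \<open>a/b\<close>, with a non-vanishing denominator, takes the value \<open>y\<close> at \<open>x\<close>.\<close>

definition ratfun_value :: "('k::field \<Rightarrow> 'l::field) \<Rightarrow> 'k poly \<times> 'k poly \<Rightarrow> 'l \<Rightarrow> 'l \<Rightarrow> bool" where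
  "ratfun_value \<iota> r x y \<longleftrightarrow>
     poly (map_poly \<iota> (snd r)) x \<noteq> 0 \<and>
     y = poly (map_poly \<iota> (fst r)) x / poly (map_poly \<iota> (snd r)) x"

end

theory Submission
  imports Defs
begin

text \<open>
  Let \<open>q = CARD('q)\<close> and \<open>Q = q\<^bsup>deg P\<^esup>\<close>. The curve \<open>X\<^sub>0(P)\<close> gets an explicit parameter \<open>u\<close>, in which
  \<open>j\<^sub>0 = J(u)\<close> and \<open>j\<^sub>1 = J(\<kappa> / u)\<close> for a rational function \<open>J(X) = A(X) / (X B(X))\<close> with
  \<open>deg A = Q + 1 + deg B\<close>; the involution \<open>u \<mapsto> \<kappa> / u\<close> is the passage to the dual isogeny. For
  \<open>deg P = 2\<close> and \<open>P = X\<^sup>2 - t X + n\<close> one takes \<open>u = T - \<alpha>\<close>, where \<open>T\<close> acts on the kernel of the isogeny as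
  \<open>\<alpha> + \<beta> \<tau>\<close>. Both the dual of the \<open>e\<close>-th isogeny and the isogeny after it have \<open>\<phi>\<^bsub>e+1\<^esub>\<close> as their
  source, which gives \<open>J(\<kappa> / u\<^sub>e) = J(u\<^bsub>e+1\<^esub>)\<close>. Since the composite is cyclic, the
  kernels of those two isogenies are different if \<open>P\<close> is irreducible, and otherwise so are their
  eigenspaces for each root of \<open>P\<close>. This replaces the equation by one of \<open>Y\<close>-degree \<open>Q\<close>, say
  \<open>g(\<kappa> / u\<^sub>e, u\<^bsub>e+1\<^esub>) = 0\<close>, and \<open>f\<close> is obtained from \<open>g(\<kappa> / X, Y)\<close> by clearing denominators.

  That \<open>u\<^sub>0, \<dots>, u\<^bsub>n-1\<^esub>\<close> generate the same field as \<open>j\<^sub>0\<close> and \<open>j\<^sub>n\<close> is seen at a place where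
  \<open>u\<^sub>0\<close> is infinite: there all \<open>u\<^sub>e\<close> are infinite, since \<open>g(0, Y)\<close> is a nonzero constant, and the
  pole of \<open>j\<^sub>0\<close> has \<open>Q\<^sup>n\<close> times the order of that of \<open>j\<^sub>n\<close>.
\<close>

section \<open>Subfields, adjunction and embeddings\<close>

text \<open>Cleared of denominators, J(x) = J(y) has Y-degree Q + 1 + deg B; dividing by y - x,
  which is what unequal kernels permit, leaves Q + deg B. For irreducible P this is the desired
  degree, as B = 1. For reducible P of degree two, deg B counts the submodules that share an
  eigenspace with the given one without being equal to it: 2q of them for distinct roots, q - 1 for
  a double root. Discarding these too lowers the degree to Q, and since their number depends on the
  type of P, so does the equation.

  The hard inclusion is that of the u_e in the field of j_0 and j_n. It is proved by comparing sizes
  at one place instead of by counting degrees, and it uses only abstract data A, B, \<kappa>, Q, so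
  that all levels share the argument. A place is a valuation ring of the whole algebraically closed
  field: conjugates are measured by the same place, and none has to be extended.\<close>

lemma subfieldD:
  assumes "is_subfield K"
  shows subfield_0: "0 \<in> K" and subfield_1: "1 \<in> K"
    and subfield_diff: "\<And>x y. x \<in> K \<Longrightarrow> y \<in> K \<Longrightarrow> x - y \<in> K"
    and subfield_mult: "\<And>x y. x \<in> K \<Longrightarrow> y \<in> K \<Longrightarrow> x * y \<in> K"
    and subfield_inverse: "\<And>x. x \<in> K \<Longrightarrow> inverse x \<in> K"
  using assms by (auto simp: is_subfield_def)

definition is_subring :: "'l::field set \<Rightarrow> bool" where
  "is_subring B \<longleftrightarrow> 1 \<in> B \<and> (\<forall>x\<in>B. \<forall>y\<in>B. x - y \<in> B \<and> x * y \<in> B)"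

lemma subringD:
  assumes "is_subring B"
  shows subring_1: "1 \<in> B"
    and subring_diff: "\<And>x y. x \<in> B \<Longrightarrow> y \<in> B \<Longrightarrow> x - y \<in> B"
    and subring_mult: "\<And>x y. x \<in> B \<Longrightarrow> y \<in> B \<Longrightarrow> x * y \<in> B"
  using assms by (auto simp: is_subring_def)

lemma subring_0: "is_subring B \<Longrightarrow> 0 \<in> B"
  using subring_diff[of B 1 1] subring_1[of B] by auto

lemma subring_uminus: "is_subring B \<Longrightarrow> x \<in> B \<Longrightarrow> - x \<in> B"
  using subring_diff[of B 0 x] subring_0[of B] by auto

lemma subring_add: "is_subring B \<Longrightarrow> x \<in> B \<Longrightarrow> y \<in> B \<Longrightarrow> x + y \<in> B"
  using subring_diff[of B x "- y"] subring_uminus[of B y] by auto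

lemma subring_power: "is_subring B \<Longrightarrow> x \<in> B \<Longrightarrow> x ^ n \<in> B"
  by (induction n) (auto intro: subring_mult subring_1)

lemma subring_sum: "is_subring B \<Longrightarrow> (\<And>i. i \<in> S \<Longrightarrow> f i \<in> B) \<Longrightarrow> sum f S \<in> B"
  by (induction S rule: infinite_finite_induct) (auto intro: subring_add subring_0)

lemmas subring_intros = subring_0 subring_1 subring_diff subring_mult
  subring_uminus subring_add subring_power subring_sum

lemma subfield_subring: "is_subfield K \<Longrightarrow> is_subring K"
  by (auto simp: is_subfield_def is_subring_def)

lemmas subfield_uminus = subring_uminus[OF subfield_subring]
  and subfield_add = subring_add[OF subfield_subring]
  and subfield_power = subring_power[OF subfield_subring]
  and subfield_sum = subring_sum[OF subfield_subring]

lemma subfield_divide: "is_subfield K \<Longrightarrow> x \<in> K \<Longrightarrow> y \<in> K \<Longrightarrow> x / y \<in> K"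
  by (simp add: divide_inverse subfield_mult subfield_inverse)

lemma subfield_adjoin: "is_subfield (adjoin K S)"
  unfolding adjoin_def hull_def by (auto simp: is_subfield_def)

lemma adjoin_base: "K \<subseteq> adjoin K S"
  and adjoin_gens: "S \<subseteq> adjoin K S"
  unfolding adjoin_def hull_def by auto

lemma adjoin_least: "is_subfield L \<Longrightarrow> K \<subseteq> L \<Longrightarrow> S \<subseteq> L \<Longrightarrow> adjoin K S \<subseteq> L"
  unfolding adjoin_def hull_def by auto

lemma adjoin_eqI:
  assumes "S \<subseteq> adjoin K S'" "S' \<subseteq> adjoin K S"
  shows "adjoin K S = adjoin K S'"
  using assms by (intro antisym adjoin_least subfield_adjoin adjoin_base)

lemma adjoin_mono: "S \<subseteq> S' \<Longrightarrow> adjoin K S \<subseteq> adjoin K S'"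
  using adjoin_gens[of S' K] by (intro adjoin_least subfield_adjoin adjoin_base) auto

lemma adjoin_adjoin: "adjoin (adjoin K S) S' = adjoin K (S \<union> S')"
proof (rule antisym; rule adjoin_least[OF subfield_adjoin])
  show "adjoin K S \<subseteq> adjoin K (S \<union> S')" by (rule adjoin_mono) auto
  show "S' \<subseteq> adjoin K (S \<union> S')" using adjoin_gens[of "S \<union> S'" K] by auto
  show "K \<subseteq> adjoin (adjoin K S) S'" using adjoin_base[of K S] adjoin_base[of "adjoin K S" S'] by auto
  show "S \<union> S' \<subseteq> adjoin (adjoin K S) S'"
    using adjoin_gens[of S K] adjoin_base[of "adjoin K S" S'] adjoin_gens[of S' "adjoin K S"] by auto
qed

section \<open>Polynomials over a subset, minimal polynomials and simple algebraic
  extensions\<close>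

definition poly_over :: "'l::field set \<Rightarrow> 'l poly \<Rightarrow> bool" where
  "poly_over K p \<longleftrightarrow> (\<forall>i. coeff p i \<in> K)"

lemma poly_over_mono: "K \<subseteq> L \<Longrightarrow> poly_over K p \<Longrightarrow> poly_over L p"
  by (auto simp: poly_over_def)

lemma poly_in_subring:
  "is_subring B \<Longrightarrow> poly_over B p \<Longrightarrow> x \<in> B \<Longrightarrow> poly p x \<in> B"
  unfolding poly_altdef poly_over_def by (intro subring_sum subring_mult subring_power) auto

lemma poly_over_subring_intros:
  assumes "is_subring K"
  shows poly_over_subring_0: "poly_over K 0" and poly_over_subring_1: "poly_over K 1"
    and poly_over_subring_diff: "\<And>p q. poly_over K p \<Longrightarrow> poly_over K q \<Longrightarrow> poly_over K (p - q)"
    and poly_over_subring_add: "\<And>p q. poly_over K p \<Longrightarrow> poly_over K q \<Longrightarrow> poly_over K (p + q)"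
    and poly_over_subring_uminus: "\<And>p. poly_over K p \<Longrightarrow> poly_over K (- p)"
    and poly_over_subring_mult: "\<And>p q. poly_over K p \<Longrightarrow> poly_over K q \<Longrightarrow> poly_over K (p * q)"
    and poly_over_subring_smult: "\<And>c p. c \<in> K \<Longrightarrow> poly_over K p \<Longrightarrow> poly_over K (Polynomial.smult c p)"
    and poly_over_subring_monom: "\<And>c n. c \<in> K \<Longrightarrow> poly_over K (monom c n)"
    and poly_over_subring_pCons: "\<And>c p. c \<in> K \<Longrightarrow> poly_over K p \<Longrightarrow> poly_over K (pCons c p)"
  using assms unfolding poly_over_def coeff_mult
  by (auto intro!: subring_intros simp: coeff_pCons split: nat.splits)

lemmas poly_over_0 = poly_over_subring_0[OF subfield_subring]
  and poly_over_1 = poly_over_subring_1[OF subfield_subring]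
  and poly_over_diff = poly_over_subring_diff[OF subfield_subring]
  and poly_over_add = poly_over_subring_add[OF subfield_subring]
  and poly_over_uminus = poly_over_subring_uminus[OF subfield_subring]
  and poly_over_mult = poly_over_subring_mult[OF subfield_subring]
  and poly_over_monom = poly_over_subring_monom[OF subfield_subring]
  and poly_over_pCons = poly_over_subring_pCons[OF subfield_subring]

text \<open>Subfields are sets inside one type, so quotient and remainder have to be kept over
  \<open>K\<close>; each round subtracts the multiple of \<open>m\<close> that cancels the leading
  term of \<open>p\<close>.\<close>

lemma poly_over_divmod:
  assumes K: "is_subfield K" and m: "poly_over K m" "m \<noteq> 0" and p: "poly_over K p"
  shows "\<exists>a b. poly_over K a \<and> poly_over K b \<and> p = m * a + b \<and> (b = 0 \<or> degree b < degree m)"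
  using p
proof (induction "degree p" arbitrary: p rule: less_induct)
  case less
  show ?case
  proof (cases "p = 0 \<or> degree p < degree m")
    case True
    then show ?thesis using less.prems poly_over_0[OF K]
      by (intro exI[of _ 0] exI[of _ p]) auto
  next
    case False
    define c where "c = monom (lead_coeff p / lead_coeff m) (degree p - degree m)"
    define p' where "p' = p - m * c"
    have c: "poly_over K c" unfolding c_def using less.prems m K
      by (intro poly_over_monom subfield_divide) (auto simp: poly_over_def)
    have p': "poly_over K p'" unfolding p'_def using less.prems m c K
      by (intro poly_over_diff poly_over_mult) auto
    have dc: "c \<noteq> 0" "degree c = degree p - degree m"
      using False m by (auto simp: c_def degree_monom_eq monom_eq_0_iff)
    have dmc: "degree (m * c) = degree p" "lead_coeff (m * c) = lead_coeff p"
      using False m dc by (simp add: degree_mult_eq)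
      (use False m dc in \<open>simp only: lead_coeff_mult\<close>, simp add: c_def degree_monom_eq)
    have "p' = 0 \<or> degree p' < degree p"
    proof (cases "degree p = 0")
      case True
      have "degree (m * c) = 0" using dmc True by simp
      then have "p' = 0" using True dmc(2) unfolding p'_def
        by (metis degree_0_id right_minus_eq)
      then show ?thesis ..
    next
      case d: False
      have "degree p' \<le> degree p" unfolding p'_def using dmc(1) by (intro degree_diff_le) auto
      moreover have "coeff p' (degree p) = 0" unfolding p'_def using dmc by auto
      ultimately show ?thesis using eq_zero_or_degree_less by blast
    qed
    then obtain a b where ab: "poly_over K a" "poly_over K b" "p' = m * a + b"
        "b = 0 \<or> degree b < degree m"
    proof
      assume "p' = 0" then show ?thesis using that[of 0 0] poly_over_0[OF K] by simp
    next
      assume "degree p' < degree p" then show ?thesis using less.hyps[OF _ p'] that by blast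
    qed
    then show ?thesis using c K unfolding p'_def
      by (intro exI[of _ "a + c"] exI[of _ b]) (auto intro: poly_over_add simp: algebra_simps)
  qed
qed

definition algebraic_in :: "'l::field set \<Rightarrow> 'l \<Rightarrow> bool" where
  "algebraic_in K x \<longleftrightarrow> (\<exists>p. p \<noteq> 0 \<and> poly_over K p \<and> poly p x = 0)"

definition min_polynomial :: "'l::field set \<Rightarrow> 'l \<Rightarrow> 'l poly \<Rightarrow> bool" where
  "min_polynomial K x m \<longleftrightarrow> m \<noteq> 0 \<and> poly_over K m \<and> poly m x = 0 \<and>
     (\<forall>p. p \<noteq> 0 \<and> poly_over K p \<and> poly p x = 0 \<longrightarrow> degree m \<le> degree p)"

lemma min_polynomial_exists: "algebraic_in K x \<Longrightarrow> \<exists>m. min_polynomial K x m"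
  unfolding algebraic_in_def min_polynomial_def
  using ex_has_least_nat[of "\<lambda>p. p \<noteq> 0 \<and> poly_over K p \<and> poly p x = 0" _ degree] by blast

lemma min_polynomial_degree:
  assumes "min_polynomial K x m" shows "degree m > 0"
proof (rule ccontr)
  assume "\<not> degree m > 0"
  then obtain c where "m = [:c:]" using degree_eq_zeroE by blast
  then show False using assms by (auto simp: min_polynomial_def)
qed

lemma min_polynomial_dvd:
  assumes K: "is_subfield K" and m: "min_polynomial K x m" and p: "poly_over K p" "poly p x = 0"
  shows "\<exists>a. poly_over K a \<and> p = m * a"
proof -
  obtain a b where ab: "poly_over K a" "poly_over K b" "p = m * a + b" "b = 0 \<or> degree b < degree m"
    using poly_over_divmod[OF K _ _ p(1)] m unfolding min_polynomial_def by blast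
  have "poly b x = 0" using ab(3) p(2) m by (auto simp: min_polynomial_def)
  then have "b = 0" using ab m unfolding min_polynomial_def by (metis not_le)
  then show ?thesis using ab by auto
qed

text \<open>Euclid's algorithm: in \<open>m = p * a + b\<close> the remainder is nonzero, since
  otherwise \<open>a\<close> would be a shorter polynomial vanishing at \<open>x\<close>. Then p(x)
  a(x) = - b(x), and b(x) is inverted by induction on the degree.\<close>

lemma poly_value_inverse:
  assumes K: "is_subfield K" and m: "min_polynomial K x m"
    and p: "poly_over K p" "p \<noteq> 0" "degree p < degree m"
  shows "\<exists>a. poly_over K a \<and> poly p x * poly a x = 1"
  using p
proof (induction "degree p" arbitrary: p rule: less_induct)
  case less
  have px: "poly p x \<noteq> 0" using less.prems m unfolding min_polynomial_def by (metis not_le)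
  show ?case
  proof (cases "degree p = 0")
    case True
    then obtain c where c: "p = [:c:]" using degree_eq_zeroE by blast
    then have "c \<in> K" "c \<noteq> 0" using less.prems by (auto simp: poly_over_def coeff_pCons split: nat.splits)
    then show ?thesis using K c
      by (intro exI[of _ "[:inverse c:]"]) (auto intro!: poly_over_pCons poly_over_0 subfield_inverse)
  next
    case False
    have mK: "poly_over K m" "m \<noteq> 0" "poly m x = 0" using m by (auto simp: min_polynomial_def)
    obtain a b where ab: "poly_over K a" "poly_over K b" "m = p * a + b" "b = 0 \<or> degree b < degree p"
      using poly_over_divmod[OF K less.prems(1,2) mK(1)] by blast
    have b0: "b \<noteq> 0"
    proof
      assume "b = 0"
      then have ma: "m = p * a" using ab by simp
      then have "a \<noteq> 0" using mK by auto
      then have "degree a < degree m" using ma less.prems False by (simp add: degree_mult_eq)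
      moreover have "poly a x = 0" using ma mK(3) px by simp
      ultimately show False using m \<open>a \<noteq> 0\<close> ab(1) unfolding min_polynomial_def by (metis not_le)
    qed
    then have "degree b < degree p" using ab by auto
    then obtain c where c: "poly_over K c" "poly b x * poly c x = 1"
      using less.hyps[OF _ ab(2) b0] less.prems by auto
    have "poly b x = - (poly p x * poly a x)" using ab(3) mK(3) by (simp add: eq_neg_iff_add_eq_0 add.commute)
    then have "poly p x * poly (- (a * c)) x = 1" using c(2) by (simp add: mult.assoc)
    then show ?thesis using ab(1) c(1) K by (intro exI[of _ "- (a * c)"]) (auto intro: poly_over_uminus poly_over_mult)
  qed
qed

text \<open>Values of polynomials already form a field. Embeddings of the extension can therefore be
  defined on polynomials, with no fractions.\<close>

lemma adjoin_algebraic_eq: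
  assumes K: "is_subfield K" and alg: "algebraic_in K x"
  shows "adjoin K {x} = (\<lambda>p. poly p x) ` {p. poly_over K p}" (is "_ = ?L")
proof (intro antisym)
  obtain m where m: "min_polynomial K x m" using min_polynomial_exists[OF alg] ..
  have mK: "poly_over K m" "m \<noteq> 0" "poly m x = 0" using m by (auto simp: min_polynomial_def)
  have inv: "inverse (poly p x) \<in> ?L" if p: "poly_over K p" for p
  proof (cases "poly p x = 0")
    case True then show ?thesis using poly_over_0[OF K] by (auto intro!: image_eqI[of _ _ 0])
  next
    case False
    obtain a b where ab: "poly_over K a" "poly_over K b" "p = m * a + b" "b = 0 \<or> degree b < degree m"
      using poly_over_divmod[OF K mK(1,2) p] by blast
    have "poly p x = poly b x" using ab mK by simp
    moreover from this have "b \<noteq> 0" using False by auto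
    ultimately show ?thesis using poly_value_inverse[OF K m ab(2)] ab(4)
      by (auto intro!: image_eqI simp: inverse_unique)
  qed
  have "is_subfield ?L" unfolding is_subfield_def
  proof (intro conjI ballI)
    show "0 \<in> ?L" using poly_over_0[OF K] by (auto intro!: image_eqI[of _ _ 0])
    show "1 \<in> ?L" using poly_over_1[OF K] by (auto intro!: image_eqI[of _ _ 1])
    fix y z assume "y \<in> ?L" "z \<in> ?L"
    then obtain p r where pr: "poly_over K p" "poly_over K r" "y = poly p x" "z = poly r x" by auto
    show "y - z \<in> ?L" using pr K by (auto intro!: image_eqI[of _ _ "p - r"] poly_over_diff)
    show "y * z \<in> ?L" using pr K by (auto intro!: image_eqI[of _ _ "p * r"] poly_over_mult)
  qed (use inv in blast)
  moreover have "K \<subseteq> ?L"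
  proof
    fix c assume "c \<in> K"
    then show "c \<in> ?L" using K
      by (auto intro!: image_eqI[of _ _ "[:c:]"] poly_over_pCons poly_over_0)
  qed
  moreover have "{x} \<subseteq> ?L" using K
    by (auto intro!: image_eqI[of _ _ "[:0, 1:]"] poly_over_pCons poly_over_0 subfield_0 subfield_1)
  ultimately show "adjoin K {x} \<subseteq> ?L" by (rule adjoin_least)
  show "?L \<subseteq> adjoin K {x}"
    using poly_in_subring[OF subfield_subring[OF subfield_adjoin], of K "{x}" _ x] adjoin_base[of K "{x}"]
      adjoin_gens[of "{x}" K] poly_over_mono by blast
qed

section \<open>Embeddings of subfields and their extension to algebraic elements\<close>

definition hom_on :: "'l::field set \<Rightarrow> ('l \<Rightarrow> 'l) \<Rightarrow> bool" where
  "hom_on K \<sigma> \<longleftrightarrow> \<sigma> 1 = 1 \<and> (\<forall>x\<in>K. \<forall>y\<in>K. \<sigma> (x + y) = \<sigma> x + \<sigma> y \<and> \<sigma> (x * y) = \<sigma> x * \<sigma> y)"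

context
  fixes K :: "'l::field set" and \<sigma>
  assumes K: "is_subfield K" and h: "hom_on K \<sigma>"
begin

lemma hom_on_0: "\<sigma> 0 = 0"
  using h subfield_0[OF K] unfolding hom_on_def by (metis add.right_neutral add_left_cancel)

lemma hom_on_1: "\<sigma> 1 = 1"
  using h unfolding hom_on_def by auto

lemma hom_on_add: "x \<in> K \<Longrightarrow> y \<in> K \<Longrightarrow> \<sigma> (x + y) = \<sigma> x + \<sigma> y"
  and hom_on_mult: "x \<in> K \<Longrightarrow> y \<in> K \<Longrightarrow> \<sigma> (x * y) = \<sigma> x * \<sigma> y"
  using h unfolding hom_on_def by auto

lemma hom_on_power: "x \<in> K \<Longrightarrow> \<sigma> (x ^ n) = \<sigma> x ^ n"
  by (induction n) (auto simp: hom_on_1 hom_on_mult subfield_power[OF K])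

lemma hom_on_sum: "(\<And>i. i \<in> S \<Longrightarrow> f i \<in> K) \<Longrightarrow> \<sigma> (sum f S) = (\<Sum>i\<in>S. \<sigma> (f i))"
  by (induction S rule: infinite_finite_induct)
     (auto simp: hom_on_0 hom_on_add subfield_sum[OF K])

lemma hom_on_eq_0: "x \<in> K \<Longrightarrow> \<sigma> x = 0 \<longleftrightarrow> x = 0"
  using hom_on_mult[of x "inverse x"] subfield_inverse[OF K, of x] hom_on_0 hom_on_1
  by (cases "x = 0") auto

lemma hom_on_divide: "x \<in> K \<Longrightarrow> y \<in> K \<Longrightarrow> \<sigma> (x / y) = \<sigma> x / \<sigma> y"
proof (cases "y = 0")
  case False
  assume xy: "x \<in> K" "y \<in> K"
  have "\<sigma> (x / y) * \<sigma> y = \<sigma> x"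
    using hom_on_mult[of "x / y" y] xy False by (simp add: subfield_divide[OF K])
  then show ?thesis using hom_on_eq_0[OF xy(2)] False by (simp add: field_simps)
qed (simp add: hom_on_0)

lemma hom_on_poly:
  "poly_over K p \<Longrightarrow> x \<in> K \<Longrightarrow> \<sigma> (poly p x) = poly (map_poly \<sigma> p) (\<sigma> x)"
proof -
  assume p: "poly_over K p" and x: "x \<in> K"
  have "\<sigma> (poly p x) = (\<Sum>i\<le>degree p. \<sigma> (coeff p i) * \<sigma> x ^ i)"
    unfolding poly_altdef using p x
    by (subst hom_on_sum) (auto simp: poly_over_def hom_on_mult hom_on_power subfield_power[OF K]
      intro!: subfield_mult[OF K] sum.cong)
  also have "\<dots> = (\<Sum>i\<le>degree p. coeff (map_poly \<sigma> p) i * \<sigma> x ^ i)"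
    by (simp add: coeff_map_poly hom_on_0)
  also have "\<dots> = poly (map_poly \<sigma> p) (\<sigma> x)"
    unfolding poly_altdef using map_poly_degree_leq[of \<sigma> p] hom_on_0
    by (intro sum.mono_neutral_right) (auto simp: coeff_eq_0)
  finally show ?thesis .
qed

lemma map_poly_hom_on_add:
  "poly_over K p \<Longrightarrow> poly_over K r \<Longrightarrow> map_poly \<sigma> (p + r) = map_poly \<sigma> p + map_poly \<sigma> r"
  by (intro poly_eqI) (auto simp: coeff_map_poly hom_on_0 hom_on_add poly_over_def)

lemma map_poly_hom_on_mult:
  "poly_over K p \<Longrightarrow> poly_over K r \<Longrightarrow> map_poly \<sigma> (p * r) = map_poly \<sigma> p * map_poly \<sigma> r"
  by (intro poly_eqI)
     (auto simp: coeff_map_poly hom_on_0 coeff_mult hom_on_sum poly_over_def subfield_mult[OF K] hom_on_mult)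

lemma degree_map_poly_hom_on:
  assumes "poly_over K p" shows "degree (map_poly \<sigma> p) = degree p"
proof (cases "p = 0")
  case False
  show ?thesis using hom_on_0 assms False
    by (intro map_poly_degree_eq) (auto simp: hom_on_eq_0 poly_over_def)
qed auto

text \<open>The extension sends p(x) to the value at \<open>y\<close> of the transported polynomial.
  Two polynomials with the same value at \<open>x\<close> differ by a multiple of \<open>m\<close>,
  whose image vanishes at \<open>y\<close>, so the choice of representative does not matter.\<close>

lemma hom_on_extend_root:
  assumes m: "min_polynomial K x m" and y: "poly (map_poly \<sigma> m) y = 0"
  shows "\<exists>\<tau>. hom_on (adjoin K {x}) \<tau> \<and> (\<forall>k\<in>K. \<tau> k = \<sigma> k) \<and> \<tau> x = y"
proof -
  have mK: "poly_over K m" "m \<noteq> 0" "poly m x = 0" using m by (auto simp: min_polynomial_def)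
  then have alg: "algebraic_in K x" unfolding algebraic_in_def by auto
  define \<tau> where "\<tau> = (\<lambda>z. poly (map_poly \<sigma> (SOME p. poly_over K p \<and> poly p x = z)) y)"
  have \<tau>: "\<tau> (poly p x) = poly (map_poly \<sigma> p) y" if p: "poly_over K p" for p
  proof -
    define r where "r = (SOME r. poly_over K r \<and> poly r x = poly p x)"
    have r: "poly_over K r" "poly r x = poly p x"
      using someI[of "\<lambda>r. poly_over K r \<and> poly r x = poly p x" p] p unfolding r_def by auto
    obtain a where a: "poly_over K a" "p - r = m * a"
      using min_polynomial_dvd[OF K m, of "p - r"] poly_over_diff[OF K p r(1)] r by auto
    have "p = r + m * a" using a by (simp add: algebra_simps)
    then have "map_poly \<sigma> p = map_poly \<sigma> r + map_poly \<sigma> m * map_poly \<sigma> a"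
      using r a mK by (simp add: map_poly_hom_on_add map_poly_hom_on_mult poly_over_mult[OF K])
    then have "poly (map_poly \<sigma> p) y = poly (map_poly \<sigma> r) y" using y by simp
    then show ?thesis unfolding \<tau>_def r_def[symmetric] by simp
  qed
  have c: "\<tau> c = \<sigma> c" if "c \<in> K" for c
    using \<tau>[of "[:c:]"] that
    by (cases "c = 0") (auto simp: map_poly_pCons hom_on_0 poly_over_pCons[OF K] poly_over_0[OF K])
  have x: "\<tau> x = y"
    using \<tau>[of "[:0, 1:]"] subfield_0[OF K] subfield_1[OF K]
    by (simp add: map_poly_pCons hom_on_0 hom_on_1 poly_over_pCons[OF K] poly_over_0[OF K] del: pCons_one)
  have "hom_on (adjoin K {x}) \<tau>"
    unfolding hom_on_def adjoin_algebraic_eq[OF K alg]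
  proof (intro conjI ballI)
    show "\<tau> 1 = 1" using c subfield_1[OF K] hom_on_1 by simp
    fix a b assume "a \<in> (\<lambda>p. poly p x) ` {p. poly_over K p}" "b \<in> (\<lambda>p. poly p x) ` {p. poly_over K p}"
    then obtain p r where pr: "poly_over K p" "poly_over K r" "a = poly p x" "b = poly r x" by auto
    show "\<tau> (a + b) = \<tau> a + \<tau> b"
      using \<tau>[of "p + r"] \<tau>[of p] \<tau>[of r] pr by (simp add: poly_over_add[OF K] map_poly_hom_on_add)
    show "\<tau> (a * b) = \<tau> a * \<tau> b"
      using \<tau>[of "p * r"] \<tau>[of p] \<tau>[of r] pr by (simp add: poly_over_mult[OF K] map_poly_hom_on_mult)
  qed
  then show ?thesis using c x by blast
qed

end

lemma hom_on_extend:
  fixes K :: "'l::alg_closed_field set"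
  assumes K: "is_subfield K" and h: "hom_on K \<sigma>" and alg: "algebraic_in K x"
  shows "\<exists>\<tau>. hom_on (adjoin K {x}) \<tau> \<and> (\<forall>k\<in>K. \<tau> k = \<sigma> k)"
proof -
  obtain m where m: "min_polynomial K x m" using min_polynomial_exists[OF alg] ..
  then have "degree (map_poly \<sigma> m) > 0"
    using min_polynomial_degree[OF m] degree_map_poly_hom_on[OF K h] by (auto simp: min_polynomial_def)
  then obtain y where "poly (map_poly \<sigma> m) y = 0" using alg_closed_imp_poly_has_root by blast
  then show ?thesis using hom_on_extend_root[OF K h m] by blast
qed

text \<open>Lets a conjugation of one element act on a whole chain of elements, each algebraic over
  its predecessors; it will be applied to all parameters of a tower at once.\<close>

lemma hom_on_extend_chain:
  fixes K :: "'l::alg_closed_field set" and w :: "nat \<Rightarrow> 'l"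
  assumes K: "is_subfield K" and h: "hom_on K \<sigma>"
    and alg: "\<And>i. i < N \<Longrightarrow> algebraic_in (adjoin K (w ` {..<i})) (w i)"
  shows "\<exists>\<tau>. hom_on (adjoin K (w ` {..<N})) \<tau> \<and> (\<forall>k\<in>K. \<tau> k = \<sigma> k)"
  using alg
proof (induct N)
  case 0
  have "adjoin K {} = K" using adjoin_base[of K "{}"] adjoin_least[OF K, of K "{}"] by auto
  then show ?case using h by auto
next
  case (Suc N)
  then obtain \<tau> where \<tau>: "hom_on (adjoin K (w ` {..<N})) \<tau>" "\<forall>k\<in>K. \<tau> k = \<sigma> k" by auto
  obtain \<tau>' where \<tau>': "hom_on (adjoin (adjoin K (w ` {..<N})) {w N}) \<tau>'"
      "\<forall>k\<in>adjoin K (w ` {..<N}). \<tau>' k = \<tau> k"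
    using hom_on_extend[OF subfield_adjoin \<tau>(1)] Suc.prems by blast
  have "adjoin (adjoin K (w ` {..<N})) {w N} = adjoin K (w ` {..<Suc N})"
    by (simp add: adjoin_adjoin lessThan_Suc)
  then show ?case using \<tau> \<tau>' adjoin_base[of K "w ` {..<N}"] by (intro exI[of _ \<tau>']) auto
qed

text \<open>A simple root of \<open>p\<close> is a simple root of the minimal polynomial, so in m =
  (X - x) r the value r(x) is nonzero. As \<open>x\<close> is outside \<open>K\<close>,
  \<open>r\<close> is not constant, and any of its roots is a conjugate other than
  \<open>x\<close>.\<close>

lemma exists_conjugate:
  fixes K :: "'l::alg_closed_field set"
  assumes K: "is_subfield K" and p: "poly_over K p" "poly p x = 0" "poly (pderiv p) x \<noteq> 0"
    and x: "x \<notin> K"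
  shows "\<exists>\<tau>. hom_on (adjoin K {x}) \<tau> \<and> (\<forall>k\<in>K. \<tau> k = k) \<and> \<tau> x \<noteq> x"
proof -
  have "p \<noteq> 0" using p by auto
  then have "algebraic_in K x" using p unfolding algebraic_in_def by auto
  then obtain m where m: "min_polynomial K x m" using min_polynomial_exists by blast
  have mK: "poly_over K m" "m \<noteq> 0" "poly m x = 0" using m by (auto simp: min_polynomial_def)
  obtain a where a: "p = m * a" using min_polynomial_dvd[OF K m p(1,2)] by auto
  obtain r where r: "m = [:- x, 1:] * r" using mK(3) by (auto simp: poly_eq_0_iff_dvd elim: dvdE)
  have r0: "r \<noteq> 0" using r mK by auto
  have rx: "poly r x \<noteq> 0"
  proof
    assume "poly r x = 0"
    then show False using p(3) unfolding a r pderiv_mult by (simp add: pderiv_pCons)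
  qed
  have "degree r \<noteq> 0"
  proof
    assume "degree r = 0"
    then obtain c where c: "r = [:c:]" using degree_eq_zeroE by blast
    have "coeff m 1 \<in> K" "coeff m 0 \<in> K" using mK by (auto simp: poly_over_def)
    then have "c \<in> K" "- (x * c) \<in> K" using r c by (auto simp: mult.commute)
    then have "- (- (x * c)) / c \<in> K" using K by (blast intro: subfield_divide subfield_uminus)
    then show False using x c r0 by simp
  qed
  then obtain y where y: "poly r y = 0" using alg_closed_imp_poly_has_root[of r] by auto
  have h: "hom_on K (\<lambda>z. z)" by (simp add: hom_on_def)
  have "poly m y = 0" "y \<noteq> x" using r y rx by auto
  then show ?thesis using hom_on_extend_root[OF K h m, of y] by (auto simp: map_poly_idI)
qed

section \<open>Valuation rings\<close>

definition valuation_ring :: "'l::field set \<Rightarrow> bool" where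
  "valuation_ring V \<longleftrightarrow> is_subring V \<and> (\<forall>x. x \<noteq> 0 \<longrightarrow> x \<in> V \<or> inverse x \<in> V)"

lemma subring_poly_values:
  assumes B: "is_subring B"
  shows "is_subring ((\<lambda>p. poly p x) ` {p. poly_over B p})" (is "is_subring ?L")
    and "B \<subseteq> (\<lambda>p. poly p x) ` {p. poly_over B p}" and "x \<in> (\<lambda>p. poly p x) ` {p. poly_over B p}"
proof -
  show "is_subring ?L" unfolding is_subring_def
  proof (intro conjI ballI)
    show "1 \<in> ?L" using poly_over_subring_1[OF B] by (auto intro!: image_eqI[of _ _ 1])
    fix y z assume "y \<in> ?L" "z \<in> ?L"
    then obtain p r where pr: "poly_over B p" "poly_over B r" "y = poly p x" "z = poly r x" by auto
    show "y - z \<in> ?L" using pr B by (auto intro!: image_eqI[of _ _ "p - r"] poly_over_subring_diff)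
    show "y * z \<in> ?L" using pr B by (auto intro!: image_eqI[of _ _ "p * r"] poly_over_subring_mult)
  qed
  show "B \<subseteq> ?L"
  proof
    fix c assume "c \<in> B"
    then show "c \<in> ?L" using B
      by (auto intro!: image_eqI[of _ _ "[:c:]"] poly_over_subring_pCons poly_over_subring_0)
  qed
  show "x \<in> ?L" using B
    by (auto intro!: image_eqI[of _ _ "[:0, 1:]"] poly_over_subring_pCons poly_over_subring_0 subring_0 subring_1)
qed

text \<open>
  Chevalley's argument: a subring that is maximal among those containing \<open>1/w\<close> but not \<open>w\<close>
  is a valuation ring.
\<close>

lemma maximal_subring_valuation_ring:
  fixes B :: "'l::field set"
  assumes B: "is_subring B" and w0: "w \<noteq> 0" and zB: "inverse w \<in> B" and wB: "w \<notin> B"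
    and max: "\<And>C. is_subring C \<Longrightarrow> B \<subseteq> C \<Longrightarrow> w \<notin> C \<Longrightarrow> C = B"
  shows "valuation_ring B"
proof -
  define z where "z = inverse w"
  have z: "z \<in> B" "z * w = 1" using zB w0 by (auto simp: z_def)
  \<comment> \<open>Maximality: adjoining any element outside \<open>B\<close> brings in
    \<open>w\<close>.\<close>
  have w_value: "\<exists>p. poly_over B p \<and> poly p x = w" if "x \<notin> B" for x
    using max[OF subring_poly_values(1,2)[OF B, of x]] subring_poly_values(3)[OF B, of x] that by blast
  \<comment> \<open>With y = 1 - z b, suppose that 1/y is outside \<open>B\<close>. Then
    \<open>w\<close> is a polynomial in 1/y, so w y^k lies in \<open>B\<close> for some k. As y^k =
    1 - z b' and z w = 1, this product is w - b', and \<open>w\<close> itself would lie in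
    \<open>B\<close>.\<close>
  have unit: "inverse (1 - z * b) \<in> B" "1 - z * b \<noteq> 0" if b: "b \<in> B" for b
  proof -
    define y where "y = 1 - z * b"
    have y0: "y \<noteq> 0"
    proof
      assume "y = 0"
      then have "w = w * (z * b)" by (simp add: y_def)
      also have "\<dots> = b" using z by (simp add: mult.assoc[symmetric] mult.commute[of w])
      finally show False using b wB by simp
    qed
    then show "1 - z * b \<noteq> 0" by (simp add: y_def)
    have yB: "y \<in> B" unfolding y_def using B b z by (intro subring_intros)
    show "inverse (1 - z * b) \<in> B"
    proof (rule ccontr)
      assume "inverse (1 - z * b) \<notin> B"
      then obtain p where p: "poly_over B p" "poly p (inverse y) = w" using w_value unfolding y_def by blast
      define k where "k = degree p"
      have "w * y ^ k = (\<Sum>i\<le>k. coeff p i * y ^ (k - i))"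
        unfolding p(2)[symmetric] poly_altdef k_def sum_distrib_right
      proof (intro sum.cong refl)
        fix i assume "i \<in> {..degree p}"
        then have "y ^ degree p = y ^ i * y ^ (degree p - i)" by (simp flip: power_add)
        then show "coeff p i * inverse y ^ i * y ^ degree p = coeff p i * y ^ (degree p - i)"
          using y0 by (simp add: field_simps)
      qed
      also have "\<dots> \<in> B" using B p yB by (intro subring_intros) (auto simp: poly_over_def)
      finally have wy: "w * y ^ k \<in> B" .
      have "\<exists>b'\<in>B. y ^ k = 1 - z * b'" for k
      proof (induction k)
        case 0 then show ?case using subring_0[OF B] by (intro bexI[of _ 0]) auto
      next
        case (Suc k)
        then obtain b' where b': "b' \<in> B" "y ^ k = 1 - z * b'" by auto
        have "y ^ Suc k = (1 - z * b) * (1 - z * b')" using b' by (simp add: y_def)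
        also have "\<dots> = 1 - z * (b' + b - z * b * b')" by (simp add: algebra_simps)
        finally have "y ^ Suc k = 1 - z * (b' + b - z * b * b')" .
        moreover have "b' + b - z * b * b' \<in> B" using B b b' z by (intro subring_intros)
        ultimately show ?case by blast
      qed
      then obtain b' where b': "b' \<in> B" "y ^ k = 1 - z * b'" by blast
      have "w * y ^ k + b' = w - (z * w) * b' + b'" unfolding b'(2) by (simp add: algebra_simps)
      then have "w * y ^ k + b' = w" using z by simp
      then show False using wy b' wB subring_add[OF B] by metis
    qed
  qed
  \<comment> \<open>Let w have degree n in x and degree at most n in 1/x. Multiplying the second
    expression by z x^n gives (1 - z r_0) x^n = z s(x) with deg s < n. The factor on the left is a
    unit of \<open>B\<close>, so x^n can be replaced by lower terms in p. Expressions of minimal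
    degree in x and in 1/x thus exclude each other.\<close>
  have reduce: "\<exists>p'. poly_over B p' \<and> poly p' x = w \<and> degree p' < degree p"
    if p: "poly_over B p" "poly p x = w" and r: "poly_over B r" "poly r (inverse x) = w"
      and d: "degree r \<le> degree p" and x0: "x \<noteq> 0" for p r x
  proof -
    define n where "n = degree p"
    define e where "e = inverse (1 - z * coeff r 0)"
    have r0: "coeff r 0 \<in> B" and pn: "coeff p n \<in> B" using r p by (auto simp: poly_over_def)
    have e: "e \<in> B" "e * (1 - z * coeff r 0) = 1" using unit[OF r0] by (auto simp: e_def)
    have n0: "n > 0"
    proof (rule ccontr)
      assume "\<not> n > 0"
      then obtain c where "p = [:c:]" using degree_eq_zeroE[of p] unfolding n_def by blast
      then show False using p wB by (auto simp: poly_over_def coeff_pCons split: nat.splits)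
    qed
    define s where "s = (\<Sum>i=1..degree r. monom (coeff r i) (n - i))"
    define p' where "p' = (p - monom (coeff p n) n) + Polynomial.smult (e * z * coeff p n) s"
    have sB: "poly_over B s"
      unfolding poly_over_def s_def coeff_sum coeff_monom using r B
      by (auto intro!: subring_sum subring_0 simp: poly_over_def)
    have p'B: "poly_over B p'" unfolding p'_def using B p e z pn sB
      by (intro poly_over_subring_intros subring_mult)
    have "w = coeff r 0 + (\<Sum>i=1..degree r. coeff r i * inverse x ^ i)"
      unfolding r(2)[symmetric] poly_altdef
      by (simp add: sum.atLeast1_atMost_eq sum.atMost_shift)
    then have "w * x ^ n = coeff r 0 * x ^ n + (\<Sum>i=1..degree r. coeff r i * inverse x ^ i * x ^ n)"
      by (simp add: algebra_simps sum_distrib_left)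
    also have "(\<Sum>i=1..degree r. coeff r i * inverse x ^ i * x ^ n) = poly s x"
      unfolding s_def poly_sum poly_monom
    proof (intro sum.cong refl)
      fix i assume "i \<in> {1..degree r}"
      then have "x ^ n = x ^ i * x ^ (n - i)" using d by (simp add: n_def flip: power_add)
      then show "coeff r i * inverse x ^ i * x ^ n = coeff r i * x ^ (n - i)"
        using x0 by (simp add: field_simps)
    qed
    finally have wx: "w * x ^ n = coeff r 0 * x ^ n + poly s x" .
    have "(z * w) * x ^ n = z * (w * x ^ n)" by (simp only: mult.assoc)
    also have "\<dots> = z * coeff r 0 * x ^ n + z * poly s x" unfolding wx by (simp add: algebra_simps)
    finally have "(z * w) * x ^ n = z * coeff r 0 * x ^ n + z * poly s x" .
    then have "(1 - z * coeff r 0) * x ^ n = z * poly s x"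
      unfolding z(2) by (simp add: algebra_simps)
    then have "e * (1 - z * coeff r 0) * x ^ n = e * z * poly s x" by (simp add: mult.assoc)
    then have xn: "x ^ n = e * z * poly s x" using e(2) by simp
    have "poly p' x = poly p x - coeff p n * x ^ n + coeff p n * (e * z * poly s x)"
      by (simp add: p'_def poly_monom)
    then have val: "poly p' x = w" using xn p(2) by simp
    have "degree (p - monom (coeff p n) n) < n"
      using n0 by (intro degree_lessI) (auto simp: coeff_eq_0 n_def coeff_monom)
    moreover have "degree s \<le> n - 1" unfolding s_def
      by (intro degree_sum_le) (auto intro: order.trans[OF degree_monom_le])
    ultimately have "degree p' < n" unfolding p'_def using n0
      by (intro degree_add_less) (auto intro: le_less_trans[OF degree_smult_le])
    then show ?thesis using p'B val unfolding n_def by blast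
  qed
  have "x \<in> B \<or> inverse x \<in> B" if x0: "x \<noteq> 0" for x
  proof (rule ccontr)
    assume "\<not> (x \<in> B \<or> inverse x \<in> B)"
    then have ex: "\<exists>p. poly_over B p \<and> poly p x = w" "\<exists>p. poly_over B p \<and> poly p (inverse x) = w"
      using w_value by auto
    obtain p where p: "poly_over B p" "poly p x = w"
        "\<And>p'. poly_over B p' \<Longrightarrow> poly p' x = w \<Longrightarrow> degree p \<le> degree p'"
      using ex_has_least_nat[of "\<lambda>p. poly_over B p \<and> poly p x = w" _ degree] ex(1) by blast
    obtain r where r: "poly_over B r" "poly r (inverse x) = w"
        "\<And>p'. poly_over B p' \<Longrightarrow> poly p' (inverse x) = w \<Longrightarrow> degree r \<le> degree p'"
      using ex_has_least_nat[of "\<lambda>p. poly_over B p \<and> poly p (inverse x) = w" _ degree] ex(2) by blast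
    show False
    proof (cases "degree r \<le> degree p")
      case True
      then show False using reduce[OF p(1,2) r(1,2) True x0] p(3) by (metis not_le)
    next
      case False
      then show False using reduce[OF r(1,2), of p] p(1,2) x0 r(3)
        by (metis inverse_inverse_eq inverse_nonzero_iff_nonzero nle_le not_le)
    qed
  qed
  then show ?thesis using B by (auto simp: valuation_ring_def)
qed

text \<open>Zorn's lemma is applied to the subrings that contain \<open>R\<close> and 1/w but not w;
  the hypothesis says that R[1/w] is one of them.\<close>

theorem exists_valuation_ring:
  fixes R :: "'l::field set"
  assumes R: "is_subring R" and w: "\<And>p. poly_over R p \<Longrightarrow> poly p (inverse w) \<noteq> w"
  shows "\<exists>V. valuation_ring V \<and> R \<subseteq> V \<and> w \<notin> V"
proof -
  define \<A> where "\<A> = {B. is_subring B \<and> R \<subseteq> B \<and> inverse w \<in> B \<and> w \<notin> B}"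
  have w0: "w \<noteq> 0" using w[of 0] poly_over_subring_0[OF R] by auto
  have "(\<lambda>p. poly p (inverse w)) ` {p. poly_over R p} \<in> \<A>"
    unfolding \<A>_def using subring_poly_values[OF R, of "inverse w"] w by fastforce
  then have ne: "\<A> \<noteq> {}" by auto
  have "\<exists>M\<in>\<A>. \<forall>X\<in>\<A>. M \<subseteq> X \<longrightarrow> X = M"
  proof (rule subset_Zorn_nonempty[OF ne])
    fix C assume C: "C \<noteq> {}" "subset.chain \<A> C"
    then have CA: "\<And>B. B \<in> C \<Longrightarrow> B \<in> \<A>" by (auto simp: subset_chain_def)
    obtain B0 where B0: "B0 \<in> C" using C by auto
    have "is_subring (\<Union>C)" unfolding is_subring_def
    proof (intro conjI ballI)
      show "1 \<in> \<Union>C" using B0 CA by (auto simp: \<A>_def subring_1)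
      fix x y assume "x \<in> \<Union>C" "y \<in> \<Union>C"
      then obtain B1 B2 where B12: "B1 \<in> C" "B2 \<in> C" "x \<in> B1" "y \<in> B2" by auto
      then obtain B where "B \<in> C" "x \<in> B" "y \<in> B" using C(2) unfolding subset_chain_def by blast
      then show "x - y \<in> \<Union>C" "x * y \<in> \<Union>C"
        using CA[of B] by (auto simp: \<A>_def intro: subring_diff subring_mult)
    qed
    then show "\<Union>C \<in> \<A>" using CA B0 unfolding \<A>_def by blast
  qed
  then obtain M where M: "M \<in> \<A>" "\<And>X. X \<in> \<A> \<Longrightarrow> M \<subseteq> X \<Longrightarrow> X = M" by blast
  have "valuation_ring M"
    using M w0 by (intro maximal_subring_valuation_ring[of _ w]) (auto simp: \<A>_def)
  then show ?thesis using M by (auto simp: \<A>_def)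
qed

text \<open>An equality w = p(1/w) would become a monic equation for w after multiplication by a
  power of w. The valuation ring obtained is a place at which w is infinite.\<close>

lemma exists_valuation_ring_transcendental:
  assumes R: "is_subfield R" and w: "\<not> algebraic_in R w"
  shows "\<exists>V. valuation_ring V \<and> R \<subseteq> V \<and> w \<notin> V"
proof (rule exists_valuation_ring[OF subfield_subring[OF R]])
  fix p assume p: "poly_over R p"
  show "poly p (inverse w) \<noteq> w"
  proof
    assume e: "poly p (inverse w) = w"
    have w0: "w \<noteq> 0"
      using w poly_over_pCons[OF R subfield_0[OF R] poly_over_1[OF R]]
      unfolding algebraic_in_def by (metis mult_zero_left one_neq_zero pCons_eq_0_iff poly_pCons add_0)
    define n where "n = degree p"
    define s where "s = monom 1 (Suc n) - (\<Sum>i\<le>n. monom (coeff p i) (n - i))"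
    have "coeff (\<Sum>i\<le>n. monom (coeff p i) (n - i)) (Suc n) = 0"
      by (auto simp: coeff_sum coeff_monom intro!: sum.neutral)
    then have "coeff s (Suc n) = 1" by (simp add: s_def coeff_monom)
    then have s0: "s \<noteq> 0" by auto
    have "poly_over R (\<Sum>i\<le>n. monom (coeff p i) (n - i))"
      unfolding poly_over_def coeff_sum coeff_monom using R p
      by (auto intro!: subfield_sum subfield_0 simp: poly_over_def)
    then have sR: "poly_over R s" unfolding s_def
      using R by (intro poly_over_diff poly_over_monom subfield_1)
    have "w ^ Suc n = poly p (inverse w) * w ^ n" using e by simp
    also have "\<dots> = (\<Sum>i\<le>n. coeff p i * w ^ (n - i))"
      unfolding poly_altdef n_def sum_distrib_right
    proof (intro sum.cong refl)
      fix i assume "i \<in> {..degree p}"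
      then have "w ^ degree p = w ^ i * w ^ (degree p - i)" by (simp flip: power_add)
      then show "coeff p i * inverse w ^ i * w ^ degree p = coeff p i * w ^ (degree p - i)"
        using w0 by (simp add: field_simps)
    qed
    finally have "poly s w = 0" by (simp add: s_def poly_monom poly_sum)
    then show False using w s0 sR unfolding algebraic_in_def by blast
  qed
qed

section \<open>Sizes at a place that is trivial on the subfield \<open>R\<close>\<close>

locale valuation =
  fixes R V :: "'l::field set"
  assumes R: "is_subfield R" and V: "valuation_ring V" and RV: "R \<subseteq> V"
begin

text \<open>Read \<open>x \<preceq> y\<close> as |x| \<le> |y|; divisibility in \<open>V\<close>
  replaces the value group. Elements of \<open>V\<close> are the finite ones,
  \<open>\<not> 1 \<preceq> s\<close> says that s is infinitesimal, and
  \<open>\<not> s \<preceq> 1\<close> that it is infinite.\<close>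

definition le :: "'l \<Rightarrow> 'l \<Rightarrow> bool" (infix "\<preceq>" 50) where
  "x \<preceq> y \<longleftrightarrow> (\<exists>v\<in>V. x = v * y)"

definition sim :: "'l \<Rightarrow> 'l \<Rightarrow> bool" (infix "\<approx>" 50) where
  "x \<approx> y \<longleftrightarrow> x \<preceq> y \<and> y \<preceq> x"

lemma VS: "is_subring V" using V by (simp add: valuation_ring_def)

lemma le_1_iff: "x \<preceq> 1 \<longleftrightarrow> x \<in> V" by (simp add: le_def)

lemma le_refl [simp]: "x \<preceq> x" using subring_1[OF VS] by (auto simp: le_def intro!: bexI[of _ 1])

lemma le_trans [trans]: "x \<preceq> y \<Longrightarrow> y \<preceq> z \<Longrightarrow> x \<preceq> z"
  unfolding le_def using subring_mult[OF VS] by (metis mult.assoc)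

lemma le_total: "x \<preceq> y \<or> y \<preceq> x"
proof (cases "x = 0 \<or> y = 0")
  case True then show ?thesis using subring_0[OF VS] by (auto simp: le_def)
next
  case False
  then have "x / y \<in> V \<or> inverse (x / y) \<in> V" using V unfolding valuation_ring_def by (metis divide_eq_0_iff)
  moreover have "x = (x / y) * y" "y = inverse (x / y) * x" using False by auto
  ultimately show ?thesis unfolding le_def by blast
qed

lemma zero_le [simp]: "0 \<preceq> x" using subring_0[OF VS] by (auto simp: le_def intro!: bexI[of _ 0])

lemma le_zero: "x \<preceq> 0 \<longleftrightarrow> x = 0" by (auto simp: le_def intro: subring_0[OF VS])

lemma le_mult: "a \<preceq> b \<Longrightarrow> c \<preceq> d \<Longrightarrow> a * c \<preceq> b * d"
  unfolding le_def
proof (elim bexE)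
  fix v w assume "v \<in> V" "w \<in> V" "a = v * b" "c = w * d"
  then show "\<exists>v\<in>V. a * c = v * (b * d)"
    using subring_mult[OF VS] by (intro bexI[of _ "v * w"]) auto
qed

lemma le_power: "a \<preceq> b \<Longrightarrow> a ^ n \<preceq> b ^ n"
  by (induction n) (auto intro: le_mult)

lemma le_add: "a \<preceq> c \<Longrightarrow> b \<preceq> c \<Longrightarrow> a + b \<preceq> c"
  unfolding le_def using subring_add[OF VS] by (metis distrib_right)

lemma le_uminus: "a \<preceq> c \<Longrightarrow> - a \<preceq> c"
  unfolding le_def using subring_uminus[OF VS] by (metis mult_minus_left)

lemma le_diff: "a \<preceq> c \<Longrightarrow> b \<preceq> c \<Longrightarrow> a - b \<preceq> c"
  using le_add[of a c "- b"] le_uminus[of b c] by simp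

lemma le_sum: "(\<And>i. i \<in> S \<Longrightarrow> f i \<preceq> c) \<Longrightarrow> sum f S \<preceq> c"
  by (induction S rule: infinite_finite_induct) (auto intro: le_add)

lemma le_mult_cancel: "c \<noteq> 0 \<Longrightarrow> a * c \<preceq> b * c \<longleftrightarrow> a \<preceq> b"
  by (auto simp: le_def)

lemma le_divide_iff: "c \<noteq> 0 \<Longrightarrow> a / c \<preceq> b \<longleftrightarrow> a \<preceq> b * c"
  using le_mult_cancel[of c "a / c" b] by simp

lemma le_divide_iff2: "c \<noteq> 0 \<Longrightarrow> b \<preceq> a / c \<longleftrightarrow> b * c \<preceq> a"
  using le_mult_cancel[of c b "a / c"] by simp

lemma sim_refl [simp]: "x \<approx> x" by (simp add: sim_def)
lemma sim_sym: "x \<approx> y \<Longrightarrow> y \<approx> x" by (simp add: sim_def)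
lemma sim_trans [trans]: "x \<approx> y \<Longrightarrow> y \<approx> z \<Longrightarrow> x \<approx> z" using le_trans by (auto simp: sim_def)
lemma sim_mult: "a \<approx> b \<Longrightarrow> c \<approx> d \<Longrightarrow> a * c \<approx> b * d" by (auto simp: sim_def le_mult)
lemma sim_power: "a \<approx> b \<Longrightarrow> a ^ n \<approx> b ^ n" by (auto simp: sim_def le_power)
lemma sim_zero: "a \<approx> b \<Longrightarrow> a = 0 \<longleftrightarrow> b = 0" by (auto simp: sim_def le_zero)

lemma sim_divide: "a \<approx> b \<Longrightarrow> c \<approx> d \<Longrightarrow> a / c \<approx> b / d"
proof (cases "c = 0")
  case True
  assume "a \<approx> b" "c \<approx> d"
  then show ?thesis using True sim_zero[of c d] by auto
next
  case False
  assume ab: "a \<approx> b" and cd: "c \<approx> d"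
  then have d: "d \<noteq> 0" using False sim_zero by blast
  have "a * d \<approx> b * c" using ab cd by (auto simp: sim_def le_mult)
  then show ?thesis using False d by (simp add: sim_def le_divide_iff le_divide_iff2 mult.commute)
qed

text \<open>With b = v a and a + b = u a, the claim amounts to \<open>V\<close> being local: v and u
  = 1 + v cannot both be non-units.\<close>

lemma sim_add: "\<not> a \<preceq> b \<Longrightarrow> a + b \<approx> a"
proof -
  assume ab: "\<not> a \<preceq> b"
  then have ba: "b \<preceq> a" using le_total by blast
  then have 1: "a + b \<preceq> a" by (intro le_add) auto
  have "a \<preceq> a + b"
  proof (rule ccontr)
    assume n: "\<not> a \<preceq> a + b"
    obtain v where v: "v \<in> V" "b = v * a" using ba by (auto simp: le_def)
    obtain u where u: "u \<in> V" "a + b = u * a" using 1 by (auto simp: le_def)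
    have a0: "a \<noteq> 0" using ab by auto
    have "\<not> inverse v \<in> V" if "v \<noteq> 0"
      using ab v that by (auto simp: le_def)
    then have "v = 0 \<or> inverse v \<notin> V" by auto
    have uv: "u = 1 + v" using u v a0 by (metis distrib_right mult_1 mult_cancel_right)
    show False
    proof (cases "u = 0")
      case True
      then have "v = - 1" using uv by (simp add: eq_neg_iff_add_eq_0 add.commute)
      then have "- 1 \<in> V" "a = - 1 * b" using v by auto
      then show False using ab unfolding le_def by blast
    next
      case False
      then have "inverse u \<notin> V" using n u by (auto simp: le_def)
      moreover have u1: "u = 1 + v" by fact
      have "v \<noteq> 0" using \<open>inverse u \<notin> V\<close> u1 subring_1[OF VS] by auto
      then have iv: "inverse v \<notin> V" using \<open>v = 0 \<or> inverse v \<notin> V\<close> by auto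
      have "inverse (inverse u - 1) \<in> V \<or> inverse u - 1 \<in> V" if "inverse u \<noteq> 1"
        using V that unfolding valuation_ring_def by (metis right_minus_eq)
      moreover have "inverse u \<noteq> 1" using u1 \<open>v \<noteq> 0\<close> by auto
      moreover have "inverse u - 1 \<in> V \<Longrightarrow> inverse u \<in> V" using subring_add[OF VS _ subring_1[OF VS]] by fastforce
      ultimately have "inverse (inverse u - 1) \<in> V" by blast
      moreover have "inverse u - 1 = - v / u" using False u1 by (simp add: field_simps)
      ultimately have "- (u / v) \<in> V" by simp
      then have "u / v \<in> V" using subring_uminus[OF VS, of "- (u / v)"] by simp
      moreover have "u / v = inverse v + 1" using u1 \<open>v \<noteq> 0\<close> by (simp add: field_simps)
      ultimately show False using iv subring_diff[OF VS _ subring_1[OF VS], of "u / v"] by simp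
    qed
  qed
  with 1 show ?thesis by (simp add: sim_def)
qed

lemma sim_one_of_subfield: "c \<in> R \<Longrightarrow> c \<noteq> 0 \<Longrightarrow> c \<approx> 1"
proof -
  assume c: "c \<in> R" "c \<noteq> 0"
  then have "c \<in> V" "inverse c \<in> V" using RV subfield_inverse[OF R] by auto
  then show ?thesis using c by (auto simp: sim_def le_def intro!: bexI[of _ "inverse c"])
qed

lemma poly_le_1: "poly_over R p \<Longrightarrow> s \<preceq> 1 \<Longrightarrow> poly p s \<preceq> 1"
  unfolding le_1_iff using poly_in_subring[OF VS poly_over_mono[OF RV]] by blast

text \<open>Near 0 the constant term dominates, and nonzero elements of \<open>R\<close> have size
  one.\<close>

lemma poly_sim_infinitesimal:
  assumes p: "poly_over R p" "coeff p 0 \<noteq> 0" and s: "\<not> 1 \<preceq> s"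
  shows "poly p s \<approx> 1"
proof -
  have s1: "s \<preceq> 1" using s le_total by blast
  obtain c p' where cp: "p = pCons c p'" by (cases p)
  then have c: "c \<in> R" "c \<noteq> 0" and p': "poly_over R p'"
    using p by (auto simp: poly_over_def coeff_pCons split: nat.splits)
  have cs: "c \<approx> 1" using sim_one_of_subfield c by blast
  have "s * poly p' s \<preceq> s * 1" using poly_le_1[OF p' s1] by (intro le_mult) auto
  then have "s * poly p' s \<preceq> s" by simp
  then have "\<not> c \<preceq> s * poly p' s" using s cs le_trans by (meson sim_def)
  from sim_add[OF this] show ?thesis using cs sim_trans by (simp add: cp)
qed

text \<open>Near infinity the leading term dominates: even after multiplication by s, the lower
  terms have at most the size of s^n.\<close>

lemma poly_sim_infinite:
  assumes p: "poly_over R p" "p \<noteq> 0" and s: "\<not> s \<preceq> 1"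
  shows "poly p s \<approx> s ^ degree p"
proof -
  have s1: "1 \<preceq> s" and s0: "s \<noteq> 0" using s le_total by auto
  define n where "n = degree p"
  define t where "t = (\<Sum>i<n. coeff p i * s ^ i)"
  have ps: "poly p s = coeff p n * s ^ n + t"
    unfolding poly_altdef n_def t_def by (simp add: lessThan_Suc_atMost[symmetric])
  have c: "coeff p n \<in> R" "coeff p n \<noteq> 0" using p by (auto simp: poly_over_def n_def)
  have cs: "coeff p n * s ^ n \<approx> 1 * s ^ n" by (intro sim_mult sim_one_of_subfield c) auto
  have "t * s \<preceq> s ^ n" unfolding t_def sum_distrib_right
  proof (intro le_sum)
    fix i assume "i \<in> {..<n}"
    then obtain k where n: "n = Suc i + k" using less_iff_Suc_add by auto
    have "coeff p i \<preceq> 1" using p RV by (auto simp: le_1_iff poly_over_def)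
    moreover have "1 ^ k \<preceq> s ^ k" using s1 by (rule le_power)
    ultimately have "(coeff p i * s ^ Suc i) * 1 \<preceq> (1 * s ^ Suc i) * s ^ k" by (intro le_mult) auto
    then show "coeff p i * s ^ i * s \<preceq> s ^ n" by (simp add: n power_add mult_ac)
  qed
  moreover have "\<not> s ^ n * s \<preceq> s ^ n" using s le_mult_cancel[of "s ^ n" s 1] s0 by (simp add: mult.commute)
  ultimately have "\<not> s ^ n * s \<preceq> t * s" using le_trans by blast
  then have "\<not> s ^ n \<preceq> t" using le_mult_cancel s0 by blast
  then have "\<not> coeff p n * s ^ n \<preceq> t" using cs le_trans by (auto simp: sim_def)
  from sim_add[OF this] show ?thesis using cs sim_trans unfolding ps n_def[symmetric] by simp
qed

text \<open>At an infinite w a nonzero polynomial over \<open>R\<close> has the size of a power of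
  w, hence cannot vanish. This makes places a test for transcendence over \<open>R\<close>.\<close>

lemma algebraic_le_1:
  assumes "algebraic_in R w" shows "w \<preceq> 1"
proof (rule ccontr)
  assume w: "\<not> w \<preceq> 1"
  obtain p where p: "p \<noteq> 0" "poly_over R p" "poly p w = 0" using assms by (auto simp: algebraic_in_def)
  have "w \<noteq> 0" using w by auto
  then show False using poly_sim_infinite[OF p(2,1) w] p(3) sim_zero by fastforce
qed

lemma adjoin_algebraic_subset:
  assumes "algebraic_in R w" shows "adjoin R {w} \<subseteq> V"
  using adjoin_algebraic_eq[OF R assms] poly_le_1 algebraic_le_1[OF assms] by (auto simp: le_1_iff)

lemma le_inverse_iff: "x \<noteq> 0 \<Longrightarrow> \<not> inverse x \<preceq> 1 \<longleftrightarrow> \<not> 1 \<preceq> x"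
  using le_mult_cancel[of x "inverse x" 1] by simp

end

section \<open>Towers recursively defined by a rational function and an involution\<close>

lemma poly_map_poly_hom_on_fixed:
  assumes K: "is_subfield K" and h: "hom_on K \<sigma>" and R: "R \<subseteq> K" "\<And>r. r \<in> R \<Longrightarrow> \<sigma> r = r"
    and p: "poly_over R p" and x: "x \<in> K"
  shows "\<sigma> (poly p x) = poly p (\<sigma> x)"
proof -
  have "map_poly \<sigma> p = p"
    using p R(2) by (intro poly_eqI) (auto simp: coeff_map_poly hom_on_0[OF K h] poly_over_def)
  then show ?thesis using hom_on_poly[OF K h poly_over_mono[OF R(1) p] x] by simp
qed

text \<open>The function A / (X B) has a simple pole at 0, a pole of order \<open>Q\<close> at
  infinity, and its other poles at the zeros of \<open>B\<close>, which s |-> \<kappa> / s permutes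
  by \<open>reciprocal\<close>. The identity \<open>bezout\<close> also keeps A and B from being
  infinitesimal simultaneously at any place, which the absence of common zeros alone would not say
  directly.\<close>

locale involutive_cover =
  fixes R :: "'l::alg_closed_field set" and A B :: "'l poly" and \<kappa> :: 'l and Q :: nat
  assumes R: "is_subfield R" and A: "poly_over R A" and B: "poly_over R B"
    and A0: "coeff A 0 \<noteq> 0" and B0: "coeff B 0 \<noteq> 0"
    and degA: "degree A = Q + 1 + degree B" and Q: "Q > 1"
    and \<kappa>: "\<kappa> \<in> R" "\<kappa> \<noteq> 0"
    and bezout: "\<exists>a b. poly_over R a \<and> poly_over R b \<and> a * A + b * B = 1"
    and reciprocal: "\<exists>c\<in>R. c \<noteq> 0 \<and> (\<forall>s. s \<noteq> 0 \<longrightarrow> poly B (\<kappa> / s) * s ^ degree B = c * poly B s)"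
begin

definition J :: "'l \<Rightarrow> 'l" where
  "J s = poly A s / (s * poly B s)"

lemma A_nz: "A \<noteq> 0" and B_nz: "B \<noteq> 0" using A0 B0 by auto

lemma J_in_subfield:
  assumes "is_subfield K" "R \<subseteq> K" "s \<in> K" shows "J s \<in> K"
  unfolding J_def using assms poly_in_subring[OF subfield_subring[OF assms(1)]] A B
  by (intro subfield_divide subfield_mult) (auto intro: poly_over_mono)

lemma B_involution_nz: "s \<noteq> 0 \<Longrightarrow> poly B s \<noteq> 0 \<Longrightarrow> poly B (\<kappa> / s) \<noteq> 0"
  using reciprocal by force

definition fiber_poly :: "'l \<Rightarrow> 'l poly" where
  "fiber_poly j = A - Polynomial.smult j ([:0, 1:] * B)"

lemma poly_fiber_poly: "s \<noteq> 0 \<Longrightarrow> poly B s \<noteq> 0 \<Longrightarrow> poly (fiber_poly (J s)) s = 0"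
  by (simp add: fiber_poly_def J_def)

lemma fiber_poly_nz: "fiber_poly j \<noteq> 0"
proof
  assume "fiber_poly j = 0"
  then have "coeff (fiber_poly j) 0 = 0" by simp
  then show False using A0 by (simp add: fiber_poly_def)
qed

lemma fiber_poly_over:
  assumes "is_subfield K" "R \<subseteq> K" "j \<in> K" shows "poly_over K (fiber_poly j)"
  unfolding fiber_poly_def using assms poly_over_mono[OF assms(2)] A B
  by (intro poly_over_diff poly_over_subring_smult[OF subfield_subring] poly_over_mult poly_over_pCons poly_over_0)
     (auto intro: subfield_0 subfield_1 poly_over_pCons poly_over_0 poly_over_1)

text \<open>In positive characteristic \<open>J\<close> might be inseparable. The numerator
  \<open>D\<close> of its derivative, however, has constant term - A(0) B(0), so it is a nonzero
  polynomial over \<open>R\<close> and does not vanish at a transcendental s. At s it agrees, up to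
  a nonzero factor, with the derivative of the fiber polynomial.\<close>

lemma fiber_poly_simple_root:
  assumes s: "s \<noteq> 0" "poly B s \<noteq> 0" and tr: "\<not> algebraic_in R s"
  shows "poly (pderiv (fiber_poly (J s))) s \<noteq> 0"
proof -
  define D where "D = pderiv A * ([:0, 1:] * B) - A * pderiv ([:0, 1:] * B)"
  have pd: "poly_over R p \<Longrightarrow> poly_over R (pderiv p)" for p :: "'l poly"
  proof -
    have "of_nat n \<in> R" for n
      using R by (induction n) (auto intro: subfield_0 subfield_1 subfield_add)
    then show "poly_over R p \<Longrightarrow> poly_over R (pderiv p)"
      unfolding poly_over_def coeff_pderiv using subfield_mult[OF R] by blast
  qed
  have XB: "poly_over R ([:0, 1:] * B)" using R B
    by (intro poly_over_mult poly_over_pCons poly_over_0 subfield_0 subfield_1)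
  have DR: "poly_over R D" unfolding D_def using R A XB pd
    by (intro poly_over_diff[OF R] poly_over_mult[OF R A] poly_over_mult[OF R _ XB]) auto
  have "coeff D 0 = - (coeff A 0 * coeff B 0)"
    by (simp add: D_def coeff_mult pderiv_mult pderiv_pCons)
  then have "D \<noteq> 0" using A0 B0 by auto
  then have "poly D s \<noteq> 0" using DR tr by (auto simp: algebraic_in_def)
  moreover have "poly D s = s * poly B s * poly (pderiv (fiber_poly (J s))) s"
    using s unfolding D_def fiber_poly_def J_def pderiv_diff pderiv_smult
    by (simp add: field_simps)
  ultimately show ?thesis by auto
qed

end

locale involutive_cover_valuation = involutive_cover R A B \<kappa> Q + valuation R V
  for R V :: "'l::alg_closed_field set" and A B \<kappa> Q
begin

lemma \<kappa>_sim: "\<kappa> \<approx> 1" by (rule sim_one_of_subfield[OF \<kappa>])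

lemma infinite_involution:
  assumes "s \<noteq> 0" shows "\<not> 1 \<preceq> \<kappa> / s \<longleftrightarrow> \<not> s \<preceq> 1"
  using assms \<kappa>_sim le_trans[of s \<kappa> 1] le_trans[of s 1 \<kappa>] by (auto simp: le_divide_iff2 sim_def)

lemma J_infinitesimal:
  assumes s: "\<not> 1 \<preceq> s" shows "J s \<approx> 1 / s"
proof -
  have "J s \<approx> 1 / (s * 1)" unfolding J_def
    by (intro sim_divide sim_mult sim_refl poly_sim_infinitesimal s A B A0 B0)
  then show ?thesis by simp
qed

lemma J_infinite:
  assumes s: "\<not> s \<preceq> 1" shows "J s \<approx> s ^ Q"
proof -
  have s0: "s \<noteq> 0" using s by auto
  have "J s \<approx> s ^ degree A / (s * s ^ degree B)" unfolding J_def
    by (intro sim_divide sim_mult sim_refl poly_sim_infinite s A B A_nz B_nz)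
  then show ?thesis using s0 by (simp add: degA power_add)
qed

text \<open>Close to a zero of \<open>B\<close> the value of \<open>A\<close> is a unit, since
  otherwise the Bezout identity would make 1 infinitesimal.\<close>

lemma J_unit:
  assumes y: "y \<approx> 1" and By: "\<not> 1 \<preceq> poly B y" shows "J y \<approx> 1 / poly B y"
proof -
  obtain a b where ab: "poly_over R a" "poly_over R b" "a * A + b * B = 1" using bezout by blast
  have y1: "y \<preceq> 1" using y by (simp add: sim_def)
  have A1: "poly A y \<preceq> 1" using poly_le_1 A y1 by blast
  have "1 \<preceq> poly A y"
  proof (rule ccontr)
    assume Ay: "\<not> 1 \<preceq> poly A y"
    obtain t where t: "poly A y \<preceq> t" "poly B y \<preceq> t" "\<not> 1 \<preceq> t"
      using Ay By le_total le_refl by metis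
    have "poly a y * poly A y \<preceq> 1 * t" "poly b y * poly B y \<preceq> 1 * t"
      using poly_le_1[OF _ y1] ab(1,2) t by (auto intro!: le_mult simp del: mult_1)
    then have "poly a y * poly A y + poly b y * poly B y \<preceq> 1 * t" by (rule le_add)
    moreover have "poly a y * poly A y + poly b y * poly B y = 1"
      using arg_cong[OF ab(3), of "\<lambda>p. poly p y"] by simp
    ultimately show False using t by simp
  qed
  then have "poly A y \<approx> 1" using A1 by (simp add: sim_def)
  then have "J y \<approx> 1 / (1 * poly B y)" unfolding J_def by (intro sim_divide sim_mult y sim_refl)
  then show ?thesis by simp
qed

lemma J_involution_sim:
  assumes s: "s \<noteq> 0" "\<not> s \<preceq> 1" shows "J (\<kappa> / s) \<approx> s"
proof -
  have "\<not> 1 \<preceq> \<kappa> / s" using infinite_involution s by blast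
  then have "J (\<kappa> / s) \<approx> 1 / (\<kappa> / s)" by (rule J_infinitesimal)
  also have "1 / (\<kappa> / s) = s / \<kappa>" by simp
  also have "s / \<kappa> \<approx> s / 1" by (intro sim_divide sim_refl \<kappa>_sim)
  finally show ?thesis by simp
qed

lemma J_involution_notin: "s \<noteq> 0 \<Longrightarrow> s \<notin> V \<Longrightarrow> J (\<kappa> / s) \<notin> V"
  using J_involution_sim[of s] le_trans[of s "J (\<kappa> / s)" 1] unfolding sim_def le_1_iff[symmetric] by auto

lemma le_self_power: "1 \<preceq> x \<Longrightarrow> n > 0 \<Longrightarrow> x \<preceq> x ^ n"
  using le_mult[of x x "1" "x ^ (n - 1)"] le_power[of 1 x "n - 1"]
  by (cases n) auto

text \<open>Put y = \<kappa> / v. The poles of \<open>J\<close> are of three kinds, and the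
  involution exchanges 0 with infinity and preserves the zeros of \<open>B\<close>. For y near 0,
  J(v) has the size of J(y)^Q; for infinite y it is J(y) that has the size of J(v)^Q; near a zero of
  \<open>B\<close> the sizes agree. Only the first kind gains the exponent \<open>Q\<close>, which
  the last clause records.\<close>

lemma J_step:
  assumes v: "v \<noteq> 0" "poly B v \<noteq> 0" and inf: "\<not> J (\<kappa> / v) \<preceq> 1"
  shows "\<not> J v \<preceq> 1 \<and> J v \<preceq> J (\<kappa> / v) ^ Q \<and> (\<not> 1 \<preceq> \<kappa> / v \<or> J v \<preceq> J (\<kappa> / v))"
proof -
  define y where "y = \<kappa> / v"
  have y0: "y \<noteq> 0" using v(1) \<kappa>(2) by (simp add: y_def)
  have vy: "v = \<kappa> / y" using \<kappa>(2) v(1) by (simp add: y_def)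
  have inf': "\<not> J y \<preceq> 1" using inf by (simp add: y_def)
  then have J1: "1 \<preceq> J y" using le_total by blast
  have JQ: "J y \<preceq> J y ^ Q" using J1 Q by (intro le_self_power) auto
  have pow_inf: "\<not> z ^ Q \<preceq> 1" if "\<not> z \<preceq> 1" for z
  proof -
    have "z \<preceq> z ^ Q" using that Q le_total by (intro le_self_power) auto
    then show ?thesis using that le_trans[of z "z ^ Q" 1] by auto
  qed
  consider "\<not> 1 \<preceq> y" | "\<not> y \<preceq> 1" | "y \<approx> 1" by (auto simp: sim_def)
  then have "\<not> J v \<preceq> 1 \<and> J v \<preceq> J y ^ Q \<and> (\<not> 1 \<preceq> y \<or> J v \<preceq> J y)"
  proof cases
    case 1
    then have vi: "\<not> v \<preceq> 1" using infinite_involution[OF v(1)] by (simp add: y_def)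
    have "J y \<approx> 1 / y" by (rule J_infinitesimal[OF 1])
    also have "1 / y = v / \<kappa>" by (simp add: y_def)
    also have "v / \<kappa> \<approx> v / 1" by (intro sim_divide sim_refl \<kappa>_sim)
    finally have Jy: "J y \<approx> v" by simp
    have "J v \<approx> v ^ Q" by (rule J_infinite[OF vi])
    moreover have "v ^ Q \<approx> J y ^ Q" using Jy by (intro sim_power) (rule sim_sym)
    ultimately have Jv: "J v \<approx> J y ^ Q" by (rule sim_trans)
    have "\<not> J y ^ Q \<preceq> 1" using pow_inf inf' by blast
    then have "\<not> J v \<preceq> 1" using Jv le_trans[of "J y ^ Q" "J v" 1] by (auto simp: sim_def)
    then show ?thesis using 1 Jv by (simp add: sim_def)
  next
    case 2
    have vi: "\<not> 1 \<preceq> v" using infinite_involution[OF y0] 2 by (simp add: vy)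
    have "J v \<approx> 1 / v" by (rule J_infinitesimal[OF vi])
    also have "1 / v = y / \<kappa>" using \<kappa>(2) by (simp add: y_def)
    also have "y / \<kappa> \<approx> y / 1" by (intro sim_divide sim_refl \<kappa>_sim)
    finally have Jv: "J v \<approx> y" by simp
    have "y \<preceq> y ^ Q" using 2 Q le_total by (intro le_self_power) auto
    moreover have "J y \<approx> y ^ Q" by (rule J_infinite[OF 2])
    ultimately have "y \<preceq> J y" using le_trans[of y "y ^ Q" "J y"] by (simp add: sim_def)
    then have le: "J v \<preceq> J y" using Jv le_trans[of "J v" y "J y"] by (simp add: sim_def)
    moreover have "\<not> J v \<preceq> 1" using Jv 2 le_trans[of y "J v" 1] by (auto simp: sim_def)
    ultimately show ?thesis using le_trans[OF le JQ] by blast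
  next
    case 3
    have Ay: "poly A y \<preceq> 1" using poly_le_1[OF A] 3 by (auto simp: sim_def)
    have By0: "poly B y \<noteq> 0" using B_involution_nz[OF v] by (simp add: y_def)
    have By: "\<not> 1 \<preceq> poly B y"
    proof
      assume "1 \<preceq> poly B y"
      then have "1 * 1 \<preceq> y * poly B y" using 3 by (intro le_mult) (auto simp: sim_def)
      then have "poly A y \<preceq> 1 * (y * poly B y)" using le_trans[OF Ay, of "y * poly B y"] by simp
      then have "J y \<preceq> 1" unfolding J_def using y0 By0 by (subst le_divide_iff) auto
      then show False using inf' by simp
    qed
    have Jy: "J y \<approx> 1 / poly B y" by (rule J_unit[OF 3 By])
    have "v \<approx> 1 / 1" unfolding vy by (intro sim_divide \<kappa>_sim 3)
    then have v1: "v \<approx> 1" by simp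
    obtain c where c: "c \<in> R" "c \<noteq> 0" "poly B v * y ^ degree B = c * poly B y"
      using reciprocal y0 vy by blast
    then have "poly B v = c * poly B y / y ^ degree B" using y0 by (simp add: field_simps)
    also have "\<dots> \<approx> 1 * poly B y / 1 ^ degree B"
      using 3 sim_one_of_subfield c by (intro sim_divide sim_mult sim_refl sim_power)
    finally have Bv: "poly B v \<approx> poly B y" by simp
    have "\<not> 1 \<preceq> poly B v" using Bv By le_trans[of 1 "poly B v" "poly B y"] by (auto simp: sim_def)
    then have "J v \<approx> 1 / poly B v" by (rule J_unit[OF v1])
    also have "1 / poly B v \<approx> 1 / poly B y" using Bv by (intro sim_divide sim_refl)
    also have "1 / poly B y \<approx> J y" by (rule sim_sym[OF Jy])
    finally have "J v \<approx> J y" .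
    then show ?thesis using inf' JQ le_trans[of "J v" "J y" "J y ^ Q"] le_trans[of "J y" "J v" 1]
      by (auto simp: sim_def)
  qed
  then show ?thesis by (simp add: y_def)
qed

lemma poly_diff_le:
  assumes "poly_over R p" "s \<preceq> 1" "s' \<preceq> 1" shows "poly p s' - poly p s \<preceq> s' - s"
  using assms(1)
proof (induction p)
  case (pCons c p)
  then have p: "poly_over R p" by (auto simp: poly_over_def coeff_pCons split: nat.splits)
  have "poly (pCons c p) s' - poly (pCons c p) s = (s' - s) * poly p s' + s * (poly p s' - poly p s)"
    by (simp add: algebra_simps)
  also have "\<dots> \<preceq> (s' - s)"
    using le_mult[of "s' - s" "s' - s" "poly p s'" 1] le_mult[of s 1 "poly p s' - poly p s" "s' - s"]
      poly_le_1[OF p assms(3)] assms(2) pCons.IH[OF p] by (intro le_add) auto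
  finally show ?case .
qed auto

text \<open>The pole at 0 is simple. Cross-multiplying J(s) = J(s') bounds A(s) B(s) (s' - s) by (s'
  - s) times an infinitesimal, while A(s) B(s) is a unit.\<close>

lemma J_inj_infinitesimal:
  assumes s: "s \<noteq> 0" "\<not> 1 \<preceq> s" and s': "s' \<noteq> 0" "\<not> 1 \<preceq> s'" and eq: "J s = J s'"
  shows "s = s'"
proof (rule ccontr)
  assume ne: "s \<noteq> s'"
  define d where "d = s' - s"
  have d0: "d \<noteq> 0" using ne by (simp add: d_def)
  have s1: "s \<preceq> 1" "s' \<preceq> 1" using s s' le_total by auto
  have B1: "poly B s \<approx> 1" "poly B s' \<approx> 1" and A1: "poly A s \<approx> 1"
    using poly_sim_infinitesimal A A0 B B0 s s' by auto
  have Bnz: "poly B s \<noteq> 0" "poly B s' \<noteq> 0" using B1 sim_zero by fastforce+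
  have "poly A s * (s' * poly B s') = poly A s' * (s * poly B s)"
    using eq Bnz s s' unfolding J_def by (simp add: field_simps)
  then have e: "poly A s * poly B s * d =
      (poly A s' - poly A s) * (poly B s * s) - poly A s * ((poly B s' - poly B s) * s')"
    by (simp add: d_def algebra_simps)
  obtain t where t: "s \<preceq> t" "s' \<preceq> t" "\<not> 1 \<preceq> t" using s s' le_total le_refl by metis
  have "(poly A s' - poly A s) * (poly B s * s) \<preceq> d * (1 * t)"
    using poly_diff_le[OF A s1] B1 t by (intro le_mult) (auto simp: d_def sim_def)
  moreover have "poly A s * ((poly B s' - poly B s) * s') \<preceq> 1 * (d * t)"
    using poly_diff_le[OF B s1] A1 t by (intro le_mult) (auto simp: d_def sim_def)
  ultimately have "poly A s * poly B s * d \<preceq> d * t" unfolding e by (intro le_diff) auto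
  moreover have "1 * 1 * d \<approx> poly A s * poly B s * d"
    using A1 B1 by (intro sim_mult sim_refl) (auto intro: sim_sym)
  ultimately have "1 * d \<preceq> t * d"
    using le_trans[of "1 * 1 * d" "poly A s * poly B s * d" "d * t"] by (simp add: sim_def mult.commute)
  then show False using t d0 le_mult_cancel by blast
qed

lemma power_le_iff_infinite:
  assumes x: "\<not> x \<preceq> 1" and le: "x ^ m \<preceq> x ^ n" shows "m \<le> n"
proof (rule ccontr)
  assume "\<not> m \<le> n"
  then obtain k where m: "m = n + Suc k" by (metis add_Suc_right less_imp_Suc_add not_le)
  have x0: "x \<noteq> 0" using x by auto
  have "x ^ Suc k * x ^ n \<preceq> 1 * x ^ n" using le by (simp add: m power_add mult_ac)
  then have "x ^ Suc k \<preceq> 1" using le_mult_cancel x0 by (metis power_not_zero)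
  moreover have "x \<preceq> x ^ Suc k" using x le_total by (intro le_self_power) auto
  ultimately show False using x le_trans[of x "x ^ Suc k" 1] by blast
qed

end

context involutive_cover
begin

text \<open>If s were algebraic, R(s) would lie in every valuation ring above \<open>R\<close>, in
  particular in one where the transcendental J(s) is infinite.\<close>

lemma transcendental_of_J:
  assumes j: "\<not> algebraic_in R (J s)" shows "\<not> algebraic_in R s"
proof
  assume s: "algebraic_in R s"
  obtain V where V: "valuation_ring V" "R \<subseteq> V" "J s \<notin> V"
    using exists_valuation_ring_transcendental[OF R j] by blast
  then have "valuation R V" using R by unfold_locales auto
  then have "adjoin R {s} \<subseteq> V" using s by (rule valuation.adjoin_algebraic_subset)
  moreover have "J s \<in> adjoin R {s}"
    using adjoin_base[of R "{s}"] adjoin_gens[of "{s}" R] by (intro J_in_subfield subfield_adjoin) auto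
  ultimately show False using V by auto
qed

text \<open>At a place where s is infinite, \<kappa> / s approaches the simple pole 0, so J(\<kappa>
  / s) is as large as s.\<close>

lemma J_involution_transcendental:
  assumes s: "s \<noteq> 0" "\<not> algebraic_in R s" shows "\<not> algebraic_in R (J (\<kappa> / s))"
proof -
  obtain V where V: "valuation_ring V" "R \<subseteq> V" "s \<notin> V"
    using exists_valuation_ring_transcendental[OF R s(2)] by blast
  then have val: "valuation R V" using R by unfold_locales auto
  then have "involutive_cover_valuation R V A B \<kappa> Q"
    by (intro involutive_cover_valuation.intro involutive_cover_axioms)
  then have "J (\<kappa> / s) \<notin> V" using s V
    by (intro involutive_cover_valuation.J_involution_notin)
  then show ?thesis
    using valuation.adjoin_algebraic_subset[OF val] adjoin_gens[of "{J (\<kappa> / s)}" R] by auto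
qed

end

text \<open>Of the equation of Y-degree \<open>Q\<close> only the consequence
  \<open>ramified\<close> enters: a tower that is at infinity stays there, rather than moving to
  another point of the fiber of \<open>J\<close>.\<close>

locale recursive_tower = involutive_cover R A B \<kappa> Q
  for R :: "'l::alg_closed_field set" and A B \<kappa> Q +
  fixes u j :: "nat \<Rightarrow> 'l"
  assumes u_nz: "u e \<noteq> 0" and Bu_nz: "poly B (u e) \<noteq> 0"
    and j_eq: "j e = J (u e)" and j_Suc: "j (Suc e) = J (\<kappa> / u e)"
    and j0_transcendental: "\<not> algebraic_in R (j 0)"
    and ramified: "valuation R V \<Longrightarrow> u e \<notin> V \<Longrightarrow> u (Suc e) \<notin> V"
begin

lemma transcendental: "\<not> algebraic_in R (j e) \<and> \<not> algebraic_in R (u e)"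
proof (induction e)
  case 0
  then show ?case using j0_transcendental transcendental_of_J by (auto simp: j_eq)
next
  case (Suc e)
  then have "\<not> algebraic_in R (j (Suc e))" using J_involution_transcendental u_nz by (simp add: j_Suc)
  then show ?case using transcendental_of_J by (auto simp: j_eq)
qed

end

locale recursive_tower_valuation = recursive_tower R A B \<kappa> Q u j +
    involutive_cover_valuation R V A B \<kappa> Q
  for R V :: "'l::alg_closed_field set" and A B \<kappa> Q u j +
  assumes u0_infinite: "u 0 \<notin> V"
begin

text \<open>
  Conjugates over \<open>K = R(j\<^sub>0, j\<^sub>n)\<close> are separated by a place at which all \<open>u\<^sub>e\<close> are infinite:
  there \<open>j\<^sub>0\<close> has the order of \<open>j\<^sub>n\<close> to the power \<open>Q\<^sup>n\<close>, the largest possible, and this forces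
  every conjugate of \<open>\<kappa> / u\<^bsub>n-1\<^esub>\<close> to be infinitesimal. But \<open>J\<close> is injective on infinitesimals.
\<close>

lemma u_last_in_field:
  assumes n: "n \<ge> 1"
  shows "u (n - 1) \<in> adjoin R {j 0, j n}"
proof -
  define K where "K = adjoin R {j 0, j n}"
  define x where "x = \<kappa> / u (n - 1)"
  have K: "is_subfield K" and RK: "R \<subseteq> K" and jK: "j 0 \<in> K" "j n \<in> K"
    using subfield_adjoin adjoin_base[of R] adjoin_gens[of "{j 0, j n}" R] by (auto simp: K_def)
  have x0: "x \<noteq> 0" using \<kappa> u_nz by (simp add: x_def)
  have Bx: "poly B x \<noteq> 0" using B_involution_nz[OF u_nz Bu_nz] by (simp add: x_def)
  have jn: "j n = J x" using j_Suc[of "n - 1"] n by (simp add: x_def)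
  have u_inf: "\<not> u e \<preceq> 1" for e
    unfolding le_1_iff by (induction e) (use u0_infinite ramified[OF valuation_axioms] in auto)
  \<comment> \<open>At this place \<open>j (Suc e)\<close> has the size of \<open>u e\<close>, and
    \<open>j e\<close> that of its Q-th power, so every step contributes the exponent
    \<open>Q\<close>.\<close>
  have j_sim: "j e \<approx> j (Suc e) ^ Q" for e
  proof -
    have "u e ^ Q \<approx> j (Suc e) ^ Q"
      unfolding j_Suc by (intro sim_power sim_sym[OF J_involution_sim] u_nz u_inf)
    moreover have "j e \<approx> u e ^ Q" unfolding j_eq by (rule J_infinite[OF u_inf])
    ultimately show ?thesis using sim_trans by blast
  qed
  have j0_sim: "j 0 \<approx> j e ^ (Q ^ e)" for e
  proof (induction e)
    case (Suc e)
    have "j e ^ (Q ^ e) \<approx> (j (Suc e) ^ Q) ^ (Q ^ e)" by (intro sim_power j_sim)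
    then show ?case using sim_trans[OF Suc] by (simp add: power_mult)
  qed simp
  have j_inf: "\<not> j e \<preceq> 1" for e
  proof -
    have "j e \<approx> u e ^ Q" unfolding j_eq by (rule J_infinite[OF u_inf])
    moreover have "u e \<preceq> u e ^ Q" using u_inf Q le_total by (intro le_self_power) auto
    ultimately show ?thesis
      using u_inf[of e] le_trans[of "u e" "u e ^ Q" "j e"] le_trans[of "u e" "j e" 1] by (auto simp: sim_def)
  qed
  have "x \<in> K"
  proof (rule ccontr)
    assume xK: "x \<notin> K"
    \<comment> \<open>x is infinitesimal; were it algebraic, its inverse would be algebraic as well
      and lie in \<open>V\<close>.\<close>
    have "\<not> algebraic_in R x"
    proof
      assume a: "algebraic_in R x"
      have "\<not> 1 \<preceq> x" using u_inf infinite_involution[OF u_nz] by (simp add: x_def)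
      then have "inverse x \<notin> V" using le_inverse_iff[OF x0] by (simp add: le_1_iff)
      moreover have "inverse x \<in> adjoin R {x}"
        using adjoin_gens[of "{x}" R] by (intro subfield_inverse subfield_adjoin) auto
      ultimately show False using adjoin_algebraic_subset[OF a] by blast
    qed
    then have "poly (pderiv (fiber_poly (j n))) x \<noteq> 0"
      unfolding jn by (intro fiber_poly_simple_root x0 Bx)
    moreover have "poly (fiber_poly (j n)) x = 0" unfolding jn by (intro poly_fiber_poly x0 Bx)
    ultimately obtain \<tau> where \<tau>: "hom_on (adjoin K {x}) \<tau>" "\<forall>k\<in>K. \<tau> k = k" "\<tau> x \<noteq> x"
      using exists_conjugate[OF K fiber_poly_over[OF K RK jK(2)]] xK by blast
    define K1 where "K1 = adjoin K {x}"
    \<comment> \<open>The tower is descended from the top: \<open>w i\<close> is a root of the fiber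
      polynomial of \<open>j (n - i)\<close>, and \<kappa> / w i is the parameter that determines
      the j-invariant one step lower. This makes the conjugation extendable to all
      parameters.\<close>
    define w where "w = (\<lambda>i. \<kappa> / u (n - 1 - i))"
    have K1: "is_subfield K1" "K \<subseteq> K1" "x \<in> K1"
      using subfield_adjoin adjoin_base[of K] adjoin_gens[of "{x}" K] by (auto simp: K1_def)
    have alg: "algebraic_in (adjoin K1 (w ` {..<i})) (w i)" if i: "i < n" for i
    proof -
      define S where "S = adjoin K1 (w ` {..<i})"
      have S: "is_subfield S" "K1 \<subseteq> S" "w ` {..<i} \<subseteq> S"
        using subfield_adjoin adjoin_base[of K1] adjoin_gens[of "w ` {..<i}" K1] by (auto simp: S_def)
      have "j (n - i) \<in> S"
      proof (cases i)
        case 0 then show ?thesis using jK K1 S by auto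
      next
        case (Suc k)
        have "\<kappa> / w k \<in> S" using S K1 RK \<kappa> Suc by (intro subfield_divide) auto
        moreover have "\<kappa> / w k = u (n - i)" using Suc i \<kappa> by (simp add: w_def)
        ultimately show ?thesis unfolding j_eq[of "n - i"] using S K1 RK by (intro J_in_subfield) auto
      qed
      then have "poly_over S (fiber_poly (j (n - i)))" using S K1 RK by (intro fiber_poly_over) auto
      moreover have "poly (fiber_poly (j (n - i))) (w i) = 0"
      proof -
        have "n - i = Suc (n - 1 - i)" using i by simp
        then have "j (n - i) = J (w i)" using j_Suc[of "n - 1 - i"] by (simp add: w_def)
        then show ?thesis
          using poly_fiber_poly[of "w i"] B_involution_nz[OF u_nz Bu_nz] \<kappa> u_nz by (simp add: w_def)
      qed
      ultimately show ?thesis using fiber_poly_nz unfolding S_def[symmetric] algebraic_in_def by blast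
    qed
    obtain \<sigma> where \<sigma>: "hom_on (adjoin K1 (w ` {..<n})) \<sigma>" "\<forall>k\<in>K1. \<sigma> k = \<tau> k"
      using hom_on_extend_chain[OF K1(1) \<tau>(1)[folded K1_def] alg] by blast
    define L where "L = adjoin K1 (w ` {..<n})"
    have L: "is_subfield L" "K1 \<subseteq> L" and wL: "w ` {..<n} \<subseteq> L" and h: "hom_on L \<sigma>"
      using subfield_adjoin adjoin_base[of K1] adjoin_gens[of "w ` {..<n}" K1] \<sigma> by (auto simp: L_def)
    have RL: "R \<subseteq> L" using RK K1 L by auto
    have \<sigma>K: "\<sigma> k = k" if "k \<in> K" for k using that \<sigma>(2) \<tau>(2) K1 by auto
    have \<sigma>R: "\<sigma> r = r" if "r \<in> R" for r using \<sigma>K RK that by auto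
    have \<sigma>J: "\<sigma> (J s) = J (\<sigma> s)" if "s \<in> L" for s
    proof -
      have "poly A s \<in> L" "poly B s \<in> L"
        using poly_in_subring[OF subfield_subring[OF L(1)]] poly_over_mono[OF RL] A B that by auto
      then show ?thesis unfolding J_def
        using that L by (simp add: hom_on_divide[OF L(1) h] hom_on_mult[OF L(1) h] subfield_mult[OF L(1)]
          poly_map_poly_hom_on_fixed[OF L(1) h RL \<sigma>R A] poly_map_poly_hom_on_fixed[OF L(1) h RL \<sigma>R B])
    qed
    have uL: "u e \<in> L" "\<kappa> / u e \<in> L" if "e < n" for e
    proof -
      have "w (n - 1 - e) \<in> L" using wL that by auto
      moreover have "w (n - 1 - e) = \<kappa> / u e" using that by (simp add: w_def)
      ultimately show "\<kappa> / u e \<in> L" by simp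
      then have "\<kappa> / (\<kappa> / u e) \<in> L" by (rule subfield_divide[OF L(1) subsetD[OF RL \<kappa>(1)]])
      moreover have "\<kappa> / (\<kappa> / u e) = u e" using \<kappa> by simp
      ultimately show "u e \<in> L" by metis
    qed
    define v where "v = (\<lambda>e. \<sigma> (u e))"
    define c where "c = (\<lambda>e. \<sigma> (j e))"
    have v0: "v e \<noteq> 0" if "e < n" for e using hom_on_eq_0[OF L(1) h] uL[OF that] u_nz by (simp add: v_def)
    have Bv0: "poly B (v e) \<noteq> 0" if e: "e < n" for e
    proof -
      have "poly B (u e) \<in> L"
        using poly_in_subring[OF subfield_subring[OF L(1)]] poly_over_mono[OF RL] B uL[OF e] by auto
      then show ?thesis unfolding v_def
        using poly_map_poly_hom_on_fixed[OF L(1) h RL \<sigma>R B uL(1)[OF e]] hom_on_eq_0[OF L(1) h] Bu_nz by metis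
    qed
    have \<sigma>\<kappa>: "\<sigma> (\<kappa> / u e) = \<kappa> / v e" if e: "e < n" for e
      using hom_on_divide[OF L(1) h _ uL(1)[OF e]] \<kappa>(1) RL \<sigma>R by (auto simp: v_def)
    have c: "c e = J (v e)" "c (Suc e) = J (\<kappa> / v e)" if e: "e < n" for e
      using \<sigma>J uL[OF e] \<sigma>\<kappa>[OF e] by (simp_all add: c_def v_def j_eq[of e] j_Suc[of e])
    have c_ends: "c 0 = j 0" "c n = j n" using \<sigma>K jK by (simp_all add: c_def)
    \<comment> \<open>Infinity is passed from \<open>c n\<close>, which is fixed by the conjugation,
      down to \<open>c 0\<close>. Afterwards the bounds of \<open>J_step\<close> hold at each
      conjugated step, without knowing which pole it meets.\<close>
    have c_inf: "\<not> c (n - i) \<preceq> 1" if "i \<le> n" for i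
      using that
    proof (induction i)
      case 0 then show ?case using j_inf c_ends by simp
    next
      case (Suc i)
      then have e: "n - Suc i < n" and s: "n - i = Suc (n - Suc i)" by auto
      show ?case using J_step[OF v0[OF e] Bv0[OF e]] Suc c[OF e] s by auto
    qed
    have step: "c e \<preceq> c (Suc e) ^ Q \<and> (\<not> 1 \<preceq> \<kappa> / v e \<or> c e \<preceq> c (Suc e))" if e: "e < n" for e
      using J_step[OF v0[OF e] Bv0[OF e]] c[OF e] c_inf[of "n - Suc e"] e by auto
    have c0: "c 0 \<preceq> c e ^ (Q ^ e)" if "e \<le> n" for e
      using that
    proof (induction e)
      case (Suc e)
      then have "c e ^ (Q ^ e) \<preceq> (c (Suc e) ^ Q) ^ (Q ^ e)" using step[of e] by (intro le_power) auto
      then have "c e ^ (Q ^ e) \<preceq> c (Suc e) ^ (Q ^ Suc e)" by (simp add: power_mult)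
      moreover have "c 0 \<preceq> c e ^ (Q ^ e)" using Suc by simp
      ultimately show ?case by (metis le_trans)
    qed simp
    \<comment> \<open>Otherwise the last step would contribute the exponent 1 instead of
      \<open>Q\<close>. Then \<open>j 0\<close>, which the conjugation also fixes, would be bounded
      by \<open>j n\<close> to the power Q^(n - 1), although its exponent at this place is
      Q^n.\<close>
    have "\<not> 1 \<preceq> \<kappa> / v (n - 1)"
    proof
      assume "1 \<preceq> \<kappa> / v (n - 1)"
      then have "c (n - 1) \<preceq> c n" using step[of "n - 1"] n by auto
      then have "c (n - 1) ^ (Q ^ (n - 1)) \<preceq> c n ^ (Q ^ (n - 1))" by (rule le_power)
      then have "c 0 \<preceq> c n ^ (Q ^ (n - 1))" by (rule le_trans[OF c0[of "n - 1"], rotated]) simp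
      then have "j n ^ (Q ^ n) \<preceq> j n ^ (Q ^ (n - 1))"
        using c_ends j0_sim[of n] le_trans[of "j n ^ (Q ^ n)" "j 0" "j n ^ (Q ^ (n - 1))"] by (auto simp: sim_def)
      then have "Q ^ n \<le> Q ^ (n - 1)" using power_le_iff_infinite[OF j_inf] by blast
      then show False using n Q by (simp add: power_increasing_iff)
    qed
    moreover have "\<not> 1 \<preceq> x" using u_inf infinite_involution[OF u_nz] by (simp add: x_def)
    moreover have "J (\<kappa> / v (n - 1)) = J x" using c(2)[of "n - 1"] c_ends n jn by simp
    moreover have "\<kappa> / v (n - 1) \<noteq> 0" using v0[of "n - 1"] n \<kappa> by simp
    ultimately have "\<kappa> / v (n - 1) = x" using J_inj_infinitesimal x0 by blast
    then have "\<sigma> x = x" using \<sigma>\<kappa>[of "n - 1"] n by (simp add: x_def)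
    then show False using \<sigma>(2) K1(3) \<tau>(3) by auto
  qed
  moreover have "u (n - 1) = \<kappa> / x" using \<kappa> by (simp add: x_def)
  ultimately show ?thesis using K RK \<kappa> unfolding K_def[symmetric] by (auto intro: subfield_divide)
qed

end

context recursive_tower
begin

lemma last_in_field:
  assumes n: "n \<ge> 1"
  shows "u (n - 1) \<in> adjoin R {j 0, j n}"
proof -
  obtain V where V: "valuation_ring V" "R \<subseteq> V" "u 0 \<notin> V"
    using exists_valuation_ring_transcendental[OF R] transcendental[of 0] by blast
  interpret recursive_tower_valuation R V A B \<kappa> Q u j by unfold_locales (use V R in auto)
  show ?thesis by (rule u_last_in_field[OF n])
qed

text \<open>The last parameter determines \<open>j n\<close>, so the field for n is contained in the
  one for n + 1 and the induction hypothesis supplies the earlier parameters.\<close>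

lemma all_in_field: "n \<ge> 1 \<Longrightarrow> i < n \<Longrightarrow> u i \<in> adjoin R {j 0, j n}"
proof (induction n)
  case (Suc n)
  define K where "K = adjoin R {j 0, j (Suc n)}"
  have K: "is_subfield K" and RK: "R \<subseteq> K" and jK: "j 0 \<in> K"
    using subfield_adjoin adjoin_base[of R] adjoin_gens[of "{j 0, j (Suc n)}" R] by (auto simp: K_def)
  have un: "u n \<in> K" using last_in_field[of "Suc n"] by (simp add: K_def)
  then have "j n \<in> K" unfolding j_eq using K RK by (intro J_in_subfield)
  then have sub: "adjoin R {j 0, j n} \<subseteq> K" using jK K RK by (intro adjoin_least) auto
  show ?case
  proof (cases "i = n")
    case False
    then show ?thesis using Suc sub unfolding K_def by auto
  qed (use un in \<open>simp add: K_def\<close>)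
qed simp

lemma field_eq:
  assumes n: "n \<ge> 1"
  shows "adjoin R {j 0, j n} = adjoin R (u ` {..<n})"
proof (rule adjoin_eqI)
  have R': "R \<subseteq> adjoin R (u ` {..<n})" "u ` {..<n} \<subseteq> adjoin R (u ` {..<n})"
    by (rule adjoin_base, rule adjoin_gens)
  have "\<kappa> / u (n - 1) \<in> adjoin R (u ` {..<n})"
    using R' \<kappa> n by (intro subfield_divide subfield_adjoin) auto
  then have "j n \<in> adjoin R (u ` {..<n})"
    using j_Suc[of "n - 1"] n R'(1) J_in_subfield[OF subfield_adjoin] by simp
  moreover have "j 0 \<in> adjoin R (u ` {..<n})"
    unfolding j_eq using R' n by (intro J_in_subfield subfield_adjoin) auto
  ultimately show "{j 0, j n} \<subseteq> adjoin R (u ` {..<n})" by auto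
  show "u ` {..<n} \<subseteq> adjoin R {j 0, j n}" using all_in_field[OF n] by auto
qed

text \<open>A tail of a tower is a tower; \<open>field_eq\<close> for the tail with one step then
  identifies the field of each single step.\<close>

lemma shifted: "recursive_tower R A B \<kappa> Q (\<lambda>e. u (e + k)) (\<lambda>e. j (e + k))"
proof unfold_locales
  show "\<not> algebraic_in R (j (0 + k))" using transcendental by auto
  show "u (Suc e + k) \<notin> V" if "valuation R V" "u (e + k) \<notin> V" for V e
    using ramified[OF that] by simp
qed (use u_nz Bu_nz j_eq j_Suc in auto)

lemma step_field_eq: "adjoin R {u e} = adjoin R {j e, j (e + 1)}"
proof -
  interpret sh: recursive_tower R A B \<kappa> Q "\<lambda>i. u (i + e)" "\<lambda>i. j (i + e)" by (rule shifted)
  show ?thesis using sh.field_eq[of 1] by (simp add: lessThan_Suc add.commute)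
qed

end

section \<open>Separable linearized polynomials\<close>

lemma card_roots_separable:
  fixes p :: "'l::alg_closed_field poly"
  assumes "p \<noteq> 0" "\<And>x. poly p x = 0 \<Longrightarrow> poly (pderiv p) x \<noteq> 0"
  shows "card {x. poly p x = 0} = degree p"
  using assms
proof (induction "degree p" arbitrary: p)
  case 0
  then obtain c where "p = [:c:]" using degree_eq_zeroE by metis
  then show ?case using 0 by auto
next
  case (Suc n)
  obtain a where a: "poly p a = 0" using alg_closed_imp_poly_has_root[of p] Suc.hyps(2) by auto
  then obtain r where r: "p = [:- a, 1:] * r" by (auto simp: poly_eq_0_iff_dvd elim: dvdE)
  have r0: "r \<noteq> 0" using r Suc.prems by auto
  have pd: "poly (pderiv p) x = poly r x + (x - a) * poly (pderiv r) x" for x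
    unfolding r pderiv_mult by (simp add: pderiv_pCons algebra_simps)
  have ra: "poly r a \<noteq> 0" using Suc.prems(2)[OF a] pd[of a] by simp
  have "degree p = Suc (degree r)" unfolding r using r0 by (subst degree_mult_eq) auto
  moreover have "poly (pderiv r) x \<noteq> 0" if x: "poly r x = 0" for x
    using Suc.prems(2)[of x] pd[of x] x by (simp add: r)
  ultimately have "card {x. poly r x = 0} = n" using Suc.hyps(1)[of r] Suc.hyps(2) r0 by auto
  moreover have "{x. poly p x = 0} = insert a {x. poly r x = 0}" by (auto simp: r)
  ultimately show ?case using ra Suc.hyps(2) r0 by (simp add: poly_roots_finite)
qed

lemma finite_field_power_card:
  fixes c :: "'q::{finite,field}"
  shows "c ^ CARD('q) = c"
proof (cases "c = 0")
  case False
  define S where "S = UNIV - {0::'q}"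
  have "(\<Prod>y\<in>S. c * y) = (\<Prod>y\<in>S. y)"
    by (rule prod.reindex_bij_witness[of _ "\<lambda>y. y / c" "\<lambda>y. c * y"]) (use False in \<open>auto simp: S_def\<close>)
  moreover have "(\<Prod>y\<in>S. c * y) = c ^ card S * (\<Prod>y\<in>S. y)" by (simp add: prod.distrib)
  moreover have "(\<Prod>y\<in>S. y) \<noteq> 0" by (auto simp: S_def)
  ultimately have "c ^ card S = 1" by simp
  moreover have "CARD('q) = Suc (card S)" by (simp add: S_def card_Diff_subset)
  ultimately show ?thesis by simp
qed simp

lemma card_field_gt_1: "CARD('q::{finite,field}) > 1"
proof -
  have "card {0, 1 :: 'q} \<le> CARD('q)" by (intro card_mono) auto
  then show ?thesis by simp
qed

text \<open>(c + 1)^q - c^q - 1 vanishes for all q elements c of the field, but is a polynomial in c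
  of degree below q, so its coefficients are zero. Additivity of the q-th power thus follows without
  writing q as a prime power.\<close>

lemma card_choose_eq_0:
  assumes "0 < i" "i < CARD('q::{finite,field})"
  shows "of_nat (CARD('q) choose i) = (0 :: 'q)"
proof -
  define q where "q = CARD('q)"
  have q1: "q > 1" unfolding q_def by (rule card_field_gt_1)
  define p :: "'q poly" where "p = (\<Sum>i=1..<q. monom (of_nat (q choose i)) i)"
  have "degree p \<le> q - 1" unfolding p_def
    by (intro degree_sum_le) (auto intro: order.trans[OF degree_monom_le])
  moreover have "poly p c = 0" for c
  proof -
    have "{..q} = insert 0 (insert q {1..<q})" using q1 by auto
    then have "(c + 1) ^ q = 1 + c ^ q + poly p c"
      unfolding binomial_ring p_def using q1 by (simp add: poly_sum poly_monom mult.commute)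
    then show ?thesis using finite_field_power_card[of "c + 1"] finite_field_power_card[of c]
      by (simp add: q_def)
  qed
  then have "card {c. poly p c = 0} = q" by (simp add: q_def)
  ultimately have "p = 0" using poly_roots_degree[of p] q1 by fastforce
  then have "coeff p i = 0" by simp
  moreover have "coeff p i = of_nat (q choose i)" using assms
    by (simp add: p_def coeff_sum coeff_monom q_def)
  ultimately show ?thesis by (simp add: q_def)
qed

lemma frobenius_add_ring:
  fixes x y :: "'a::comm_ring_1"
  assumes "q > 1" "\<And>i. 0 < i \<Longrightarrow> i < q \<Longrightarrow> of_nat (q choose i) = (0::'a)"
  shows "(x + y) ^ q = x ^ q + y ^ q"
proof -
  have "{..q} = insert 0 (insert q {1..<q})" using assms(1) by auto
  moreover have "(\<Sum>k\<in>{1..<q}. of_nat (q choose k) * x ^ k * y ^ (q - k)) = 0"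
    using assms(2) by (intro sum.neutral) auto
  ultimately show ?thesis unfolding binomial_ring using assms(1) by simp
qed

lemma frobenius_diff_ring:
  fixes x y :: "'a::comm_ring_1"
  assumes "q > 1" "\<And>i. 0 < i \<Longrightarrow> i < q \<Longrightarrow> of_nat (q choose i) = (0::'a)"
  shows "(x - y) ^ q = x ^ q - y ^ q"
  using frobenius_add_ring[OF assms, of "x - y" y] by simp

lemma card_small_degree:
  "card {b::'q::{finite,field} poly. b = 0 \<or> degree b < d} = CARD('q) ^ d"
proof (induction d)
  case (Suc d)
  have "{b::'q poly. b = 0 \<or> degree b < Suc d} =
      (\<lambda>(c, b). pCons c b) ` (UNIV \<times> {b. b = 0 \<or> degree b < d})" (is "?L = ?R")
  proof (intro antisym subsetI)
    fix b assume b: "b \<in> ?L"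
    obtain c b' where cb: "b = pCons c b'" by (cases b)
    then have "b' = 0 \<or> degree b' < d" using b by (auto split: if_splits)
    then show "b \<in> ?R" using cb by auto
  qed (auto split: if_splits)
  moreover have "inj (\<lambda>(c::'q, b). pCons c b)" by (auto intro!: injI)
  then have "inj_on (\<lambda>(c::'q, b). pCons c b) (UNIV \<times> {b. b = 0 \<or> degree b < d})"
    by (rule inj_on_subset) auto
  ultimately show ?case using Suc by (simp add: card_image card_cartesian_product)
qed auto

lemma residue_class_eq_iff: "residue_class N a = residue_class N b \<longleftrightarrow> N dvd a - b"
proof
  assume eq: "residue_class N a = residue_class N b"
  have "a \<in> residue_class N a" by (simp add: residue_class_def)
  then have "a \<in> residue_class N b" unfolding eq .
  then show "N dvd a - b" by (simp add: residue_class_def)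
next
  assume "N dvd a - b"
  then have "N dvd (x - a) + (a - b) \<longleftrightarrow> N dvd x - a" for x by (rule dvd_add_left_iff)
  then have "N dvd x - b \<longleftrightarrow> N dvd x - a" for x by simp
  then show "residue_class N a = residue_class N b" unfolding residue_class_def by blast
qed

lemma card_residue_classes:
  fixes N :: "'q::{finite,field} poly"
  assumes "N \<noteq> 0"
  shows "card (range (residue_class N)) = CARD('q) ^ degree N"
proof -
  define S where "S = {b::'q poly. b = 0 \<or> degree b < degree N}"
  have "residue_class N a \<in> residue_class N ` S" for a
  proof -
    have "residue_class N a = residue_class N (a mod N)"
      by (simp add: residue_class_eq_iff minus_mod_eq_mult_div)
    moreover have "a mod N \<in> S" using degree_mod_less[OF assms, of a] by (auto simp: S_def)
    ultimately show ?thesis by auto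
  qed
  then have "range (residue_class N) = residue_class N ` S" by auto
  moreover have "inj_on (residue_class N) S"
  proof (rule inj_onI, rule ccontr)
    fix a b assume ab: "a \<in> S" "b \<in> S" "residue_class N a = residue_class N b" "a \<noteq> b"
    then have "degree N \<le> degree (a - b)" by (intro dvd_imp_degree_le) (auto simp: residue_class_eq_iff)
    moreover have "degree N > 0 \<Longrightarrow> degree (a - b) < degree N"
      using ab by (auto simp: S_def intro: degree_diff_less)
    ultimately show False using ab by (auto simp: S_def)
  qed
  ultimately show ?thesis using card_small_degree[where ?'q = 'q] by (simp add: card_image S_def)
qed

section \<open>Frobenius, additive polynomials and separability over an extension of F_q(T)\<close>

locale drinfeld_setting = field_hom \<iota>
  for \<iota> :: "'q::{finite,field} poly fract \<Rightarrow> 'l::alg_closed_field" +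
  fixes q :: nat
  assumes q_card: "q = CARD('q)"
begin

definition \<gamma> :: "'q poly \<Rightarrow> 'l" where "\<gamma> a = \<iota> (to_fract a)"

definition T :: 'l where "T = \<gamma> [:0, 1:]"

definition F :: "'l \<Rightarrow> 'l" where "F x = x ^ q"

lemma \<gamma>_simps [simp]: "\<gamma> 0 = 0" "\<gamma> 1 = 1" "\<gamma> (a + b) = \<gamma> a + \<gamma> b" "\<gamma> (a - b) = \<gamma> a - \<gamma> b"
    "\<gamma> (a * b) = \<gamma> a * \<gamma> b" "\<gamma> (- a) = - \<gamma> a" "\<gamma> (a ^ n) = \<gamma> a ^ n"
  unfolding \<gamma>_def by (simp_all add: hom_distribs)

lemma \<gamma>_eq_0_iff [simp]: "\<gamma> a = 0 \<longleftrightarrow> a = 0"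
  unfolding \<gamma>_def by simp

lemma \<gamma>_eq_iff: "\<gamma> a = \<gamma> b \<longleftrightarrow> a = b"
  using \<gamma>_eq_0_iff[of "a - b"] by (simp del: \<gamma>_eq_0_iff)

lemma \<gamma>_of_nat: "\<gamma> (of_nat n) = of_nat n"
  by (induction n) auto

lemma q_gt_1: "q > 1" unfolding q_card by (rule card_field_gt_1)

lemma of_nat_eq_0: "of_nat n = (0::'q) \<Longrightarrow> of_nat n = (0::'l)"
proof -
  assume "of_nat n = (0::'q)"
  then have "(of_nat n :: 'q poly) = 0" by (simp add: of_nat_poly)
  then show ?thesis using \<gamma>_of_nat[of n] by simp
qed

lemma of_nat_q: "of_nat q = (0::'l)"
proof (rule of_nat_eq_0)
  have "(\<Sum>x\<in>UNIV. x + 1) = (\<Sum>x\<in>UNIV. x :: 'q)"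
    by (rule sum.reindex_bij_witness[of _ "\<lambda>x. x - 1" "\<lambda>x. x + 1"]) auto
  then show "of_nat q = (0::'q)" by (simp add: sum.distrib q_card)
qed

lemma F_add: "F (x + y) = F x + F y"
  unfolding F_def by (rule frobenius_add_ring[OF q_gt_1])
    (use of_nat_eq_0[OF card_choose_eq_0[where ?'q = 'q]] q_card in auto)

sublocale F: field_hom F
  using q_gt_1 F_add by unfold_locales (simp_all add: F_def power_mult_distrib)

lemma F_funpow: "(F ^^ k) z = z ^ (q ^ k)"
  by (induction k) (auto simp: F_def power_mult[symmetric] mult.commute)

lemma F_\<gamma>: "F (\<gamma> [:c:]) = \<gamma> [:c:]"
proof -
  have "F (\<gamma> [:c:]) = \<gamma> ([:c:] ^ q)" by (simp add: F_def)
  also have "[:c:] ^ q = [:c:]" by (simp add: poly_const_pow finite_field_power_card q_card)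
  finally show ?thesis .
qed

text \<open>X^q - X has at most q roots, and the constants already provide q of them.\<close>

lemma F_fixed: 
  assumes "F x = x" shows "\<exists>c. x = \<gamma> [:c:]"
proof (rule ccontr)
  assume n: "\<nexists>c. x = \<gamma> [:c:]"
  define p where "p = monom 1 q - [:0, 1 :: 'l:]"
  have c: "coeff p q = 1" using q_gt_1 by (simp add: p_def coeff_pCons split: nat.splits)
  then have p0: "p \<noteq> 0" by auto
  have d: "degree p \<le> q" unfolding p_def using q_gt_1 by (intro degree_diff_le degree_monom_le) auto
  have roots: "{y. F y = y} \<subseteq> {y. poly p y = 0}" by (auto simp: p_def poly_monom F_def)
  have "insert x ((\<lambda>c. \<gamma> [:c:]) ` UNIV) \<subseteq> {y. poly p y = 0}" using assms F_\<gamma> roots by auto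
  then have "card (insert x ((\<lambda>c. \<gamma> [:c:]) ` UNIV)) \<le> card {y. poly p y = 0}"
    by (intro card_mono poly_roots_finite p0)
  also have "\<dots> \<le> q" using poly_roots_degree[OF p0] d by simp
  also have "card (insert x ((\<lambda>c. \<gamma> [:c:]) ` UNIV)) = Suc q"
  proof -
    have "inj (\<lambda>c. \<gamma> [:c:])" by (auto intro!: injI simp: \<gamma>_eq_iff)
    then have "card ((\<lambda>c. \<gamma> [:c:]) ` UNIV) = q" by (simp add: card_image q_card)
    moreover have "x \<notin> (\<lambda>c. \<gamma> [:c:]) ` UNIV" using n by auto
    ultimately show ?thesis by simp
  qed
  finally show False by simp
qed

lemma T_power: "T ^ n = T \<Longrightarrow> n \<ge> 1 \<Longrightarrow> n = 1"
proof -
  assume "T ^ n = T" "n \<ge> 1"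
  then have "\<gamma> (monom 1 n) = \<gamma> (monom 1 1)"
    unfolding T_def by (simp add: monom_altdef)
  then have "monom 1 n = (monom 1 1 :: 'q poly)" by (simp only: \<gamma>_eq_iff)
  then have "degree (monom 1 n :: 'q poly) = degree (monom 1 1 :: 'q poly)" by simp
  then show "n = 1" by (simp add: degree_monom_eq)
qed

lemma linearized_poly:
  fixes h :: "'l poly"
  assumes "linearized q h" "degree h \<le> q ^ d"
  shows "poly h z = (\<Sum>k\<le>d. coeff h (q ^ k) * (F ^^ k) z)"
proof -
  have "poly h z = (\<Sum>i\<le>q ^ d. coeff h i * z ^ i)"
    unfolding poly_altdef using assms(2) by (intro sum.mono_neutral_left) (auto simp: coeff_eq_0)
  also have "\<dots> = (\<Sum>i\<in>(\<lambda>k. q ^ k) ` {..d}. coeff h i * z ^ i)"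
  proof (rule sum.mono_neutral_right)
    show "(\<lambda>k. q ^ k) ` {..d} \<subseteq> {..q ^ d}"
      using q_gt_1 by (auto intro: power_increasing)
    show "\<forall>i\<in>{..q ^ d} - (\<lambda>k. q ^ k) ` {..d}. coeff h i * z ^ i = 0"
    proof
      fix i assume i: "i \<in> {..q ^ d} - (\<lambda>k. q ^ k) ` {..d}"
      have "coeff h i = 0"
      proof (rule ccontr)
        assume "coeff h i \<noteq> 0"
        then obtain k where k: "i = q ^ k" using assms(1) by (auto simp: linearized_def)
        then have "k \<le> d" using i q_gt_1 by (simp add: power_increasing_iff)
        then show False using i k by auto
      qed
      then show "coeff h i * z ^ i = 0" by simp
    qed
  qed auto
  also have "\<dots> = (\<Sum>k\<le>d. coeff h (q ^ k) * z ^ (q ^ k))"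
    using q_gt_1 by (subst sum.reindex) (auto intro!: inj_onI simp: power_inject_exp)
  finally show ?thesis by (simp add: F_funpow)
qed

text \<open>The sum is the value of a polynomial of degree at most q^d, so it cannot vanish at more
  than q^d points unless all coefficients are zero. Identities between additive operators may thus
  be compared coefficient by coefficient, on the whole field or on a large enough kernel.\<close>

lemma additive_coeffs_eq_0:
  fixes a :: "nat \<Rightarrow> 'l"
  assumes S: "infinite S \<or> card S > q ^ d" and z: "\<And>z. z \<in> S \<Longrightarrow> (\<Sum>k\<le>d. a k * (F ^^ k) z) = 0"
    and k: "k \<le> d"
  shows "a k = 0"
proof -
  define p where "p = (\<Sum>k\<le>d. monom (a k) (q ^ k))"
  have "degree p \<le> q ^ d" unfolding p_def using q_gt_1
    by (intro degree_sum_le) (auto intro!: order.trans[OF degree_monom_le] power_increasing)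
  moreover have sub: "S \<subseteq> {z. poly p z = 0}"
    using z by (auto simp: p_def poly_sum poly_monom F_funpow)
  ultimately have "p = 0"
    using S card_mono[OF poly_roots_finite sub] poly_roots_degree[of p] finite_subset[OF sub poly_roots_finite]
    by fastforce
  then have "coeff p (q ^ k) = 0" by simp
  also have "coeff p (q ^ k) = (\<Sum>i\<le>d. if i = k then a i else 0)"
    unfolding p_def coeff_sum coeff_monom using q_gt_1 by (intro sum.cong) (auto simp: power_inject_exp)
  finally show ?thesis using k by simp
qed

text \<open>Differentiating X^(q^k) brings down the factor q^k, which is zero in the field for k >
  0.\<close>

lemma pderiv_linearized:
  fixes h :: "'l poly"
  assumes "linearized q h" shows "pderiv h = [:coeff h 1:]"
proof (rule poly_eqI)
  fix n
  show "coeff (pderiv h) n = coeff [:coeff h 1:] n"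
  proof (cases "n = 0 \<or> coeff h (Suc n) = 0")
    case True then show ?thesis by (cases n) (auto simp: coeff_pderiv)
  next
    case False
    then obtain k where k: "Suc n = q ^ k" using assms by (auto simp: linearized_def)
    then have "k > 0" using False by (cases k) auto
    then have "of_nat (Suc n) = (0::'l)" unfolding k by (cases k) (auto simp: of_nat_q)
    then show ?thesis using False by (simp add: coeff_pderiv coeff_pCons split: nat.splits del: of_nat_Suc)
  qed
qed

lemma card_roots_linearized:
  fixes h :: "'l poly"
  assumes "linearized q h" "coeff h 1 \<noteq> 0"
  shows "card {z. poly h z = 0} = degree h"
  by (rule card_roots_separable) (use assms pderiv_linearized in auto)

lemma linearized_zero: "linearized q h \<Longrightarrow> poly h 0 = 0"
  using q_gt_1 by (auto simp: linearized_def poly_0_coeff_0)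

text \<open>Let n be the order of vanishing of h at 0. The lowest coefficients of the intertwining
  identity give T^n = T, and T is transcendental over the constants, so n = 1. This is how generic
  characteristic makes isogenies separable.\<close>

lemma isogeny_coeff_1:
  fixes h f f' :: "'l poly"
  assumes h: "h \<noteq> 0" "poly h 0 = 0" and f: "poly f 0 = 0" "coeff f 1 = T" "poly f' 0 = 0" "coeff f' 1 = T"
    and eq: "pcompose h f = pcompose f' h"
  shows "coeff h 1 \<noteq> 0"
proof -
  define n where "n = order 0 h"
  define X :: "'l poly" where "X = [:0, 1:]"
  obtain r where r: "h = X ^ n * r" "\<not> X dvd r"
    using order_decomp[OF h(1), of 0] unfolding n_def X_def by auto
  have r0: "poly r 0 \<noteq> 0" using r(2) by (simp add: poly_eq_0_iff_dvd X_def)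
  have n1: "n \<ge> 1" using h order_root[of h 0] unfolding n_def by (simp add: Suc_le_eq)
  have "X dvd f" "X dvd f'" using f by (simp_all add: poly_eq_0_iff_dvd X_def)
  then obtain w w' where w: "f = X * w" and w': "f' = X * w'" by (elim dvdE)
  have wT: "poly w 0 = T" "poly w' 0 = T" using f w w' by (simp_all add: poly_0_coeff_0 X_def)
  have Xc: "pcompose X g = g" for g by (simp add: X_def pcompose_pCons)
  have Xn: "pcompose (X ^ n) g = g ^ n" for g
    by (induction n) (simp_all add: pcompose_mult Xc pcompose_1)
  have "X ^ n * (w ^ n * pcompose r f) = pcompose h f"
    unfolding r(1) pcompose_mult Xn by (simp only: w power_mult_distrib mult.assoc)
  also have "\<dots> = h * pcompose w' h" unfolding eq w' pcompose_mult Xc ..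
  also have "\<dots> = X ^ n * (r * pcompose w' h)" by (subst r(1)) (simp only: mult.assoc)
  finally have "w ^ n * pcompose r f = r * pcompose w' h" by (simp add: X_def)
  then have "poly (w ^ n * pcompose r f) 0 = poly (r * pcompose w' h) 0" by simp
  then have "T ^ n = T" using r0 f(1) h(2) by (simp add: poly_pcompose wT)
  then have "n = 1" using n1 T_power by blast
  then show ?thesis using r(1) r0 by (simp add: poly_0_coeff_0 X_def)
qed

end

section \<open>Rank two modules with a cyclic submodule of quadratic level\<close>

text \<open>
  Here \<open>F\<close> is the \<open>q\<close>-Frobenius and the level is \<open>P = T\<^sup>2 - t T + n\<close>. A cyclic submodule
  \<open>W\<close> of the module \<open>T + g F + D F\<^sup>2\<close> is encoded by the operator \<open>\<beta> F + \<alpha>\<close> through which \<open>T\<close> acts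
  on \<open>W\<close>: the submodule is the kernel of \<open>P (\<beta> F + \<alpha>)\<close>, and the module itself is
  \<open>\<delta> P (\<beta> F + \<alpha>) + (\<beta> F + \<alpha>)\<close> up to scalars, with \<open>\<delta> = (T - \<alpha>) / P(\<alpha>)\<close>.
\<close>

locale quadratic_level = field_hom F
  for F :: "'l::field \<Rightarrow> 'l" +
  fixes T t n :: 'l
  assumes Ft: "F t = t" and Fn: "F n = n"
begin

definition P :: "'l \<Rightarrow> 'l" where "P x = x * x - t * x + n"

text \<open>Forced by the constant coefficient of the module: \<delta> P(\<alpha>) + \<alpha> =
  T.\<close>

definition \<delta> :: "'l \<Rightarrow> 'l" where "\<delta> \<alpha> = (T - \<alpha>) / P \<alpha>"

text \<open>The coefficient of F in P(\<beta> F + \<alpha>), divided by \<beta>.\<close>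

definition m :: "'l \<Rightarrow> 'l" where "m \<alpha> = \<alpha> + F \<alpha> - t"

definition submodule :: "'l \<Rightarrow> 'l \<Rightarrow> 'l \<Rightarrow> 'l \<Rightarrow> bool" where
  "submodule g D \<alpha> \<beta> \<longleftrightarrow> \<beta> \<noteq> 0 \<and> P \<alpha> \<noteq> 0 \<and> T \<noteq> \<alpha> \<and>
     D = \<delta> \<alpha> * \<beta> * F \<beta> \<and> g = \<beta> * (1 + \<delta> \<alpha> * m \<alpha>)"

definition act :: "'l \<Rightarrow> 'l \<Rightarrow> 'l \<Rightarrow> 'l" where "act \<alpha> \<beta> z = \<beta> * F z + \<alpha> * z"

definition P_act :: "'l \<Rightarrow> 'l \<Rightarrow> 'l \<Rightarrow> 'l" where
  "P_act \<alpha> \<beta> z = act \<alpha> \<beta> (act \<alpha> \<beta> z) - t * act \<alpha> \<beta> z + n * z"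

definition module_op :: "'l \<Rightarrow> 'l \<Rightarrow> 'l \<Rightarrow> 'l" where
  "module_op g D z = T * z + g * F z + D * F (F z)"

lemma act_simps: "act \<alpha> \<beta> (x + y) = act \<alpha> \<beta> x + act \<alpha> \<beta> y" "act \<alpha> \<beta> (x - y) = act \<alpha> \<beta> x - act \<alpha> \<beta> y"
    "F a = a \<Longrightarrow> act \<alpha> \<beta> (a * x) = a * act \<alpha> \<beta> x"
  by (simp_all add: act_def hom_distribs algebra_simps)

lemma P_act_expand:
  "P_act \<alpha> \<beta> z = \<beta> * F \<beta> * F (F z) + \<beta> * m \<alpha> * F z + P \<alpha> * z"
  by (simp add: P_act_def act_def m_def P_def hom_distribs algebra_simps)

lemma P_act_commute: "P_act \<alpha> \<beta> (act \<alpha> \<beta> z) = act \<alpha> \<beta> (P_act \<alpha> \<beta> z)"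
  by (simp add: P_act_def act_simps Ft Fn)

lemma P_act_diff: "P_act \<alpha> \<beta> (x - y) = P_act \<alpha> \<beta> x - P_act \<alpha> \<beta> y"
  by (simp add: P_act_def act_simps algebra_simps)

lemma \<delta>_P: "P \<alpha> \<noteq> 0 \<Longrightarrow> \<delta> \<alpha> * P \<alpha> = T - \<alpha>"
  by (simp add: \<delta>_def)

lemma \<delta>_nz: "submodule g D \<alpha> \<beta> \<Longrightarrow> \<delta> \<alpha> \<noteq> 0"
  by (auto simp: submodule_def \<delta>_def)

lemma module_op_eq:
  assumes "submodule g D \<alpha> \<beta>"
  shows "module_op g D z = \<delta> \<alpha> * P_act \<alpha> \<beta> z + act \<alpha> \<beta> z"
proof -
  have "\<delta> \<alpha> * P_act \<alpha> \<beta> z + act \<alpha> \<beta> z =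
      (\<delta> \<alpha> * \<beta> * F \<beta>) * F (F z) + (\<beta> * (1 + \<delta> \<alpha> * m \<alpha>)) * F z + (\<delta> \<alpha> * P \<alpha> + \<alpha>) * z"
    unfolding P_act_expand act_def by (simp add: algebra_simps)
  then show ?thesis using assms \<delta>_P[of \<alpha>] by (auto simp: submodule_def module_op_def)
qed

text \<open>Passing to an isomorphic module rescales \<beta> and fixes \<alpha>, so \<beta> has to
  cancel. This is why \<alpha> alone can parametrize the curve.\<close>

lemma submodule_j:
  assumes "submodule g D \<alpha> \<beta>"
  shows "g * F g / D = (1 + \<delta> \<alpha> * m \<alpha>) * F (1 + \<delta> \<alpha> * m \<alpha>) / \<delta> \<alpha>"
proof -
  have "\<beta> * F \<beta> \<noteq> 0" using assms by (auto simp: submodule_def)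
  moreover have "g * F g / D = (\<beta> * F \<beta> * ((1 + \<delta> \<alpha> * m \<alpha>) * F (1 + \<delta> \<alpha> * m \<alpha>))) / (\<beta> * F \<beta> * \<delta> \<alpha>)"
    using assms by (simp add: submodule_def hom_mult mult_ac)
  ultimately show ?thesis by simp
qed

text \<open>With \<delta> = \<delta>(\<alpha>) fixed, \<alpha> and
  \<open>dual\<alpha> \<alpha>\<close> are the two roots of \<delta> P(X) + X - T. Hence they share
  \<delta>, and evaluating at X = T shows that T - \<alpha> and T -
  \<open>dual\<alpha> \<alpha>\<close> have the product P(T). This is the origin of the involution
  and of the constant \<kappa> = P(T).\<close>

definition dual\<alpha> :: "'l \<Rightarrow> 'l" where "dual\<alpha> \<alpha> = t - \<alpha> - 1 / \<delta> \<alpha>"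

text \<open>Chosen so that the dual operator becomes t - 1/\<delta> - (\<beta> F + \<alpha>)
  conjugated by c / \<delta>; see \<open>act_dual\<close>. Here c is the scalar in the isogeny c
  P(\<beta> F + \<alpha>).\<close>

definition dual\<beta> :: "'l \<Rightarrow> 'l \<Rightarrow> 'l \<Rightarrow> 'l" where
  "dual\<beta> \<alpha> \<beta> c = - (F (\<delta> \<alpha>) / \<delta> \<alpha>) * \<beta> * c / F c"

lemma T_minus_dual:
  assumes "P \<alpha> \<noteq> 0" "T \<noteq> \<alpha>" shows "T - dual\<alpha> \<alpha> = P T / (T - \<alpha>)"
proof -
  have "T - \<alpha> \<noteq> 0" using assms by simp
  then have "(T - dual\<alpha> \<alpha>) * (T - \<alpha>) = P T"
    using assms by (simp add: dual\<alpha>_def \<delta>_def P_def field_simps)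
  then show ?thesis using \<open>T - \<alpha> \<noteq> 0\<close> by (simp add: field_simps)
qed

lemma dual_\<delta>:
  assumes a: "P \<alpha> \<noteq> 0" "T \<noteq> \<alpha>" and PT: "P T \<noteq> 0"
  shows "P (dual\<alpha> \<alpha>) \<noteq> 0" "\<delta> (dual\<alpha> \<alpha>) = \<delta> \<alpha>"
proof -
  define d where "d = \<delta> \<alpha>"
  have d0: "d \<noteq> 0" using a by (simp add: d_def \<delta>_def)
  have "P (dual\<alpha> \<alpha>) = P \<alpha> + (2 * \<alpha> - t) / d + 1 / (d * d)"
    using d0 by (simp add: dual\<alpha>_def P_def d_def[symmetric] field_simps)
  then have "d * P (dual\<alpha> \<alpha>) = d * P \<alpha> + (2 * \<alpha> - t) + 1 / d"
    using d0 by (simp add: field_simps)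
  also have "\<dots> = T - dual\<alpha> \<alpha>" using \<delta>_P[OF a(1)] by (simp add: d_def dual\<alpha>_def)
  finally have e: "d * P (dual\<alpha> \<alpha>) = T - dual\<alpha> \<alpha>" .
  moreover have "T - dual\<alpha> \<alpha> \<noteq> 0" using T_minus_dual[OF a] a PT by simp
  ultimately show nz: "P (dual\<alpha> \<alpha>) \<noteq> 0" by auto
  have "\<delta> (dual\<alpha> \<alpha>) = d * P (dual\<alpha> \<alpha>) / P (dual\<alpha> \<alpha>)" unfolding e by (rule \<delta>_def)
  then show "\<delta> (dual\<alpha> \<alpha>) = \<delta> \<alpha>" using nz by (simp add: d_def)
qed

text \<open>The last two hypotheses are the coefficients of F^4 and F^3 in the relation that c
  P(\<beta> F + \<alpha>) intertwines the two modules. They can be solved for D' and g', and the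
  result has the shape that belongs to the dual operator.\<close>

lemma dual_submodule:
  assumes s: "submodule g D \<alpha> \<beta>" and c: "c \<noteq> 0" and PT: "P T \<noteq> 0"
    and D': "c * \<beta> * F \<beta> * F (F D) = D' * F (F (c * \<beta> * F \<beta>))"
    and g': "c * \<beta> * m \<alpha> * F D + c * \<beta> * F \<beta> * F (F g) =
        g' * F (c * \<beta> * F \<beta>) + D' * F (F (c * \<beta> * m \<alpha>))"
  shows "submodule g' D' (dual\<alpha> \<alpha>) (dual\<beta> \<alpha> \<beta> c)"
proof -
  define d where "d = \<delta> \<alpha>"
  define M where "M = m \<alpha>"
  have b0: "\<beta> \<noteq> 0" and a: "P \<alpha> \<noteq> 0" "T \<noteq> \<alpha>" and D: "D = d * \<beta> * F \<beta>" and g: "g = \<beta> * (1 + d * M)"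
    using s by (auto simp: submodule_def d_def M_def)
  have d0: "d \<noteq> 0" using \<delta>_nz[OF s] by (simp add: d_def)
  have dd: "\<delta> (dual\<alpha> \<alpha>) = d" "P (dual\<alpha> \<alpha>) \<noteq> 0" using dual_\<delta>[OF a PT] by (simp_all add: d_def)
  have T0: "T \<noteq> dual\<alpha> \<alpha>" using T_minus_dual[OF a] a PT by auto
  have bd0: "dual\<beta> \<alpha> \<beta> c \<noteq> 0" using b0 c d0 by (simp add: dual\<beta>_def d_def[symmetric])
  have md: "1 + d * m (dual\<alpha> \<alpha>) = - (d / F d) * (1 + M * F d)"
    using d0 by (simp add: m_def dual\<alpha>_def d_def[symmetric] M_def hom_distribs Ft field_simps)
  have nz: "F \<beta> \<noteq> 0" "F (F \<beta>) \<noteq> 0" "F (F (F \<beta>)) \<noteq> 0" "F c \<noteq> 0" "F (F c) \<noteq> 0" "F d \<noteq> 0" "F (F d) \<noteq> 0"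
    using b0 c d0 by auto
  have D'1: "D' = c * \<beta> * F \<beta> * F (F d) / F (F c)"
    using D' b0 c nz unfolding D hom_mult by (simp add: field_simps)
  have "D' = d * dual\<beta> \<alpha> \<beta> c * F (dual\<beta> \<alpha> \<beta> c)"
    unfolding D'1 dual\<beta>_def d_def[symmetric] using b0 c d0 nz by (simp add: hom_distribs field_simps)
  moreover have "g' = dual\<beta> \<alpha> \<beta> c * (1 + d * m (dual\<alpha> \<alpha>))"
  proof -
    have "g' * (F c * F \<beta> * F (F \<beta>)) = c * \<beta> * M * (F d * F \<beta> * F (F \<beta>)) +
       c * \<beta> * F \<beta> * (F (F \<beta>) * (1 + F (F d) * F (F M))) - D' * (F (F c) * F (F \<beta>) * F (F M))"
      using g' unfolding D g M_def[symmetric] hom_mult hom_add hom_one by (simp add: algebra_simps)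
    also have "\<dots> = c * \<beta> * (F \<beta> * F (F \<beta>)) * (1 + M * F d)"
      unfolding D'1 using nz by (simp add: field_simps)
    finally have "g' * F c * (F \<beta> * F (F \<beta>)) = c * \<beta> * (1 + M * F d) * (F \<beta> * F (F \<beta>))"
      by (simp add: mult_ac)
    then have "g' * F c = c * \<beta> * (1 + M * F d)" using nz by simp
    then have "g' = c * \<beta> * (1 + M * F d) / F c" using nz by (simp add: field_simps)
    also have "\<dots> = - (F d / d) * \<beta> * c / F c * (- (d / F d) * (1 + M * F d))" using nz d0 by simp
    finally show ?thesis unfolding md dual\<beta>_def d_def[symmetric] .
  qed
  ultimately show ?thesis unfolding submodule_def dd(1) using bd0 dd(2) T0 by simp
qed

lemma act_dual:
  assumes c: "c \<noteq> 0" and d0: "\<delta> \<alpha> \<noteq> 0"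
  shows "act (dual\<alpha> \<alpha>) (dual\<beta> \<alpha> \<beta> c) (c * x / \<delta> \<alpha>) = c / \<delta> \<alpha> * (t * x - act \<alpha> \<beta> x - x / \<delta> \<alpha>)"
  using assms by (simp add: act_def dual\<alpha>_def dual\<beta>_def hom_distribs field_simps)

text \<open>Write A = \<beta> F + \<alpha> and x = a z - A z. The form of the module gives \<delta>
  P(A) z = x, so the isogeny sends z to c x / \<delta>, where the dual operator acts as t - A -
  1/\<delta> does on x.\<close>

lemma dual_eigen:
  assumes s: "submodule g D \<alpha> \<beta>" and c: "c \<noteq> 0"
    and a: "F a = a" "t = a + a'" "n = a * a'" and z: "module_op g D z = a * z"
  shows "act (dual\<alpha> \<alpha>) (dual\<beta> \<alpha> \<beta> c) (c * P_act \<alpha> \<beta> z) = a * (c * P_act \<alpha> \<beta> z)"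
proof -
  define d where "d = \<delta> \<alpha>"
  have d0: "d \<noteq> 0" using \<delta>_nz[OF s] by (simp add: d_def)
  define x where "x = a * z - act \<alpha> \<beta> z"
  have dp: "d * P_act \<alpha> \<beta> z = x" using z module_op_eq[OF s, of z] by (simp add: d_def x_def algebra_simps)
  then have cp: "c * P_act \<alpha> \<beta> z = c * x / d" using d0 by (simp add: field_simps)
  have Ax: "act \<alpha> \<beta> x = a * act \<alpha> \<beta> z - act \<alpha> \<beta> (act \<alpha> \<beta> z)" unfolding x_def by (simp add: act_simps a(1))
  have "x / d = P_act \<alpha> \<beta> z" using dp d0 by (simp add: field_simps)
  then have xd: "x / d = act \<alpha> \<beta> (act \<alpha> \<beta> z) - t * act \<alpha> \<beta> z + n * z" by (simp add: P_act_def)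
  have "t * x - act \<alpha> \<beta> x - x / d = t * a * z - a * act \<alpha> \<beta> z - n * z"
    unfolding Ax xd by (simp add: x_def algebra_simps)
  also have "t * a * z = a * a * z + n * z" by (simp add: a(2,3) algebra_simps)
  finally have "t * x - act \<alpha> \<beta> x - x / d = a * x" by (simp add: x_def algebra_simps)
  then show ?thesis unfolding cp using act_dual[OF c, of \<alpha> \<beta> x] d0 by (simp add: d_def)
qed

text \<open>The isogeny carries the P-torsion of its source into the dual submodule, which plays the
  role of the kernel of the dual isogeny. As P(A) commutes with A, the torsion relation can be
  rewritten in terms of x = \<delta> P(A) z; this is \<open>key\<close>.\<close>

lemma dual_kernel:
  assumes s: "submodule g D \<alpha> \<beta>" and c: "c \<noteq> 0"
    and z: "module_op g D (module_op g D z) - t * module_op g D z + n * z = 0"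
  shows "P_act (dual\<alpha> \<alpha>) (dual\<beta> \<alpha> \<beta> c) (c * P_act \<alpha> \<beta> z) = 0"
proof -
  define d where "d = \<delta> \<alpha>"
  have d0: "d \<noteq> 0" using \<delta>_nz[OF s] by (simp add: d_def)
  define A where "A = act \<alpha> \<beta>"
  define p where "p = P_act \<alpha> \<beta>"
  define w where "w = module_op g D z"
  define x where "x = w - A z"
  have dpz: "d * p z = x" using module_op_eq[OF s, of z] by (simp add: d_def x_def w_def A_def p_def)
  have "module_op g D w = t * w - n * z" using z by (simp add: w_def algebra_simps)
  then have dpw: "d * p w = t * w - n * z - A w"
    using module_op_eq[OF s, of w] by (simp add: d_def A_def p_def algebra_simps)
  have pA: "p (A z) = A (p z)" using P_act_commute by (simp add: p_def A_def)
  have px: "p x = A (A x) - t * A x + n * x" by (simp add: p_def A_def P_act_def)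
  have Ax: "A x = A w - A (A z)" by (simp add: x_def A_def act_simps)
  have pz: "p z = A (A z) - t * A z + n * z" by (simp add: p_def A_def P_act_def)
  have "p x = p w - p (A z)" unfolding x_def p_def by (rule P_act_diff)
  then have pxw: "p x + A (p z) = p w" by (simp add: pA)
  have key: "d * (p x + A (p z)) + A x + p z - t * x = 0"
    unfolding pxw unfolding dpw Ax pz by (simp add: x_def algebra_simps)
  define E where "E = (\<lambda>y. t * y - A y - y / d)"
  have EE: "E y = t * y - A y - y / d" for y by (simp add: E_def)
  have hat: "act (dual\<alpha> \<alpha>) (dual\<beta> \<alpha> \<beta> c) (c * y / d) = c * E y / d" for y
    using act_dual[OF c, of \<alpha> \<beta> y] d0 by (simp add: E_def A_def d_def)
  have cp: "c * p z = c * x / d" using d0 dpz by (simp add: field_simps)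
  have "E (E x) - t * E x + n * x = 0"
  proof -
    have "x / d = p z" using dpz d0 by (simp add: field_simps)
    then have Ex: "E x = t * x - A x - p z" by (simp add: E_def)
    have "A (E x) = t * A x - A (A x) - A (p z)" unfolding Ex by (simp add: A_def act_simps Ft)
    then have "E (E x) - t * E x + n * x = - (t * A x - A (A x) - A (p z)) - (t * x - A x - p z) / d + n * x"
      unfolding EE[of "E x"] by (simp add: Ex)
    also have "\<dots> = (d * (p x + A (p z)) + A x + p z - t * x) / d" using d0 by (simp add: px field_simps)
    finally show ?thesis using key by simp
  qed
  then have "c * (E (E x) - t * E x + n * x) / d = 0" by simp
  moreover have "P_act (dual\<alpha> \<alpha>) (dual\<beta> \<alpha> \<beta> c) (c * x / d) = c * (E (E x) - t * E x + n * x) / d"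
    unfolding P_act_def hat using d0 by (simp add: field_simps)
  ultimately show ?thesis using cp by (simp add: p_def)
qed

text \<open>
  \<open>(a - \<alpha>) / \<beta>\<close> is the factor by which \<open>F\<close> acts on the \<open>a\<close>-eigenspace of \<open>T\<close> in the submodule.
\<close>

lemma submodule_eigenspaces:
  assumes s1: "submodule g D \<alpha>1 \<beta>1" and s2: "submodule g D \<alpha>2 \<beta>2"
    and a: "F a = a" "t = a + a'" "n = a * a'"
    and ne: "(a - \<alpha>1) / \<beta>1 \<noteq> (a - \<alpha>2) / \<beta>2"
    and x: "x = T - \<alpha>1" "y = T - \<alpha>2" and b: "b = \<beta>2 / \<beta>1"
    and pr: "p = T - a" "r = T - a'" and W: "W = (y - p) - b * (x - p)"
  shows "W \<noteq> 0" "p * F b * (x - r) * W = x * (y - p) * F W"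
proof -
  have PE: "P \<alpha> = (a - \<alpha>) * (a' - \<alpha>)" for \<alpha> unfolding P_def unfolding a(2,3) by (simp add: algebra_simps)
  have mE: "m \<alpha> = \<alpha> + F \<alpha> - a - a'" for \<alpha> unfolding m_def unfolding a(2) by simp
  \<comment> \<open>If F z = d z and T acts on z as a, then T + g d + D d F(d) = a. The factor d =
    (a - \<alpha>) / \<beta> of either submodule satisfies this equation.\<close>
  have eq: "g * ((a - \<alpha>) / \<beta>) + D * ((a - \<alpha>) / \<beta>) * F ((a - \<alpha>) / \<beta>) = a - T"
    if s: "submodule g D \<alpha> \<beta>" for \<alpha> \<beta>
  proof -
    have b0: "\<beta> \<noteq> 0" "F \<beta> \<noteq> 0" and P0: "P \<alpha> \<noteq> 0" using s by (auto simp: submodule_def)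
    have "g * ((a - \<alpha>) / \<beta>) + D * ((a - \<alpha>) / \<beta>) * F ((a - \<alpha>) / \<beta>) =
        (a - \<alpha>) * (1 + \<delta> \<alpha> * m \<alpha>) + \<delta> \<alpha> * (a - \<alpha>) * (a - F \<alpha>)"
    proof -
      have "\<beta> * K * (X / \<beta>) = X * K" for K X using b0 by simp
      then have "g * ((a - \<alpha>) / \<beta>) = (a - \<alpha>) * (1 + \<delta> \<alpha> * m \<alpha>)"
        using s by (simp only: submodule_def)
      moreover have "D * ((a - \<alpha>) / \<beta>) * F ((a - \<alpha>) / \<beta>) = \<delta> \<alpha> * (a - \<alpha>) * (a - F \<alpha>)"
        using s b0 by (auto simp: submodule_def hom_distribs a(1))
      ultimately show ?thesis by simp
    qed
    also have "\<dots> = (a - \<alpha>) - \<delta> \<alpha> * P \<alpha>" unfolding PE mE by (simp add: algebra_simps)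
    also have "\<dots> = a - T" using \<delta>_P[OF P0] by simp
    finally show ?thesis .
  qed
  define d1 where "d1 = (a - \<alpha>1) / \<beta>1"
  define d2 where "d2 = (a - \<alpha>2) / \<beta>2"
  have b0: "\<beta>1 \<noteq> 0" "\<beta>2 \<noteq> 0" using s1 s2 by (auto simp: submodule_def)
  have bb: "b \<noteq> 0" "\<beta>2 = b * \<beta>1" using b b0 by auto
  have e1: "g * d1 + D * d1 * F d1 = - p" and e2: "g * d2 + D * d2 * F d2 = - p"
    using eq[OF s1] eq[OF s2] pr by (auto simp: d1_def d2_def)
  \<comment> \<open>Eliminating g between the two equations leaves a relation in which F acts only
    on the difference of the factors.\<close>
  have "d2 * (g * d1 + D * d1 * F d1) - d1 * (g * d2 + D * d2 * F d2) = p * (d1 - d2)"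
    unfolding e1 e2 by (simp add: algebra_simps)
  then have key: "p * (d2 - d1) = D * d1 * d2 * F (d2 - d1)" by (simp add: hom_distribs algebra_simps)
  have d1x: "d1 = (x - p) / \<beta>1" and d2y: "d2 = (y - p) / (b * \<beta>1)"
    unfolding d1_def d2_def x pr bb(2) by simp_all
  have Wd: "d2 - d1 = W / (b * \<beta>1)" unfolding d1x d2y W using bb b0 by (simp add: field_simps)
  show "W \<noteq> 0" using ne Wd unfolding d1_def d2_def by auto
  have P1: "P \<alpha>1 = (x - p) * (x - r)" and xp: "x - p \<noteq> 0" "x - r \<noteq> 0"
    using s1 unfolding PE submodule_def x pr by auto
  have D1: "D = x / ((x - p) * (x - r)) * \<beta>1 * F \<beta>1"
    using s1 P1 by (simp add: submodule_def \<delta>_def x)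
  have F0: "F b \<noteq> 0" "F \<beta>1 \<noteq> 0" using bb b0 by auto
  have "p * (W / (b * \<beta>1)) =
     x / ((x - p) * (x - r)) * \<beta>1 * F \<beta>1 * ((x - p) / \<beta>1) * ((y - p) / (b * \<beta>1)) * (F W / (F b * F \<beta>1))"
    using key unfolding Wd unfolding d1x d2y D1 by (simp add: hom_distribs)
  also have "\<dots> = x * (y - p) * F W / ((x - r) * (b * \<beta>1) * F b)"
  proof -
    have "x / (X * R) * B * FB * (X / B) * (Y / (b * B)) * (V / (Fb * FB)) = x * Y * V / (R * (b * B) * Fb)"
      if "X \<noteq> 0" "B \<noteq> 0" "FB \<noteq> 0" for X R B FB Y V Fb using that by (simp add: mult.assoc)
    then show ?thesis using xp b0 F0 by blast
  qed
  finally have "p * (W / (b * \<beta>1)) = x * (y - p) * F W / ((x - r) * (b * \<beta>1) * F b)" .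
  moreover have "p * Fb * R * W = V"
    if "p * (W / B) = V / (R * B * Fb)" "B \<noteq> 0" "R \<noteq> 0" "Fb \<noteq> 0" for R V B Fb
    using that by (simp add: field_simps)
  ultimately show "p * F b * (x - r) * W = x * (y - p) * F W"
    using xp b0 F0 bb by (metis mult_eq_0_iff)
qed

end

section \<open>Kernels of cyclic isogenies\<close>

context drinfeld_setting
begin

definition g\<^sub>\<phi> :: "('q poly \<Rightarrow> 'l poly) \<Rightarrow> 'l" where "g\<^sub>\<phi> \<phi> = coeff (\<phi> [:0, 1:]) q"

definition D\<^sub>\<phi> :: "('q poly \<Rightarrow> 'l poly) \<Rightarrow> 'l" where "D\<^sub>\<phi> \<phi> = coeff (\<phi> [:0, 1:]) (q ^ 2)"

abbreviation drinfeld :: "('q poly \<Rightarrow> 'l poly) \<Rightarrow> bool" where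
  "drinfeld \<phi> \<equiv> drinfeld_module \<gamma> 2 \<phi>"

lemma drinfeld_linearized: "drinfeld \<phi> \<Longrightarrow> linearized q (\<phi> a)"
  and drinfeld_coeff_1: "drinfeld \<phi> \<Longrightarrow> coeff (\<phi> a) 1 = \<gamma> a"
  and drinfeld_degree: "drinfeld \<phi> \<Longrightarrow> a \<noteq> 0 \<Longrightarrow> degree (\<phi> a) = q ^ (2 * degree a)"
  and drinfeld_const: "drinfeld \<phi> \<Longrightarrow> poly (\<phi> [:c:]) z = \<gamma> [:c:] * z"
  and drinfeld_add: "drinfeld \<phi> \<Longrightarrow> poly (\<phi> (a + b)) z = poly (\<phi> a) z + poly (\<phi> b) z"
  and drinfeld_mult: "drinfeld \<phi> \<Longrightarrow> poly (\<phi> (a * b)) z = poly (\<phi> a) (poly (\<phi> b) z)"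
  unfolding drinfeld_module_def by (simp_all add: q_card poly_pcompose mult.commute)

lemma drinfeld_0: "drinfeld \<phi> \<Longrightarrow> poly (\<phi> a) 0 = 0"
  using linearized_zero drinfeld_linearized by blast

lemma drinfeld_T:
  assumes "drinfeld \<phi>"
  shows "poly (\<phi> [:0, 1:]) z = T * z + g\<^sub>\<phi> \<phi> * F z + D\<^sub>\<phi> \<phi> * F (F z)"
proof -
  have "degree (\<phi> [:0, 1:]) \<le> q ^ 2" using drinfeld_degree[OF assms, of "[:0, 1:]"] by simp
  from linearized_poly[OF drinfeld_linearized[OF assms] this]
  have "poly (\<phi> [:0, 1:]) z = (\<Sum>k\<le>2. coeff (\<phi> [:0, 1:]) (q ^ k) * (F ^^ k) z)" .
  also have "\<dots> = coeff (\<phi> [:0, 1:]) 1 * z + g\<^sub>\<phi> \<phi> * F z + D\<^sub>\<phi> \<phi> * F (F z)"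
    by (simp add: numeral_2_eq_2 g\<^sub>\<phi>_def D\<^sub>\<phi>_def)
  finally show ?thesis using drinfeld_coeff_1[OF assms] by (simp add: T_def)
qed

lemma D\<^sub>\<phi>_nz: "drinfeld \<phi> \<Longrightarrow> D\<^sub>\<phi> \<phi> \<noteq> 0"
proof -
  assume "drinfeld \<phi>"
  then have d: "degree (\<phi> [:0, 1:]) = q ^ 2" using drinfeld_degree[of \<phi> "[:0, 1:]"] by simp
  then have "\<phi> [:0, 1:] \<noteq> 0" using q_gt_1 by auto
  then show ?thesis unfolding D\<^sub>\<phi>_def d[symmetric] by simp
qed

lemma j_invariant_eq: "j_invariant \<phi> = g\<^sub>\<phi> \<phi> * F (g\<^sub>\<phi> \<phi>) / D\<^sub>\<phi> \<phi>"
  unfolding j_invariant_def q_card[symmetric] by (simp add: g\<^sub>\<phi>_def D\<^sub>\<phi>_def F_def)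

lemma infinite_field: "infinite (UNIV :: 'l set)"
proof
  assume "finite (UNIV :: 'l set)"
  then have "finite (range (\<lambda>n. \<gamma> (monom 1 n)))" by (rule finite_subset[rotated]) simp
  moreover have "inj (\<lambda>n. \<gamma> (monom 1 n))"
  proof (rule injI)
    fix i k assume "\<gamma> (monom 1 i) = \<gamma> (monom 1 k)"
    then have "degree (monom 1 i :: 'q poly) = degree (monom 1 k :: 'q poly)" by (simp add: \<gamma>_eq_iff)
    then show "i = k" by (simp add: degree_monom_eq)
  qed
  then have "infinite (range (\<lambda>n. \<gamma> (monom 1 n)))" by (rule range_inj_infinite)
  ultimately show False by simp
qed

lemma additive_identity_coeffs:
  assumes "\<And>z. a0 * z + a1 * F z + a2 * F (F z) + a3 * F (F (F z)) + a4 * F (F (F (F z))) = 0"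
  shows "a3 = 0" "a4 = 0" "a2 = 0"
proof -
  define a where "a = (\<lambda>k. [a0, a1, a2, a3, a4] ! k)"
  have "(\<Sum>k\<le>4. a k * (F ^^ k) z) = 0" for z
    using assms[of z] by (simp add: numeral_eq_Suc a_def)
  then have "a k = 0" if "k \<le> 4" for k
    using additive_coeffs_eq_0[of UNIV 4 a] infinite_field that by blast
  from this[of 2] this[of 3] this[of 4] show "a3 = 0" "a4 = 0" "a2 = 0" by (simp_all add: a_def numeral_eq_Suc)
qed

lemma additive_identity_coeffs_on:
  assumes S: "card S > q" and "\<And>z. z \<in> S \<Longrightarrow> a0 * z + a1 * F z = 0"
  shows "a0 = 0" "a1 = 0"
proof -
  define a where "a = (\<lambda>k. [a0, a1] ! k)"
  have *: "(\<Sum>k\<le>1. a k * (F ^^ k) z) = 0" if "z \<in> S" for z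
    using assms(2)[OF that] by (simp add: a_def)
  have "a k = 0" if "k \<le> 1" for k
    by (rule additive_coeffs_eq_0[OF _ *]) (use S that in simp_all)
  from this[of 0] this[of 1] show "a0 = 0" "a1 = 0" by (simp_all add: a_def)
qed

context
  fixes N :: "'q poly" and \<phi> \<psi> :: "'q poly \<Rightarrow> 'l poly" and h :: "'l poly"
  assumes N: "N \<noteq> 0" and \<phi>: "drinfeld \<phi>" and \<psi>: "drinfeld \<psi>" and h: "cyclic_isogeny N \<phi> \<psi> h"
begin

lemma isogeny_linearized: "linearized q h"
  and isogeny_commute: "poly h (poly (\<phi> a) z) = poly (\<psi> a) (poly h z)"
proof -
  have i: "drinfeld_isogeny \<phi> \<psi> h" using h by (simp add: cyclic_isogeny_def)
  then show "linearized q h" unfolding drinfeld_isogeny_def q_card by blast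
  have "pcompose h (\<phi> a) = pcompose (\<psi> a) h" using i unfolding drinfeld_isogeny_def by blast
  then show "poly h (poly (\<phi> a) z) = poly (\<psi> a) (poly h z)" by (metis poly_pcompose)
qed

lemma isogeny_0: "poly h 0 = 0"
  using linearized_zero isogeny_linearized by blast

lemma isogeny_separable: "coeff h 1 \<noteq> 0"
proof (rule isogeny_coeff_1)
  show "h \<noteq> 0" "pcompose h (\<phi> [:0, 1:]) = pcompose (\<psi> [:0, 1:]) h"
    using h unfolding cyclic_isogeny_def drinfeld_isogeny_def by blast+
  show "poly h 0 = 0" by (rule isogeny_0)
qed (simp_all only: drinfeld_0[OF \<phi>] drinfeld_0[OF \<psi>] drinfeld_coeff_1[OF \<phi>] drinfeld_coeff_1[OF \<psi>] T_def)

lemma kernel_card: "card {z. poly h z = 0} = q ^ degree N"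
proof -
  obtain \<theta> where "bij_betw \<theta> (range (residue_class N)) {x. poly h x = 0}"
    using h by (auto simp: cyclic_isogeny_def)
  then show ?thesis using bij_betw_same_card card_residue_classes[OF N] unfolding q_card by fastforce
qed

lemma isogeny_degree: "degree h = q ^ degree N"
  using kernel_card card_roots_linearized[OF isogeny_linearized isogeny_separable] by simp

text \<open>The parametrization is pulled back from residue classes to polynomials, so that
  questions about the kernel become questions of divisibility by \<open>N\<close>.\<close>

lemma kernel_structure:
  obtains \<theta> where "{z. poly h z = 0} = range \<theta>" "\<And>a b. \<theta> a = \<theta> b \<longleftrightarrow> N dvd a - b"
    "\<And>a b. \<theta> (a * b) = poly (\<phi> a) (\<theta> b)" "\<theta> 0 = 0"
proof -
  obtain \<theta> where \<theta>: "bij_betw \<theta> (range (residue_class N)) {x. poly h x = 0}"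
     "\<And>a b. \<theta> (residue_class N (a * b)) = poly (\<phi> a) (\<theta> (residue_class N b))"
    using h unfolding cyclic_isogeny_def by blast
  define \<theta>' where "\<theta>' = (\<lambda>a. \<theta> (residue_class N a))"
  have "\<theta>' a = \<theta>' b \<longleftrightarrow> N dvd a - b" for a b
    unfolding \<theta>'_def residue_class_eq_iff[symmetric]
    by (rule inj_on_eq_iff[OF bij_betw_imp_inj_on[OF \<theta>(1)]]) simp_all
  moreover have "{z. poly h z = 0} = range \<theta>'"
    using \<theta>(1) unfolding \<theta>'_def bij_betw_def by auto
  moreover have "\<theta>' 0 = 0"
    using \<theta>(2)[of 0 0] drinfeld_const[OF \<phi>, of 0 "\<theta> (residue_class N 0)"] by (simp add: \<theta>'_def)
  moreover have "\<theta>' (a * b) = poly (\<phi> a) (\<theta>' b)" for a b unfolding \<theta>'_def by (rule \<theta>(2))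
  ultimately show ?thesis using that[of \<theta>'] by blast
qed

lemma kernel_stable: "poly h z = 0 \<Longrightarrow> poly h (poly (\<phi> a) z) = 0"
  using isogeny_commute drinfeld_0[OF \<psi>] by simp

lemma kernel_torsion:
  assumes "poly h z = 0" shows "poly (\<phi> N) z = 0"
proof -
  obtain \<theta> where \<theta>: "{z. poly h z = 0} = range \<theta>" "\<And>a b. \<theta> a = \<theta> b \<longleftrightarrow> N dvd a - b"
    "\<And>a b. \<theta> (a * b) = poly (\<phi> a) (\<theta> b)" "\<theta> 0 = 0" using kernel_structure by blast
  obtain b where "z = \<theta> b" using assms \<theta>(1) by auto
  then have "poly (\<phi> N) z = \<theta> (N * b)" using \<theta>(3) by simp
  also have "\<dots> = \<theta> 0" unfolding \<theta>(2) by simp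
  finally show ?thesis using \<theta>(4) by simp
qed

text \<open>The point belonging to 1 generates the kernel and has annihilator exactly (N).\<close>

lemma kernel_annihilator:
  assumes "\<And>z. poly h z = 0 \<Longrightarrow> poly (\<phi> a) z = 0" shows "N dvd a"
proof -
  obtain \<theta> where \<theta>: "{z. poly h z = 0} = range \<theta>" "\<And>a b. \<theta> a = \<theta> b \<longleftrightarrow> N dvd a - b"
    "\<And>a b. \<theta> (a * b) = poly (\<phi> a) (\<theta> b)" "\<theta> 0 = 0" using kernel_structure by blast
  have "\<theta> 1 \<in> {z. poly h z = 0}" unfolding \<theta>(1) by simp
  then have "\<theta> (a * 1) = 0" using assms unfolding \<theta>(3) by simp
  then show ?thesis using \<theta>(2)[of a 0] \<theta>(4) by simp
qed

text \<open>In the cyclic module F_q[T]/(p M) the p-torsion consists of the multiples of M, which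
  are indexed by residues modulo p. The whole module has q^(2 deg p) torsion points instead, and
  this contrast excludes backtracking.\<close>

lemma kernel_torsion_card:
  assumes N': "N = p * M"
  shows "card {z. poly h z = 0 \<and> poly (\<phi> p) z = 0} \<le> q ^ degree p"
proof -
  obtain \<theta> where \<theta>: "{z. poly h z = 0} = range \<theta>" "\<And>a b. \<theta> a = \<theta> b \<longleftrightarrow> N dvd a - b"
    "\<And>a b. \<theta> (a * b) = poly (\<phi> a) (\<theta> b)" "\<theta> 0 = 0" using kernel_structure by blast
  have p0: "p \<noteq> 0" using N' N by auto
  define S where "S = {b::'q poly. b = 0 \<or> degree b < degree p}"
  have card_S: "card S = q ^ degree p" unfolding S_def card_small_degree q_card ..
  then have "finite S" using q_gt_1 by (intro card_ge_0_finite) simp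
  have "{z. poly h z = 0 \<and> poly (\<phi> p) z = 0} \<subseteq> (\<lambda>c. \<theta> (M * c)) ` S"
  proof
    fix z assume z: "z \<in> {z. poly h z = 0 \<and> poly (\<phi> p) z = 0}"
    then obtain b where b: "z = \<theta> b" using \<theta>(1) by auto
    have "\<theta> (p * b) = \<theta> 0" using z b \<theta>(3,4) by simp
    then have "p * M dvd p * b" using \<theta>(2) N' by simp
    then have "M dvd b" using p0 by simp
    then obtain c where c: "b = M * c" by (elim dvdE)
    have "\<theta> b = \<theta> (M * (c mod p))" unfolding \<theta>(2) c N'
      by (simp add: right_diff_distrib[symmetric] minus_mod_eq_mult_div mult_ac)
    moreover have "c mod p \<in> S" using degree_mod_less[OF p0, of c] by (auto simp: S_def)
    ultimately show "z \<in> (\<lambda>c. \<theta> (M * c)) ` S" using b by auto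
  qed
  then show ?thesis unfolding card_S[symmetric] by (rule surj_card_le[OF \<open>finite S\<close>])
qed

end

lemma torsion_card:
  assumes "drinfeld \<phi>" "p \<noteq> 0" shows "card {z. poly (\<phi> p) z = 0} = q ^ (2 * degree p)"
proof -
  have "coeff (\<phi> p) 1 \<noteq> 0" unfolding drinfeld_coeff_1[OF assms(1)] using assms(2) by simp
  from card_roots_linearized[OF drinfeld_linearized[OF assms(1)] this]
  show ?thesis using drinfeld_degree[OF assms] by simp
qed

text \<open>
  Otherwise the kernel of the composite from the start, which is cyclic, would contain the full
  \<open>p\<close>-torsion.
\<close>

lemma tower_noncyclic_contradiction:
  assumes tower: "isogeny_tower \<gamma> P \<phi> \<mu>" and P: "P \<noteq> 0" and p: "p dvd P" "degree p \<ge> 1"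
  shows "\<exists>z. poly (\<phi> e p) z = 0 \<and> poly (\<mu> (Suc e)) (poly (\<mu> e) z) \<noteq> 0"
proof (rule ccontr)
  assume n: "\<not> ?thesis"
  have dr: "drinfeld (\<phi> i)" and cyc: "cyclic_isogeny (P ^ i) (\<phi> 0) (\<phi> i) (isogeny_comp \<mu> i)" for i
    using tower by (auto simp: isogeny_tower_def)
  have p0: "p \<noteq> 0" using p P by auto
  have PN: "P ^ i \<noteq> 0" for i using P by simp
  have "p dvd P ^ Suc (Suc e)" using p by (simp add: dvd_mult2)
  then obtain M where M: "P ^ Suc (Suc e) = p * M" by (elim dvdE)
  \<comment> \<open>The composite up to the e-th module carries p-torsion to p-torsion, which by
    assumption the next two isogenies kill.\<close>
  have "poly (isogeny_comp \<mu> (Suc (Suc e))) z = 0" if z: "poly (\<phi> 0 p) z = 0" for z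
  proof -
    have "poly (\<phi> e p) (poly (isogeny_comp \<mu> e) z) = poly (isogeny_comp \<mu> e) (poly (\<phi> 0 p) z)"
      using isogeny_commute[OF PN dr dr cyc] by simp
    also have "\<dots> = 0" using z isogeny_0[OF PN dr dr cyc] by simp
    finally have "poly (\<mu> (Suc e)) (poly (\<mu> e) (poly (isogeny_comp \<mu> e) z)) = 0" using n by blast
    then show ?thesis by (simp add: poly_pcompose)
  qed
  then have "{z. poly (\<phi> 0 p) z = 0} \<subseteq>
      {z. poly (isogeny_comp \<mu> (Suc (Suc e))) z = 0 \<and> poly (\<phi> 0 p) z = 0}" by auto
  moreover have "finite {z. poly (isogeny_comp \<mu> (Suc (Suc e))) z = 0 \<and> poly (\<phi> 0 p) z = 0}"
  proof (rule finite_subset)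
    show "finite {z. poly (\<phi> 0 p) z = 0}"
      using torsion_card[OF dr p0] q_gt_1 by (intro card_ge_0_finite) simp
  qed auto
  ultimately have "card {z. poly (\<phi> 0 p) z = 0} \<le>
      card {z. poly (isogeny_comp \<mu> (Suc (Suc e))) z = 0 \<and> poly (\<phi> 0 p) z = 0}"
    by (intro card_mono)
  also have "\<dots> \<le> q ^ degree p" by (rule kernel_torsion_card[OF PN dr dr cyc M])
  finally have "q ^ (2 * degree p) \<le> q ^ degree p" unfolding torsion_card[OF dr p0] .
  then show False using q_gt_1 p by (simp add: power_increasing_iff)
qed

end

section \<open>Isogenies of level one and two as submodules\<close>

context drinfeld_setting
begin

text \<open>Level of degree one leaves h = c (F - d), where d is the factor by which F acts on the
  kernel. The kernel consists of a-eigenvectors of T, which gives the equation for d; the last two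
  relations are the coefficients of F^3 and F^2 in the intertwining identity.\<close>

lemma linear_isogeny:
  assumes \<phi>: "drinfeld \<phi>" and \<psi>: "drinfeld \<psi>" and h: "cyclic_isogeny [:- a, 1:] \<phi> \<psi> h"
  obtains c d where "c \<noteq> 0" "d \<noteq> 0" "\<And>z. poly h z = c * (F z - d * z)"
    "T - \<gamma> [:a:] + g\<^sub>\<phi> \<phi> * d + D\<^sub>\<phi> \<phi> * d * F d = 0"
    "c * F (D\<^sub>\<phi> \<phi>) = D\<^sub>\<phi> \<psi> * F (F c)"
    "c * (F (g\<^sub>\<phi> \<phi>) - d * D\<^sub>\<phi> \<phi>) = g\<^sub>\<phi> \<psi> * F c - D\<^sub>\<phi> \<psi> * F (F c) * F (F d)"
proof -
  have N: "[:- a, 1:] \<noteq> 0" by simp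
  note iso = N \<phi> \<psi> h
  define c where "c = coeff h q"
  define h0 where "h0 = coeff h 1"
  define d where "d = - h0 / c"
  have dh: "degree h = q" using isogeny_degree[OF iso] by simp
  have h0: "h0 \<noteq> 0" unfolding h0_def by (rule isogeny_separable[OF iso])
  have "h \<noteq> 0" using h0 by (auto simp: h0_def)
  then have c0: "c \<noteq> 0" unfolding c_def dh[symmetric] by simp
  have "poly h z = (\<Sum>k\<le>1. coeff h (q ^ k) * (F ^^ k) z)" for z
    using linearized_poly[OF isogeny_linearized[OF iso], of 1] dh by simp
  then have hz: "poly h z = c * (F z - d * z)" for z
    using c0 by (simp add: c_def[symmetric] h0_def d_def field_simps)
  have d0: "d \<noteq> 0" using h0 c0 by (simp add: d_def)
  have ker: "card {z. poly h z = 0} = q" using kernel_card[OF iso] by simp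
  have "{z. poly h z = 0} \<noteq> {0}"
  proof
    assume "{z. poly h z = 0} = {0}"
    then have "q = card {0::'l}" using ker by simp
    then show False using q_gt_1 by simp
  qed
  then obtain z where z: "poly h z = 0" "z \<noteq> 0" using isogeny_0[OF iso] by blast
  have Fz: "F z = d * z" using z hz c0 by simp
  have "poly (\<phi> ([:- a:] + [:0, 1:])) z = 0" using kernel_torsion[OF iso z(1)] by simp
  then have "\<gamma> [:- a:] * z + (T * z + g\<^sub>\<phi> \<phi> * F z + D\<^sub>\<phi> \<phi> * F (F z)) = 0"
    unfolding drinfeld_add[OF \<phi>] drinfeld_const[OF \<phi>] drinfeld_T[OF \<phi>] .
  moreover have "\<gamma> [:- a:] = - \<gamma> [:a:]" by (simp flip: \<gamma>_simps(6))
  ultimately have "(T - \<gamma> [:a:] + g\<^sub>\<phi> \<phi> * d + D\<^sub>\<phi> \<phi> * d * F d) * z = 0"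
    by (simp add: Fz F.hom_mult algebra_simps)
  then have rel: "T - \<gamma> [:a:] + g\<^sub>\<phi> \<phi> * d + D\<^sub>\<phi> \<phi> * d * F d = 0" using z by simp
  define g D g' D' where "g = g\<^sub>\<phi> \<phi>" and "D = D\<^sub>\<phi> \<phi>" and "g' = g\<^sub>\<phi> \<psi>" and "D' = D\<^sub>\<phi> \<psi>"
  have com: "c * (F (T * z + g * F z + D * F (F z)) - d * (T * z + g * F z + D * F (F z)))
     = T * (c * (F z - d * z)) + g' * F (c * (F z - d * z)) + D' * F (F (c * (F z - d * z)))" for z
    using isogeny_commute[OF iso, of "[:0, 1:]" z]
    unfolding hz drinfeld_T[OF \<phi>] drinfeld_T[OF \<psi>] g_def D_def g'_def D'_def .
  define a0 where "a0 = - c * d * T + T * c * d"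
  define a1 where "a1 = c * F T - c * d * g - T * c + g' * F c * F d"
  define a2 where "a2 = c * F g - c * d * D - g' * F c + D' * F (F c) * F (F d)"
  define a3 where "a3 = c * F D - D' * F (F c)"
  have "a0 * z + a1 * F z + a2 * F (F z) + a3 * F (F (F z)) + 0 * F (F (F (F z))) = 0" for z
    using com[of z] unfolding a0_def a1_def a2_def a3_def by (simp add: hom_distribs algebra_simps)
  from additive_identity_coeffs[OF this] have "a2 = 0" "a3 = 0" by simp_all
  then show ?thesis using that[OF c0 d0 hz rel]
    unfolding a2_def a3_def g_def D_def g'_def D'_def by (simp add: algebra_simps)
qed

end

locale quadratic_setting = drinfeld_setting \<iota> q
  for \<iota> :: "'q::{finite,field} poly fract \<Rightarrow> 'l::alg_closed_field" and q +
  fixes t\<^sub>q n\<^sub>q :: 'q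
begin

sublocale L: quadratic_level F T "\<gamma> [:t\<^sub>q:]" "\<gamma> [:n\<^sub>q:]"
  by unfold_locales (simp_all add: F_\<gamma>)

abbreviation N\<^sub>q :: "'q poly" where "N\<^sub>q \<equiv> [:n\<^sub>q, - t\<^sub>q, 1:]"

lemma N\<^sub>q_action:
  assumes \<phi>: "drinfeld \<phi>"
  shows "poly (\<phi> N\<^sub>q) z = poly (\<phi> [:0, 1:]) (poly (\<phi> [:0, 1:]) z) - \<gamma> [:t\<^sub>q:] * poly (\<phi> [:0, 1:]) z + \<gamma> [:n\<^sub>q:] * z"
proof -
  have "N\<^sub>q = [:0, 1:] * [:0, 1:] + ([:- t\<^sub>q:] * [:0, 1:] + [:n\<^sub>q:])" by simp
  then have "poly (\<phi> N\<^sub>q) z = poly (\<phi> [:0, 1:]) (poly (\<phi> [:0, 1:]) z) +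
      (\<gamma> [:- t\<^sub>q:] * poly (\<phi> [:0, 1:]) z + \<gamma> [:n\<^sub>q:] * z)"
    by (simp only: drinfeld_add[OF \<phi>] drinfeld_mult[OF \<phi>] drinfeld_const[OF \<phi>])
  moreover have "\<gamma> [:- t\<^sub>q:] = - \<gamma> [:t\<^sub>q:]" by (simp flip: \<gamma>_simps(6))
  ultimately show ?thesis by simp
qed

lemma module_op_eq_poly: "drinfeld \<phi> \<Longrightarrow> poly (\<phi> [:0, 1:]) z = L.module_op (g\<^sub>\<phi> \<phi>) (D\<^sub>\<phi> \<phi>) z"
  unfolding L.module_op_def by (rule drinfeld_T)

lemma P_T: "L.P T = \<gamma> N\<^sub>q"
proof -
  have "N\<^sub>q = [:0, 1:] * [:0, 1:] + (- [:t\<^sub>q:] * [:0, 1:] + [:n\<^sub>q:])" by simp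
  then show ?thesis unfolding L.P_def T_def by (simp only: \<gamma>_simps) simp
qed

lemma P_T_nz: "L.P T \<noteq> 0"
  unfolding P_T by simp

text \<open>On the kernel, which has q^2 points, h = 0 expresses F^2 through 1 and F, so T acts
  there as some \<beta> F + \<alpha>. Both h and P(\<beta> F + \<alpha>) vanish on the kernel, hence
  are proportional.\<close>

lemma quadratic_isogeny:
  assumes \<phi>: "drinfeld \<phi>" and \<psi>: "drinfeld \<psi>" and h: "cyclic_isogeny N\<^sub>q \<phi> \<psi> h"
    and g0: "g\<^sub>\<phi> \<phi> \<noteq> 0"
  obtains \<alpha> \<beta> c where "c \<noteq> 0" "\<And>z. poly h z = c * L.P_act \<alpha> \<beta> z"
    "L.submodule (g\<^sub>\<phi> \<phi>) (D\<^sub>\<phi> \<phi>) \<alpha> \<beta>"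
    "L.submodule (g\<^sub>\<phi> \<psi>) (D\<^sub>\<phi> \<psi>) (L.dual\<alpha> \<alpha>) (L.dual\<beta> \<alpha> \<beta> c)"
proof -
  have N: "N\<^sub>q \<noteq> 0" by simp
  note iso = N \<phi> \<psi> h
  define g D g' D' where "g = g\<^sub>\<phi> \<phi>" and "D = D\<^sub>\<phi> \<phi>" and "g' = g\<^sub>\<phi> \<psi>" and "D' = D\<^sub>\<phi> \<psi>"
  define h0 h1 h2 where "h0 = coeff h 1" and "h1 = coeff h q" and "h2 = coeff h (q ^ 2)"
  have dh: "degree h = q ^ 2" using isogeny_degree[OF iso] by (simp add: numeral_2_eq_2)
  have h0: "h0 \<noteq> 0" unfolding h0_def by (rule isogeny_separable[OF iso])
  then have "h \<noteq> 0" by (auto simp: h0_def)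
  then have h2: "h2 \<noteq> 0" unfolding h2_def dh[symmetric] by simp
  have "poly h z = (\<Sum>k\<le>2. coeff h (q ^ k) * (F ^^ k) z)" for z
    using linearized_poly[OF isogeny_linearized[OF iso], of 2] dh by simp
  then have hz: "poly h z = h0 * z + h1 * F z + h2 * F (F z)" for z
    by (simp add: h0_def h1_def h2_def numeral_2_eq_2)
  define W where "W = {z. poly h z = 0}"
  have cW: "card W = q ^ 2" using kernel_card[OF iso] by (simp add: W_def numeral_2_eq_2)
  have qq: "q ^ 2 > q" using q_gt_1 by (simp add: power2_eq_square)
  define \<alpha> where "\<alpha> = T - D * h0 / h2"
  define \<beta> where "\<beta> = g - D * h1 / h2"
  have D0: "D \<noteq> 0" unfolding D_def by (rule D\<^sub>\<phi>_nz[OF \<phi>])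
  have act: "poly (\<phi> [:0, 1:]) z = L.act \<alpha> \<beta> z" if "z \<in> W" for z
  proof -
    have "h2 * F (F z) + (h0 * z + h1 * F z) = 0" using that hz[of z] by (simp add: W_def algebra_simps)
    then have "h2 * F (F z) = - (h0 * z + h1 * F z)" by (simp only: eq_neg_iff_add_eq_0)
    then have Fz: "F (F z) = - (h0 * z + h1 * F z) / h2" using h2 by (simp add: field_simps)
    have "poly (\<phi> [:0, 1:]) z = T * z + g * F z + D * (- (h0 * z + h1 * F z) / h2)"
      unfolding drinfeld_T[OF \<phi>] g_def[symmetric] D_def[symmetric] Fz ..
    also have "\<dots> = L.act \<alpha> \<beta> z" using h2 unfolding L.act_def \<alpha>_def \<beta>_def by (simp add: field_simps)
    finally show ?thesis .
  qed
  have stable: "poly (\<phi> [:0, 1:]) z \<in> W" if "z \<in> W" for z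
    using kernel_stable[OF iso] that by (simp add: W_def)
  \<comment> \<open>If \<beta> = 0, T acts on the kernel as multiplication by \<alpha>, and
    stability of the kernel forces F(\<alpha>) = \<alpha>; g \<noteq> 0 enters as h1 \<noteq> 0.
    Then \<alpha> is a constant and a polynomial of degree one annihilates the kernel, contrary to
    its annihilator having degree two.\<close>
  have \<beta>0: "\<beta> \<noteq> 0"
  proof
    assume b: "\<beta> = 0"
    have *: "(h1 * (F \<alpha> - \<alpha>)) * w + (h2 * (F (F \<alpha>) - \<alpha>)) * F w = 0" if w: "w \<in> F ` W" for w
    proof -
      obtain z where z: "z \<in> W" "w = F z" using w by blast
      have "\<alpha> * z \<in> W" using stable[OF z(1)] act[OF z(1)] b by (simp add: L.act_def)
      then have "h0 * (\<alpha> * z) + h1 * F (\<alpha> * z) + h2 * F (F (\<alpha> * z)) = 0"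
        "h0 * z + h1 * F z + h2 * F (F z) = 0" using z hz by (auto simp: W_def)
      then have "h0 * (\<alpha> * z) + h1 * F (\<alpha> * z) + h2 * F (F (\<alpha> * z)) - \<alpha> * (h0 * z + h1 * F z + h2 * F (F z)) = 0"
        by simp
      then show ?thesis unfolding z(2) by (simp add: F.hom_mult algebra_simps)
    qed
    have "inj_on F W" by (rule inj_onI) simp
    then have "card (F ` W) > q" using cW qq by (simp add: card_image)
    then have "h1 * (F \<alpha> - \<alpha>) = 0" by (rule additive_identity_coeffs_on(1)) (rule *)
    moreover have "h1 \<noteq> 0" using b g0 by (auto simp: \<beta>_def g_def)
    ultimately have "F \<alpha> = \<alpha>" by simp
    then obtain c where c: "\<alpha> = \<gamma> [:c:]" using F_fixed by blast
    have "N\<^sub>q dvd [:- c:] + [:0, 1:]"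
    proof (rule kernel_annihilator[OF iso])
      fix z assume "poly h z = 0"
      then have "poly (\<phi> [:0, 1:]) z = \<alpha> * z" using act b by (simp add: W_def L.act_def)
      moreover have "\<gamma> [:- c:] = - \<alpha>" unfolding c by (simp flip: \<gamma>_simps(6))
      ultimately show "poly (\<phi> ([:- c:] + [:0, 1:])) z = 0"
        unfolding drinfeld_add[OF \<phi>] drinfeld_const[OF \<phi>] by simp
    qed
    then have "degree N\<^sub>q \<le> degree ([:- c:] + [:0, 1:])" by (intro dvd_imp_degree_le) auto
    then show False by simp
  qed
  have F\<beta>0: "F \<beta> \<noteq> 0" using \<beta>0 by simp
  have zero: "L.P_act \<alpha> \<beta> z = 0" if "z \<in> W" for z
    using kernel_torsion[OF iso] that act[OF that] act[OF stable[OF that]] N\<^sub>q_action[OF \<phi>, of z]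
    by (simp add: W_def L.P_act_def)
  \<comment> \<open>F^2 is eliminated between P(\<beta> F + \<alpha>) and h. The rest has order one
    in F and vanishes at more than q points, so both coefficients are zero.\<close>
  have *: "(h2 * L.P \<alpha> - \<beta> * F \<beta> * h0) * z + (h2 * \<beta> * L.m \<alpha> - \<beta> * F \<beta> * h1) * F z = 0" if "z \<in> W" for z
  proof -
    have "h2 * L.P_act \<alpha> \<beta> z - \<beta> * F \<beta> * (h0 * z + h1 * F z + h2 * F (F z)) = 0"
      using zero[OF that] that hz by (simp add: W_def)
    then show ?thesis unfolding L.P_act_expand by (simp add: algebra_simps)
  qed
  have "card W > q" using cW qq by simp
  note ** = additive_identity_coeffs_on[OF this *]
  have e0: "h2 * L.P \<alpha> = \<beta> * F \<beta> * h0" using **(1) by simp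
  have e1: "h2 * \<beta> * L.m \<alpha> = \<beta> * F \<beta> * h1" using **(2) by simp
  define c where "c = h2 / (\<beta> * F \<beta>)"
  have c0: "c \<noteq> 0" using h2 \<beta>0 by (simp add: c_def)
  have bb: "\<beta> * F \<beta> \<noteq> 0" using \<beta>0 F\<beta>0 by simp
  have "c * \<beta> * L.m \<alpha> = (h2 * \<beta> * L.m \<alpha>) / (\<beta> * F \<beta>)" "c * L.P \<alpha> = (h2 * L.P \<alpha>) / (\<beta> * F \<beta>)"
    by (simp_all add: c_def)
  then have hc: "h2 = c * \<beta> * F \<beta>" "h1 = c * \<beta> * L.m \<alpha>" "h0 = c * L.P \<alpha>"
    unfolding e0 e1 using bb by (simp_all add: c_def)
  have hP: "poly h z = c * L.P_act \<alpha> \<beta> z" for z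
    unfolding hz hc L.P_act_expand by (simp add: algebra_simps)
  have P0: "L.P \<alpha> \<noteq> 0" using h0 hc by auto
  have Ta: "T - \<alpha> = D * h0 / h2" by (simp add: \<alpha>_def)
  then have \<delta>: "L.\<delta> \<alpha> = D / (\<beta> * F \<beta>)" unfolding L.\<delta>_def Ta hc using c0 P0 by simp
  have sub: "L.submodule g D \<alpha> \<beta>" unfolding L.submodule_def
  proof (intro conjI)
    show "\<beta> \<noteq> 0" "L.P \<alpha> \<noteq> 0" by fact+
    show "T \<noteq> \<alpha>" using Ta D0 h0 h2 by auto
    show "D = L.\<delta> \<alpha> * \<beta> * F \<beta>" using \<beta>0 F\<beta>0 by (simp add: \<delta>)
    have "g = \<beta> + D * h1 / h2" by (simp add: \<beta>_def)
    also have "\<dots> = \<beta> * (1 + L.\<delta> \<alpha> * L.m \<alpha>)" unfolding \<delta> hc using c0 \<beta>0 F\<beta>0 by (simp add: field_simps)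
    finally show "g = \<beta> * (1 + L.\<delta> \<alpha> * L.m \<alpha>)" .
  qed
  have com: "h0 * (T * z + g * F z + D * F (F z)) + h1 * F (T * z + g * F z + D * F (F z)) +
       h2 * F (F (T * z + g * F z + D * F (F z)))
     = T * (h0 * z + h1 * F z + h2 * F (F z)) + g' * F (h0 * z + h1 * F z + h2 * F (F z)) +
       D' * F (F (h0 * z + h1 * F z + h2 * F (F z)))" for z
    using isogeny_commute[OF iso, of "[:0, 1:]" z]
    unfolding hz drinfeld_T[OF \<phi>] drinfeld_T[OF \<psi>] g_def D_def g'_def D'_def .
  define a1 where "a1 = h0 * g + h1 * F T - T * h1 - g' * F h0"
  define a2 where "a2 = h0 * D + h1 * F g + h2 * F (F T) - T * h2 - g' * F h1 - D' * F (F h0)"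
  define a3 where "a3 = h1 * F D + h2 * F (F g) - g' * F h2 - D' * F (F h1)"
  define a4 where "a4 = h2 * F (F D) - D' * F (F h2)"
  have "0 * z + a1 * F z + a2 * F (F z) + a3 * F (F (F z)) + a4 * F (F (F (F z))) = 0" for z
    using com[of z] unfolding a1_def a2_def a3_def a4_def by (simp add: hom_distribs algebra_simps)
  from additive_identity_coeffs[OF this] have "a3 = 0" "a4 = 0" by simp_all
  then have top: "c * \<beta> * F \<beta> * F (F D) = D' * F (F (c * \<beta> * F \<beta>))"
    "c * \<beta> * L.m \<alpha> * F D + c * \<beta> * F \<beta> * F (F g) = g' * F (c * \<beta> * F \<beta>) + D' * F (F (c * \<beta> * L.m \<alpha>))"
    unfolding a3_def a4_def hc[symmetric] by (simp_all add: algebra_simps)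
  have "L.submodule g' D' (L.dual\<alpha> \<alpha>) (L.dual\<beta> \<alpha> \<beta> c)"
    by (rule L.dual_submodule[OF sub c0 P_T_nz top])
  then show ?thesis using that[OF c0 hP] sub unfolding g_def D_def g'_def D'_def by blast
qed

end

section \<open>From the relation to the recursive equation\<close>

lemma poly_map_poly_sum:
  fixes h :: "'a::zero \<Rightarrow> 'b::comm_ring_1"
  assumes "h 0 = 0"
  shows "poly (map_poly h g) y = (\<Sum>i\<le>degree g. h (coeff g i) * y ^ i)"
proof -
  have "poly (map_poly h g) y = (\<Sum>i\<le>degree (map_poly h g). h (coeff g i) * y ^ i)"
    unfolding poly_altdef using assms by (simp add: coeff_map_poly)
  also have "\<dots> = (\<Sum>i\<le>degree g. h (coeff g i) * y ^ i)"
  proof (rule sum.mono_neutral_left)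
    show "\<forall>i\<in>{..degree g} - {..degree (map_poly h g)}. h (coeff g i) * y ^ i = 0"
    proof
      fix i assume "i \<in> {..degree g} - {..degree (map_poly h g)}"
      then have "coeff (map_poly h g) i = 0" by (simp add: coeff_eq_0)
      then show "h (coeff g i) * y ^ i = 0" by (simp add: coeff_map_poly assms)
    qed
  qed (use assms map_poly_degree_leq[of h g] in auto)
  finally show ?thesis .
qed

lemma eval2_sum:
  "eval2 \<iota> g x y = (\<Sum>i\<le>degree g. poly (map_poly \<iota> (coeff g i)) x * y ^ i)"
  unfolding eval2_def by (rule poly_map_poly_sum) simp

sublocale field_hom \<subseteq> map_poly_hom: map_poly_idom_hom hom ..

text \<open>This is X^(deg p) p(\<kappa> / X).\<close>

definition reciprocal_poly :: "'k::field \<Rightarrow> 'k poly \<Rightarrow> 'k poly" where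
  "reciprocal_poly \<kappa> p = Polynomial.smult (\<kappa> ^ degree p) (pcompose (reflect_poly p) [:0, 1 / \<kappa>:])"

lemma reciprocal_poly_eq_0_iff:
  "\<kappa> \<noteq> 0 \<Longrightarrow> reciprocal_poly \<kappa> p = 0 \<longleftrightarrow> p = 0"
proof
  assume \<kappa>: "\<kappa> \<noteq> 0" and "reciprocal_poly \<kappa> p = 0"
  then have "pcompose (reflect_poly p) [:0, 1 / \<kappa>:] = 0" by (simp add: reciprocal_poly_def)
  then have "reflect_poly p = 0" by (rule pcompose_eq_0) (use \<kappa> in simp)
  then show "p = 0" by simp
qed (simp add: reciprocal_poly_def)

lemma (in field_hom) poly_reciprocal_poly:
  assumes \<kappa>: "\<kappa> \<noteq> 0" and x: "x \<noteq> 0"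
  shows "poly (map_poly hom (reciprocal_poly \<kappa> p)) x = x ^ degree p * poly (map_poly hom p) (hom \<kappa> / x)"
proof -
  have h: "hom \<kappa> \<noteq> 0" using \<kappa> by simp
  have "poly (map_poly hom (reciprocal_poly \<kappa> p)) x =
      hom \<kappa> ^ degree p * poly (reflect_poly (map_poly hom p)) (x * (1 / hom \<kappa>))"
  proof -
    have "map_poly hom (reflect_poly p) = reflect_poly (map_poly hom p)"
      by (intro poly_eqI) (simp add: coeff_reflect_poly)
    then show ?thesis
      by (simp add: reciprocal_poly_def hom_distribs map_poly_pcompose poly_pcompose)
  qed
  also have "\<dots> = hom \<kappa> ^ degree p * ((x / hom \<kappa>) ^ degree p * poly (map_poly hom p) (hom \<kappa> / x))"
    using h x by (subst poly_reflect_poly_nz) simp_all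
  finally show ?thesis using h by (simp add: power_divide)
qed

text \<open>This is X^M g(\<kappa> / X, Y); the sum of all coefficient degrees serves as a common
  bound \<open>M\<close>.\<close>

definition shift_first :: "'k::field \<Rightarrow> 'k poly poly \<Rightarrow> 'k poly poly" where
  "shift_first \<kappa> g = (let M = (\<Sum>i\<le>degree g. degree (coeff g i)) in
     map_poly (\<lambda>c. monom 1 (M - degree c) * reciprocal_poly \<kappa> c) g)"

lemma degree_shift_first: "\<kappa> \<noteq> 0 \<Longrightarrow> degree (shift_first \<kappa> g) = degree g"
  unfolding shift_first_def Let_def
  by (cases "g = 0") (auto intro!: map_poly_degree_eq simp: reciprocal_poly_eq_0_iff)

lemma (in field_hom) eval2_shift_first:
  assumes \<kappa>: "\<kappa> \<noteq> 0" and x: "x \<noteq> 0" and z: "eval2 hom g (hom \<kappa> / x) y = 0"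
  shows "eval2 hom (shift_first \<kappa> g) x y = 0"
proof -
  define M where "M = (\<Sum>i\<le>degree g. degree (coeff g i))"
  have M: "degree (coeff g i) \<le> M" if "i \<le> degree g" for i
    unfolding M_def using that by (intro member_le_sum) auto
  have c: "coeff (shift_first \<kappa> g) i = monom 1 (M - degree (coeff g i)) * reciprocal_poly \<kappa> (coeff g i)" for i
    unfolding shift_first_def Let_def M_def by (simp add: coeff_map_poly reciprocal_poly_def)
  have "poly (map_poly hom (coeff (shift_first \<kappa> g) i)) x * y ^ i =
      x ^ M * (poly (map_poly hom (coeff g i)) (hom \<kappa> / x) * y ^ i)" if "i \<le> degree g" for i
  proof -
    have "x ^ M = x ^ (M - degree (coeff g i)) * x ^ degree (coeff g i)"
      using M[OF that] by (simp flip: power_add)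
    then show ?thesis unfolding c
      by (simp add: hom_distribs poly_monom poly_reciprocal_poly[OF \<kappa> x])
  qed
  then have "eval2 hom (shift_first \<kappa> g) x y = x ^ M * eval2 hom g (hom \<kappa> / x) y"
    unfolding eval2_sum degree_shift_first[OF \<kappa>] sum_distrib_left by (intro sum.cong) auto
  then show ?thesis using z by simp
qed

lemma (in field_hom) poly_over_range_iff:
  "poly_over (range hom) p \<longleftrightarrow> (\<exists>r. p = map_poly hom r)"
proof
  assume p: "poly_over (range hom) p"
  have inj: "inj hom" by (auto intro: injI)
  have "inv_into UNIV hom 0 = 0" using inv_into_f_f[OF inj, of 0] by simp
  then have "p = map_poly hom (map_poly (inv_into UNIV hom) p)"
    using p by (intro poly_eqI) (auto simp: coeff_map_poly poly_over_def f_inv_into_f)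
  then show "\<exists>r. p = map_poly hom r" by blast
qed (auto simp: poly_over_def)

lemma (in field_hom) transcendental_over_iff:
  "transcendental_over hom x \<longleftrightarrow> \<not> algebraic_in (range hom) x"
proof -
  have "algebraic_in (range hom) x \<longleftrightarrow> (\<exists>r. r \<noteq> 0 \<and> poly (map_poly hom r) x = 0)"
  proof
    assume "algebraic_in (range hom) x"
    then obtain p where p: "p \<noteq> 0" "poly_over (range hom) p" "poly p x = 0"
      unfolding algebraic_in_def by blast
    then obtain r where "p = map_poly hom r" using poly_over_range_iff by blast
    then show "\<exists>r. r \<noteq> 0 \<and> poly (map_poly hom r) x = 0" using p by auto
  next
    assume "\<exists>r. r \<noteq> 0 \<and> poly (map_poly hom r) x = 0"
    then obtain r where r: "r \<noteq> 0" "poly (map_poly hom r) x = 0" by blast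
    have "poly_over (range hom) (map_poly hom r)" unfolding poly_over_range_iff by blast
    moreover have "map_poly hom r \<noteq> 0" using r(1) by simp
    ultimately show "algebraic_in (range hom) x" unfolding algebraic_in_def using r(2) by blast
  qed
  then show ?thesis unfolding transcendental_over_def by blast
qed

lemma (in field_hom) subfield_range: "is_subfield (range hom)"
  unfolding is_subfield_def
proof (intro conjI ballI)
  show "0 \<in> range hom" using rangeI[of hom 0] by simp
  show "1 \<in> range hom" using rangeI[of hom 1] by simp
  fix x y assume "x \<in> range hom" "y \<in> range hom"
  then obtain a b where "x = hom a" "y = hom b" by blast
  then have "x - y = hom (a - b)" "x * y = hom (a * b)" by (simp_all add: hom_distribs)
  then show "x - y \<in> range hom" "x * y \<in> range hom" by simp_all
next
  fix x assume "x \<in> range hom"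
  then obtain a where "x = hom a" by blast
  then have "inverse x = hom (inverse a)" by (simp add: hom_distribs)
  then show "inverse x \<in> range hom" by simp
qed

text \<open>At the infinitesimal point x = \<kappa> / u the coefficients of Y, Y^2, ... in g are
  infinitesimal and that of Y^0 is a unit. A finite y would therefore give g(x, y) size one.\<close>

lemma (in field_hom) ramified_of_relation:
  assumes V: "valuation (range hom) V" and u: "u \<noteq> 0" "u \<notin> V" and \<kappa>: "\<kappa> \<noteq> 0"
    and g: "\<And>i. i > 0 \<Longrightarrow> coeff (coeff g i) 0 = 0" "coeff (coeff g 0) 0 \<noteq> 0"
    and rel: "eval2 hom g (hom \<kappa> / u) y = 0"
  shows "y \<notin> V"
proof
  interpret valuation "range hom" V by (rule V)
  assume "y \<in> V"
  define x where "x = hom \<kappa> / u"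
  have "\<not> le u 1" using u le_1_iff by simp
  moreover have "sim (hom \<kappa>) 1" using \<kappa> by (intro sim_one_of_subfield) auto
  ultimately have x: "\<not> le 1 x"
    using u(1) le_trans[of u "hom \<kappa>" 1] by (auto simp: x_def le_divide_iff2 sim_def)
  have x1: "le x 1" using x le_total by blast
  have over: "poly_over (range hom) (map_poly hom p)" for p using poly_over_range_iff by blast
  define t where "t = (\<Sum>i\<in>{1..degree g}. poly (map_poly hom (coeff g i)) x * y ^ i)"
  have "eval2 hom g x y = poly (map_poly hom (coeff g 0)) x + t"
    unfolding eval2_sum t_def by (simp add: sum.atLeast1_atMost_eq sum.atMost_shift)
  moreover have tx: "le t x" unfolding t_def
  proof (rule le_sum)
    fix i assume "i \<in> {1..degree g}"
    then obtain p where p: "coeff g i = pCons 0 p"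
      using g(1)[of i] by (cases "coeff g i") auto
    have "le (poly (map_poly hom p) x) 1" by (rule poly_le_1[OF over x1])
    then have "le (x * poly (map_poly hom p) x * y ^ i) (x * 1 * 1 ^ i)"
      using \<open>y \<in> V\<close> by (intro le_mult le_power) (auto simp: le_1_iff)
    then show "le (poly (map_poly hom (coeff g i)) x * y ^ i) x"
      unfolding p by (simp add: map_poly_pCons_hom)
  qed
  have s: "sim (poly (map_poly hom (coeff g 0)) x) 1"
    using g(2) x by (intro poly_sim_infinitesimal[OF over]) auto
  moreover have "\<not> le (poly (map_poly hom (coeff g 0)) x) t"
  proof
    assume "le (poly (map_poly hom (coeff g 0)) x) t"
    then have "le (poly (map_poly hom (coeff g 0)) x) x" using tx by (rule le_trans)
    moreover have "le 1 (poly (map_poly hom (coeff g 0)) x)" using s by (simp add: sim_def)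
    ultimately show False using x le_trans by blast
  qed
  from sim_trans[OF sim_add[OF this] s]
  have "sim (poly (map_poly hom (coeff g 0)) x + t) 1" .
  ultimately have "sim (eval2 hom g x y) 1" by simp
  then show False using rel sim_zero[of 0 1] by (simp add: x_def)
qed

locale alg_closed_hom = field_hom hom for hom :: "'a::field \<Rightarrow> 'l::alg_closed_field"

lemma (in alg_closed_hom) involutive_cover_hom:
  fixes A B :: "'a poly"
  assumes "coeff A 0 \<noteq> 0" "coeff B 0 \<noteq> 0" "degree A = Q + 1 + degree B" "Q > 1" "\<kappa> \<noteq> 0"
    and bez: "a * A + b * B = 1"
    and rec: "c \<noteq> 0" "\<And>s. s \<noteq> 0 \<Longrightarrow>
      poly (map_poly hom B) (hom \<kappa> / s) * s ^ degree B = hom c * poly (map_poly hom B) s"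
  shows "involutive_cover (range hom) (map_poly hom A) (map_poly hom B) (hom \<kappa>) Q"
proof
  have over: "poly_over (range hom) (map_poly hom p)" for p using poly_over_range_iff by blast
  show "poly_over (range hom) (map_poly hom A)" "poly_over (range hom) (map_poly hom B)" by (rule over)+
  have "map_poly hom (a * A + b * B) = 1" unfolding bez by simp
  then have "map_poly hom a * map_poly hom A + map_poly hom b * map_poly hom B = 1"
    by (simp add: hom_distribs)
  then show "\<exists>a b. poly_over (range hom) a \<and> poly_over (range hom) b \<and> a * map_poly hom A + b * map_poly hom B = 1"
    using over by blast
  show "\<exists>c\<in>range hom. c \<noteq> 0 \<and> (\<forall>s. s \<noteq> 0 \<longrightarrow>
      poly (map_poly hom B) (hom \<kappa> / s) * s ^ degree (map_poly hom B) = c * poly (map_poly hom B) s)"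
    using rec by (intro bexI[of _ "hom c"]) auto
qed (use assms subfield_range in auto)

lemma (in alg_closed_hom) tower_conclusion:
  fixes A B :: "'a poly" and g :: "'a poly poly"
  assumes cover: "involutive_cover (range hom) (map_poly hom A) (map_poly hom B) (hom \<kappa>) Q"
    and \<kappa>: "\<kappa> \<noteq> 0"
    and g: "\<And>i. i > 0 \<Longrightarrow> coeff (coeff g i) 0 = 0" "coeff (coeff g 0) 0 \<noteq> 0"
    and u: "\<And>e. u e \<noteq> 0" "\<And>e. poly (map_poly hom B) (u e) \<noteq> 0"
    and j: "\<And>e. j e = poly (map_poly hom A) (u e) / (u e * poly (map_poly hom B) (u e))"
      "\<And>e. j (Suc e) = poly (map_poly hom A) (hom \<kappa> / u e) /
          (hom \<kappa> / u e * poly (map_poly hom B) (hom \<kappa> / u e))"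
    and tr: "transcendental_over hom (j 0)"
    and rel: "\<And>e. eval2 hom g (hom \<kappa> / u e) (u (Suc e)) = 0"
  shows "(\<exists>\<rho> \<sigma>. \<forall>e. adjoin (range hom) {u e} = adjoin (range hom) {j e, j (e + 1)} \<and>
        ratfun_value hom \<rho> (u e) (j e) \<and> ratfun_value hom \<sigma> (u e) (j (e + 1)))"
    and "n \<ge> 1 \<Longrightarrow> adjoin (range hom) {j 0, j n} = adjoin (range hom) (u ` {..<n})"
    and "e \<ge> 1 \<Longrightarrow> eval2 hom (shift_first \<kappa> g) (u (e - 1)) (u e) = 0"
proof -
  interpret C: involutive_cover "range hom" "map_poly hom A" "map_poly hom B" "hom \<kappa>" Q by (rule cover)
  interpret W: recursive_tower "range hom" "map_poly hom A" "map_poly hom B" "hom \<kappa>" Q u j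
  proof unfold_locales
    show "u (Suc e) \<notin> V" if "valuation (range hom) V" "u e \<notin> V" for V e
      using ramified_of_relation[OF that(1) u(1) that(2) \<kappa> g rel] .
    show "\<not> algebraic_in (range hom) (j 0)" using tr transcendental_over_iff by blast
  qed (use u j in \<open>auto simp: C.J_def\<close>)
  show "n \<ge> 1 \<Longrightarrow> adjoin (range hom) {j 0, j n} = adjoin (range hom) (u ` {..<n})" by (rule W.field_eq)
  show "eval2 hom (shift_first \<kappa> g) (u (e - 1)) (u e) = 0" if "e \<ge> 1"
    using eval2_shift_first[OF \<kappa> u(1) rel, of "e - 1"] that by simp
  define \<rho> where "\<rho> = (A, [:0, 1:] * B)"
  \<comment> \<open>J(\<kappa> / X), expanded by X to the power deg A = Q + 1 + deg B. In the
    denominator deg B factors turn B(\<kappa> / X) into a polynomial, one turns \<kappa> / X into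
    \<kappa>, and X^Q remains.\<close>
  define \<sigma> where "\<sigma> = (reciprocal_poly \<kappa> A, Polynomial.smult \<kappa> (monom 1 Q * reciprocal_poly \<kappa> B))"
  have dA: "degree A = Q + 1 + degree B" using C.degA by simp
  have "adjoin (range hom) {u e} = adjoin (range hom) {j e, j (e + 1)} \<and>
        ratfun_value hom \<rho> (u e) (j e) \<and> ratfun_value hom \<sigma> (u e) (j (e + 1))" for e
  proof (intro conjI)
    show "adjoin (range hom) {u e} = adjoin (range hom) {j e, j (e + 1)}" by (rule W.step_field_eq)
    show "ratfun_value hom \<rho> (u e) (j e)"
      using u j(1)[of e] by (simp add: ratfun_value_def \<rho>_def hom_distribs map_poly_pCons_hom)
    have B0: "poly (map_poly hom B) (hom \<kappa> / u e) \<noteq> 0" using C.B_involution_nz u by blast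
    define x where "x = hom \<kappa> / u e"
    have "j (e + 1) = poly (map_poly hom A) x / (x * poly (map_poly hom B) x)" using j(2)[of e] by (simp add: x_def)
    also have "\<dots> = (u e ^ degree A * poly (map_poly hom A) x) / (hom \<kappa> * (u e ^ Q * (u e ^ degree B * poly (map_poly hom B) x)))"
      using u(1)[of e] B0 \<kappa> unfolding dA x_def by (simp add: power_add field_simps)
    finally show "ratfun_value hom \<sigma> (u e) (j (e + 1))"
      using u(1)[of e] B0 \<kappa>
      by (simp add: ratfun_value_def \<sigma>_def hom_distribs poly_monom poly_reciprocal_poly x_def)
  qed
  then show "\<exists>\<rho> \<sigma>. \<forall>e. adjoin (range hom) {u e} = adjoin (range hom) {j e, j (e + 1)} \<and>
        ratfun_value hom \<rho> (u e) (j e) \<and> ratfun_value hom \<sigma> (u e) (j (e + 1))" by blast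
qed

text \<open>For B = 1 the equation J(x) = J(y) reads A(x) y = A(y) x. The difference vanishes for y
  = x, and the quotient by y - x has Y-degree one less. At x = 0 the identity becomes A(0) y = y
  g(0, y), so g(0, Y) is the constant A(0).\<close>

lemma division_by_diagonal:
  fixes A :: "'k::field poly"
  assumes deg: "degree A = Suc Q" and Q: "Q \<ge> 1"
  obtains g :: "'k poly poly" where "degree g = Q" "\<And>i. i > 0 \<Longrightarrow> coeff (coeff g i) 0 = 0"
    "coeff (coeff g 0) 0 = coeff A 0"
    "\<And>(\<iota> :: 'k \<Rightarrow> 'l::field) x y. field_hom \<iota> \<Longrightarrow>
       poly (map_poly \<iota> A) x * y - poly (map_poly \<iota> A) y * x = (y - x) * eval2 \<iota> g x y"
proof -
  define G :: "'k poly poly" where "G = [:0, A:] - Polynomial.smult [:0, 1:] (map_poly (\<lambda>c. [:c:]) A)"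
  define g where "g = synthetic_div G [:0, 1:]"
  have cG: "coeff G i = (if i = 1 then A else 0) - [:0, coeff A i:]" for i
    by (cases i) (auto simp: G_def coeff_map_poly coeff_pCons split: nat.splits)
  have "poly (map_poly (\<lambda>c. [:c:]) A) [:0, 1:] = A"
  proof -
    have "poly (map_poly (\<lambda>c. [:c:]) A) [:0, 1:] = (\<Sum>i\<le>degree A. [:coeff A i:] * [:0, 1:] ^ i)"
      by (rule poly_map_poly_sum) simp
    also have "\<dots> = (\<Sum>i\<le>degree A. monom (coeff A i) i)" by (simp add: monom_altdef)
    finally show ?thesis by (simp add: poly_as_sum_of_monoms)
  qed
  then have "poly G [:0, 1:] = 0" by (simp add: G_def)
  then have Gg: "G = [:- [:0, 1:], 1:] * g"
    using synthetic_div_correct'[of "[:0, 1:]" G] by (simp add: g_def)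
  have dG: "degree G = Suc Q"
  proof (rule antisym)
    show "degree G \<le> Suc Q"
    proof (rule degree_le, intro allI impI)
      fix i assume "Suc Q < i"
      then show "coeff G i = 0" using deg Q coeff_eq_0[of A i] by (simp add: cG)
    qed
    have "coeff A (Suc Q) \<noteq> 0" using deg leading_coeff_0_iff[of A] by auto
    then have "coeff G (Suc Q) \<noteq> 0" using Q by (simp add: cG)
    then show "Suc Q \<le> degree G" by (rule le_degree)
  qed
  have deg_g: "degree g = Q" unfolding g_def degree_synthetic_div dG by simp
  have c: "coeff G (Suc i) = coeff g i - [:0, 1:] * coeff g (Suc i)" for i
    unfolding Gg by (simp add: coeff_pCons)
  have low: "coeff (coeff g i) 0 = coeff (coeff G (Suc i)) 0" for i using c[of i] by simp
  show ?thesis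
  proof (rule that[OF deg_g])
    show "coeff (coeff g i) 0 = 0" if "i > 0" for i unfolding low cG using that by simp
    show "coeff (coeff g 0) 0 = coeff A 0" unfolding low cG by simp
    fix \<iota> :: "'k \<Rightarrow> 'l" and x y assume "field_hom \<iota>"
    then interpret field_hom \<iota> .
    define E where "E = (\<lambda>p. poly (map_poly \<iota> p) x)"
    interpret E: comm_ring_hom E
      by unfold_locales (simp_all add: E_def map_poly_hom.hom_mult map_poly_hom_add)
    interpret mE: map_poly_comm_ring_hom E ..
    have ev: "eval2 \<iota> h x y = poly (map_poly E h) y" for h by (simp add: eval2_def E_def)
    have EX: "E [:0, 1:] = x" by (simp add: E_def map_poly_pCons_hom)
    have EG: "map_poly E G = [:- x, 1:] * map_poly E g"
    proof -
      have "map_poly E [:- [:0, 1:], 1:] = [:- E [:0, 1:], 1:]"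
        unfolding E.map_poly_pCons_hom E.hom_uminus by simp
      then show ?thesis unfolding Gg mE.hom_mult EX by simp
    qed
    have "eval2 \<iota> G x y = (y - x) * eval2 \<iota> g x y" unfolding ev EG poly_mult by (simp add: algebra_simps)
    moreover have "eval2 \<iota> G x y = poly (map_poly \<iota> A) x * y - poly (map_poly \<iota> A) y * x"
    proof -
      have "map_poly E (map_poly (\<lambda>c. [:c:]) A) = map_poly \<iota> A"
        by (intro poly_eqI) (simp add: coeff_map_poly E_def map_poly_pCons_hom)
      moreover have "map_poly E [:0, A:] = [:0, E A:]" by (simp add: E.map_poly_pCons_hom)
      ultimately show ?thesis
        unfolding ev G_def mE.hom_minus E.map_poly_hom_smult EX by (simp add: E_def mult.commute)
    qed
    ultimately show "poly (map_poly \<iota> A) x * y - poly (map_poly \<iota> A) y * x = (y - x) * eval2 \<iota> g x y" by simp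
  qed
qed

section \<open>Towers of level \<open>P\<close>\<close>

text \<open>The conclusion of the theorem as a property of P, so that the types of levels can be
  treated one by one. The type argument fixes the field over which the modules live.\<close>

definition depth_one_recursion :: "'l::alg_closed_field itself \<Rightarrow> 'q::{finite,field} poly \<Rightarrow> bool" where
  "depth_one_recursion TYPE('l) P \<longleftrightarrow> (\<exists>f :: 'q poly fract poly poly.
    degree f = CARD('q) ^ degree P \<and>
    (\<forall>(\<iota> :: 'q poly fract \<Rightarrow> 'l::alg_closed_field) \<phi> \<mu>.
       field_hom \<iota> \<and>
       isogeny_tower (\<lambda>a. \<iota> (to_fract a)) P \<phi> \<mu> \<and>
       transcendental_over \<iota> (j_invariant (\<phi> 0)) \<longrightarrow>
       (\<exists>u.
          (\<exists>\<rho> \<sigma>. \<forall>e.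
             adjoin (range \<iota>) {u e} = adjoin (range \<iota>) {j_invariant (\<phi> e), j_invariant (\<phi> (e + 1))} \<and>
             ratfun_value \<iota> \<rho> (u e) (j_invariant (\<phi> e)) \<and>
             ratfun_value \<iota> \<sigma> (u e) (j_invariant (\<phi> (e + 1)))) \<and>
          (\<forall>n\<ge>1.
             X0_field \<iota> (\<phi> 0) (\<phi> n) = adjoin (range \<iota>) (u ` {..<n}) \<and>
             (\<forall>e. 1 \<le> e \<and> e < n \<longrightarrow> eval2 \<iota> f (u (e - 1)) (u e) = 0)) \<and>
          X0_field \<iota> (\<phi> 0) (\<phi> 1) = adjoin (range \<iota>) {u 0} \<and>
          (\<forall>n\<ge>1.
             X0_field \<iota> (\<phi> 0) (\<phi> (n + 1)) = adjoin (X0_field \<iota> (\<phi> 0) (\<phi> n)) {u n} \<and>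
             eval2 \<iota> f (u (n - 1)) (u n) = 0))))"

text \<open>Leaves to each level the explicit data A, B, \<kappa>, g and the choice of parameters in
  a given tower. The data are fixed over F_q(T) before an embedding and a tower are given, so the
  equation depends on the level and not on the tower.\<close>

lemma statement_of_parametrization:
  fixes P :: "'q::{finite,field} poly" and \<kappa> :: "'q poly fract" and A B :: "'q poly fract poly"
    and g :: "'q poly fract poly poly"
  assumes A0: "coeff A 0 \<noteq> 0" and B0: "coeff B 0 \<noteq> 0" and dA: "degree A = Q + 1 + degree B" and Q: "Q > 1"
    and \<kappa>: "\<kappa> \<noteq> 0" and bez: "a * A + b * B = 1"
    and g: "\<And>i. i > 0 \<Longrightarrow> coeff (coeff g i) 0 = 0" "coeff (coeff g 0) 0 \<noteq> 0"
    and dg: "degree g = CARD('q) ^ degree P"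
    and recip: "\<And>(\<iota> :: 'q poly fract \<Rightarrow> 'l::alg_closed_field) s. field_hom \<iota> \<Longrightarrow> s \<noteq> 0 \<Longrightarrow>
       poly (map_poly \<iota> B) (\<iota> \<kappa> / s) * s ^ degree B = \<iota> c * poly (map_poly \<iota> B) s" "c \<noteq> 0"
    and tower: "\<And>(\<iota> :: 'q poly fract \<Rightarrow> 'l) \<phi> \<mu>. field_hom \<iota> \<Longrightarrow>
       involutive_cover (range \<iota>) (map_poly \<iota> A) (map_poly \<iota> B) (\<iota> \<kappa>) Q \<Longrightarrow>
       isogeny_tower (\<lambda>a. \<iota> (to_fract a)) P \<phi> \<mu> \<Longrightarrow>
       \<not> algebraic_in (range \<iota>) (j_invariant (\<phi> 0)) \<Longrightarrow>
       \<exists>u. \<forall>e. u e \<noteq> 0 \<and> poly (map_poly \<iota> B) (u e) \<noteq> 0 \<and>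
         j_invariant (\<phi> e) = poly (map_poly \<iota> A) (u e) / (u e * poly (map_poly \<iota> B) (u e)) \<and>
         j_invariant (\<phi> (Suc e)) = poly (map_poly \<iota> A) (\<iota> \<kappa> / u e) /
           (\<iota> \<kappa> / u e * poly (map_poly \<iota> B) (\<iota> \<kappa> / u e)) \<and>
         eval2 \<iota> g (\<iota> \<kappa> / u e) (u (Suc e)) = 0"
  shows "depth_one_recursion TYPE('l) P"
  unfolding depth_one_recursion_def
proof (intro exI[of _ "shift_first \<kappa> g"] conjI allI impI)
  show "degree (shift_first \<kappa> g) = CARD('q) ^ degree P" by (simp add: degree_shift_first[OF \<kappa>] dg)
next
  fix \<iota> :: "'q poly fract \<Rightarrow> 'l" and \<phi> \<mu>
  assume *: "field_hom \<iota> \<and> isogeny_tower (\<lambda>a. \<iota> (to_fract a)) P \<phi> \<mu> \<and>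
       transcendental_over \<iota> (j_invariant (\<phi> 0))"
  interpret field_hom \<iota> using * by blast
  interpret alg_closed_hom \<iota> ..
  have fh: "field_hom \<iota>" by unfold_locales
  define j where "j = (\<lambda>e. j_invariant (\<phi> e))"
  have cover: "involutive_cover (range \<iota>) (map_poly \<iota> A) (map_poly \<iota> B) (\<iota> \<kappa>) Q"
    by (rule involutive_cover_hom[OF A0 B0 dA Q \<kappa> bez recip(2)]) (rule recip(1)[OF fh])
  have tr: "transcendental_over \<iota> (j 0)" using * by (simp add: j_def)
  have tow: "isogeny_tower (\<lambda>a. \<iota> (to_fract a)) P \<phi> \<mu>" using * by blast
  have "\<not> algebraic_in (range \<iota>) (j_invariant (\<phi> 0))" using tr transcendental_over_iff by (simp add: j_def)
  from tower[OF fh cover tow this] obtain u where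
    u: "\<And>e. u e \<noteq> 0" "\<And>e. poly (map_poly \<iota> B) (u e) \<noteq> 0"
      "\<And>e. j e = poly (map_poly \<iota> A) (u e) / (u e * poly (map_poly \<iota> B) (u e))"
      "\<And>e. j (Suc e) = poly (map_poly \<iota> A) (\<iota> \<kappa> / u e) /
           (\<iota> \<kappa> / u e * poly (map_poly \<iota> B) (\<iota> \<kappa> / u e))"
      "\<And>e. eval2 \<iota> g (\<iota> \<kappa> / u e) (u (Suc e)) = 0"
    unfolding j_def by blast
  note concl = tower_conclusion[OF cover \<kappa> g u(1-4) tr u(5)]
  have X: "X0_field \<iota> (\<phi> 0) (\<phi> n) = adjoin (range \<iota>) (u ` {..<n})" if "n \<ge> 1" for n
    using concl(2)[OF _ that] by (simp add: X0_field_def j_def)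
  have Suc_X: "X0_field \<iota> (\<phi> 0) (\<phi> (n + 1)) = adjoin (X0_field \<iota> (\<phi> 0) (\<phi> n)) {u n}" if "n \<ge> 1" for n
    using X[OF that] X[of "n + 1"] by (simp add: adjoin_adjoin lessThan_Suc)
  have X1: "X0_field \<iota> (\<phi> 0) (\<phi> 1) = adjoin (range \<iota>) {u 0}"
    using X[of 1] by (simp add: lessThan_Suc)
  show "\<exists>u. (\<exists>\<rho> \<sigma>. \<forall>e.
             adjoin (range \<iota>) {u e} = adjoin (range \<iota>) {j_invariant (\<phi> e), j_invariant (\<phi> (e + 1))} \<and>
             ratfun_value \<iota> \<rho> (u e) (j_invariant (\<phi> e)) \<and>
             ratfun_value \<iota> \<sigma> (u e) (j_invariant (\<phi> (e + 1)))) \<and>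
          (\<forall>n\<ge>1.
             X0_field \<iota> (\<phi> 0) (\<phi> n) = adjoin (range \<iota>) (u ` {..<n}) \<and>
             (\<forall>e. 1 \<le> e \<and> e < n \<longrightarrow> eval2 \<iota> (shift_first \<kappa> g) (u (e - 1)) (u e) = 0)) \<and>
          X0_field \<iota> (\<phi> 0) (\<phi> 1) = adjoin (range \<iota>) {u 0} \<and>
          (\<forall>n\<ge>1.
             X0_field \<iota> (\<phi> 0) (\<phi> (n + 1)) = adjoin (X0_field \<iota> (\<phi> 0) (\<phi> n)) {u n} \<and>
             eval2 \<iota> (shift_first \<kappa> g) (u (n - 1)) (u n) = 0)"
    using concl(1)[unfolded j_def] X Suc_X X1 concl(3) by (intro exI[of _ u] conjI allI impI) blast+
qed

context quadratic_setting
begin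

text \<open>Chooses \<alpha>, \<beta> and c for all steps. Each application of
  \<open>quadratic_isogeny\<close> requires g \<noteq> 0; this follows from transcendence of the
  j-invariant, which is carried up the tower through \<open>J\<close> and the involution.\<close>

lemma quadratic_tower:
  assumes tower: "isogeny_tower \<gamma> N\<^sub>q \<phi> \<mu>"
    and cover: "involutive_cover (range \<iota>) A B (L.P T) Q"
    and J: "\<And>\<alpha>. T \<noteq> \<alpha> \<Longrightarrow> L.P \<alpha> \<noteq> 0 \<Longrightarrow> poly B (T - \<alpha>) \<noteq> 0 \<and>
        poly A (T - \<alpha>) / ((T - \<alpha>) * poly B (T - \<alpha>)) =
        (1 + L.\<delta> \<alpha> * L.m \<alpha>) * F (1 + L.\<delta> \<alpha> * L.m \<alpha>) / L.\<delta> \<alpha>"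
    and tr: "\<not> algebraic_in (range \<iota>) (j_invariant (\<phi> 0))"
  obtains \<alpha> \<beta> c where
    "\<And>e. c e \<noteq> 0" "\<And>e z. poly (\<mu> e) z = c e * L.P_act (\<alpha> e) (\<beta> e) z"
    "\<And>e. L.submodule (g\<^sub>\<phi> (\<phi> e)) (D\<^sub>\<phi> (\<phi> e)) (\<alpha> e) (\<beta> e)"
    "\<And>e. L.submodule (g\<^sub>\<phi> (\<phi> (Suc e))) (D\<^sub>\<phi> (\<phi> (Suc e))) (L.dual\<alpha> (\<alpha> e)) (L.dual\<beta> (\<alpha> e) (\<beta> e) (c e))"
    "\<And>e. g\<^sub>\<phi> (\<phi> e) \<noteq> 0"
    "\<And>e. T - L.dual\<alpha> (\<alpha> e) = L.P T / (T - \<alpha> e)"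
    "\<And>e. j_invariant (\<phi> e) = poly A (T - \<alpha> e) / ((T - \<alpha> e) * poly B (T - \<alpha> e))"
    "\<And>e. j_invariant (\<phi> (Suc e)) = poly A (L.P T / (T - \<alpha> e)) / (L.P T / (T - \<alpha> e) * poly B (L.P T / (T - \<alpha> e)))"
    "\<And>e. poly B (T - \<alpha> e) \<noteq> 0"
proof -
  interpret C: involutive_cover "range \<iota>" A B "L.P T" Q by (rule cover)
  have dr: "drinfeld (\<phi> i)" and cyc: "cyclic_isogeny N\<^sub>q (\<phi> i) (\<phi> (Suc i)) (\<mu> i)" for i
    using tower by (auto simp: isogeny_tower_def)
  have jsub: "j_invariant (\<phi> e) = C.J (T - \<alpha>)" if "L.submodule (g\<^sub>\<phi> (\<phi> e)) (D\<^sub>\<phi> (\<phi> e)) \<alpha> \<beta>" for e \<alpha> \<beta>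
  proof -
    have "T \<noteq> \<alpha>" "L.P \<alpha> \<noteq> 0" using that by (auto simp: L.submodule_def)
    from J[OF this] show ?thesis unfolding j_invariant_eq L.submodule_j[OF that] C.J_def by simp
  qed
  have zero_alg: "algebraic_in (range \<iota>) 0"
    unfolding algebraic_in_def poly_over_range_iff
    by (intro exI[of _ "[:0, 1:]"]) (auto intro!: exI[of _ "[:0, 1:]"] simp: map_poly_pCons_hom)
  have step: "\<exists>\<alpha> \<beta> c. c \<noteq> 0 \<and> (\<forall>z. poly (\<mu> e) z = c * L.P_act \<alpha> \<beta> z) \<and>
      L.submodule (g\<^sub>\<phi> (\<phi> e)) (D\<^sub>\<phi> (\<phi> e)) \<alpha> \<beta> \<and>
      L.submodule (g\<^sub>\<phi> (\<phi> (Suc e))) (D\<^sub>\<phi> (\<phi> (Suc e))) (L.dual\<alpha> \<alpha>) (L.dual\<beta> \<alpha> \<beta> c)"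
    if "\<not> algebraic_in (range \<iota>) (j_invariant (\<phi> e))" for e
  proof -
    have "g\<^sub>\<phi> (\<phi> e) \<noteq> 0" using that zero_alg by (auto simp: j_invariant_eq)
    from quadratic_isogeny[OF dr dr cyc this] show ?thesis by metis
  qed
  have jtr: "\<not> algebraic_in (range \<iota>) (j_invariant (\<phi> e))" for e
  proof (induction e)
    case (Suc e)
    obtain \<alpha> \<beta> c where s: "L.submodule (g\<^sub>\<phi> (\<phi> e)) (D\<^sub>\<phi> (\<phi> e)) \<alpha> \<beta>"
      "L.submodule (g\<^sub>\<phi> (\<phi> (Suc e))) (D\<^sub>\<phi> (\<phi> (Suc e))) (L.dual\<alpha> \<alpha>) (L.dual\<beta> \<alpha> \<beta> c)"
      using step[OF Suc] by blast
    have a: "L.P \<alpha> \<noteq> 0" "T \<noteq> \<alpha>" using s(1) by (auto simp: L.submodule_def)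
    have "j_invariant (\<phi> (Suc e)) = C.J (L.P T / (T - \<alpha>))"
      using jsub[OF s(2)] L.T_minus_dual[OF a] by simp
    moreover have "\<not> algebraic_in (range \<iota>) (T - \<alpha>)"
      using Suc jsub[OF s(1)] C.transcendental_of_J by simp
    ultimately show ?case using C.J_involution_transcendental a by simp
  qed (rule tr)
  from step[OF jtr] have ex: "\<forall>e. \<exists>\<alpha> \<beta> c. c \<noteq> 0 \<and> (\<forall>z. poly (\<mu> e) z = c * L.P_act \<alpha> \<beta> z) \<and>
      L.submodule (g\<^sub>\<phi> (\<phi> e)) (D\<^sub>\<phi> (\<phi> e)) \<alpha> \<beta> \<and>
      L.submodule (g\<^sub>\<phi> (\<phi> (Suc e))) (D\<^sub>\<phi> (\<phi> (Suc e))) (L.dual\<alpha> \<alpha>) (L.dual\<beta> \<alpha> \<beta> c)" by blast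
  obtain \<alpha> \<beta> c where c: "\<And>e. c e \<noteq> 0" "\<And>e z. poly (\<mu> e) z = c e * L.P_act (\<alpha> e) (\<beta> e) z"
    and s: "\<And>e. L.submodule (g\<^sub>\<phi> (\<phi> e)) (D\<^sub>\<phi> (\<phi> e)) (\<alpha> e) (\<beta> e)"
      "\<And>e. L.submodule (g\<^sub>\<phi> (\<phi> (Suc e))) (D\<^sub>\<phi> (\<phi> (Suc e))) (L.dual\<alpha> (\<alpha> e)) (L.dual\<beta> (\<alpha> e) (\<beta> e) (c e))"
    using ex unfolding choice_iff by blast
  have a: "L.P (\<alpha> e) \<noteq> 0" "T \<noteq> \<alpha> e" for e using s(1)[of e] by (auto simp: L.submodule_def)
  have g: "g\<^sub>\<phi> (\<phi> e) \<noteq> 0" for e using jtr[of e] zero_alg by (auto simp: j_invariant_eq)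
  have d: "T - L.dual\<alpha> (\<alpha> e) = L.P T / (T - \<alpha> e)" for e by (rule L.T_minus_dual[OF a])
  show ?thesis
  proof (rule that[OF c s g d])
    show "j_invariant (\<phi> e) = poly A (T - \<alpha> e) / ((T - \<alpha> e) * poly B (T - \<alpha> e))" for e
      using jsub[OF s(1)] by (simp add: C.J_def)
    show "j_invariant (\<phi> (Suc e)) = poly A (L.P T / (T - \<alpha> e)) / (L.P T / (T - \<alpha> e) * poly B (L.P T / (T - \<alpha> e)))" for e
      using jsub[OF s(2)] unfolding d by (simp add: C.J_def)
    show "poly B (T - \<alpha> e) \<noteq> 0" for e using J a by blast
  qed
qed

lemma act_eq_zero_P_act:
  assumes a: "F a = a" "\<gamma> [:t\<^sub>q:] = a + a'" "\<gamma> [:n\<^sub>q:] = a * a'" and z: "L.act \<alpha> \<beta> z = a * z"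
  shows "L.P_act \<alpha> \<beta> z = 0"
proof -
  have "L.act \<alpha> \<beta> (a * z) = a * (a * z)" using L.act_simps(3)[OF a(1), of \<alpha> \<beta> z] z by simp
  then show ?thesis unfolding L.P_act_def z by (simp add: a(2,3) algebra_simps)
qed

text \<open>An a-eigenvector of the e-th module is sent to an eigenvector of the dual operator. With
  equal factors it would be one for the next submodule too, hence be killed by the following
  isogeny; the composite of the two would kill the whole (T - a)-torsion.\<close>

lemma consecutive_eigenspaces:
  assumes tower: "isogeny_tower \<gamma> N\<^sub>q \<phi> \<mu>"
    and c: "\<And>e. c e \<noteq> 0" "\<And>e z. poly (\<mu> e) z = c e * L.P_act (\<alpha> e) (\<beta> e) z"
    and s: "\<And>e. L.submodule (g\<^sub>\<phi> (\<phi> e)) (D\<^sub>\<phi> (\<phi> e)) (\<alpha> e) (\<beta> e)"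
      "\<And>e. L.submodule (g\<^sub>\<phi> (\<phi> (Suc e))) (D\<^sub>\<phi> (\<phi> (Suc e))) (L.dual\<alpha> (\<alpha> e)) (L.dual\<beta> (\<alpha> e) (\<beta> e) (c e))"
    and a: "t\<^sub>q = a + a'" "n\<^sub>q = a * a'"
  shows "(\<gamma> [:a:] - L.dual\<alpha> (\<alpha> e)) / L.dual\<beta> (\<alpha> e) (\<beta> e) (c e) \<noteq> (\<gamma> [:a:] - \<alpha> (Suc e)) / \<beta> (Suc e)"
proof
  assume eq: "(\<gamma> [:a:] - L.dual\<alpha> (\<alpha> e)) / L.dual\<beta> (\<alpha> e) (\<beta> e) (c e) = (\<gamma> [:a:] - \<alpha> (Suc e)) / \<beta> (Suc e)"
  have dr: "drinfeld (\<phi> i)" for i using tower by (auto simp: isogeny_tower_def)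
  have "N\<^sub>q = [:- a, 1:] * [:- a', 1:]" by (simp add: a)
  then have "[:- a, 1:] dvd N\<^sub>q" by (rule dvdI)
  then obtain z where z: "poly (\<phi> e [:- a, 1:]) z = 0" "poly (\<mu> (Suc e)) (poly (\<mu> e) z) \<noteq> 0"
    using tower_noncyclic_contradiction[OF tower, of "[:- a, 1:]" e] by auto
  have "[:- a, 1:] = [:- a:] + [:0, 1:]" by simp
  then have "\<gamma> [:- a:] * z + poly (\<phi> e [:0, 1:]) z = 0"
    using z(1) by (simp only: drinfeld_add[OF dr] drinfeld_const[OF dr])
  moreover have "\<gamma> [:- a:] = - \<gamma> [:a:]" by (simp flip: \<gamma>_simps(6))
  ultimately have mz: "L.module_op (g\<^sub>\<phi> (\<phi> e)) (D\<^sub>\<phi> (\<phi> e)) z = \<gamma> [:a:] * z"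
    unfolding module_op_eq_poly[OF dr] by simp
  have "\<gamma> ([:a:] + [:a':]) = \<gamma> [:a:] + \<gamma> [:a':]" "\<gamma> ([:a:] * [:a':]) = \<gamma> [:a:] * \<gamma> [:a':]"
    by (rule \<gamma>_simps)+
  then have tn: "\<gamma> [:t\<^sub>q:] = \<gamma> [:a:] + \<gamma> [:a':]" "\<gamma> [:n\<^sub>q:] = \<gamma> [:a:] * \<gamma> [:a':]"
    by (simp_all add: a mult.commute)
  define y where "y = poly (\<mu> e) z"
  define \<alpha>1 \<beta>1 where "\<alpha>1 = L.dual\<alpha> (\<alpha> e)" and "\<beta>1 = L.dual\<beta> (\<alpha> e) (\<beta> e) (c e)"
  have "L.act \<alpha>1 \<beta>1 y = \<gamma> [:a:] * y"
    unfolding y_def c(2) \<alpha>1_def \<beta>1_def by (rule L.dual_eigen[OF s(1) c(1) F_\<gamma> tn mz])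
  then have "\<beta>1 * F y = (\<gamma> [:a:] - \<alpha>1) * y" by (simp add: L.act_def algebra_simps)
  moreover have b: "\<beta>1 \<noteq> 0" "\<beta> (Suc e) \<noteq> 0" using s(2)[of e] s(1)[of "Suc e"] by (auto simp: L.submodule_def \<beta>1_def)
  ultimately have "F y = (\<gamma> [:a:] - \<alpha>1) / \<beta>1 * y" by (simp add: field_simps)
  then have "F y = (\<gamma> [:a:] - \<alpha> (Suc e)) / \<beta> (Suc e) * y" using eq by (simp add: \<alpha>1_def \<beta>1_def)
  then have "L.act (\<alpha> (Suc e)) (\<beta> (Suc e)) y = \<gamma> [:a:] * y" using b by (simp add: L.act_def field_simps)
  then have "L.P_act (\<alpha> (Suc e)) (\<beta> (Suc e)) y = 0" by (rule act_eq_zero_P_act[OF F_\<gamma> tn])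
  then show False using z(2) c(2) by (simp add: y_def)
qed

text \<open>If the \<alpha> agree, so do the \<beta>, because g = \<beta> (1 + \<delta> m) is
  nonzero. The submodules then coincide, and the composite of the two isogenies kills the full
  P-torsion of the e-th module.\<close>

lemma consecutive_distinct:
  assumes tower: "isogeny_tower \<gamma> N\<^sub>q \<phi> \<mu>"
    and c: "\<And>e. c e \<noteq> 0" "\<And>e z. poly (\<mu> e) z = c e * L.P_act (\<alpha> e) (\<beta> e) z"
    and s: "\<And>e. L.submodule (g\<^sub>\<phi> (\<phi> e)) (D\<^sub>\<phi> (\<phi> e)) (\<alpha> e) (\<beta> e)"
      "\<And>e. L.submodule (g\<^sub>\<phi> (\<phi> (Suc e))) (D\<^sub>\<phi> (\<phi> (Suc e))) (L.dual\<alpha> (\<alpha> e)) (L.dual\<beta> (\<alpha> e) (\<beta> e) (c e))"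
    and g: "\<And>e. g\<^sub>\<phi> (\<phi> e) \<noteq> 0"
  shows "\<alpha> (Suc e) \<noteq> L.dual\<alpha> (\<alpha> e)"
proof
  assume eq: "\<alpha> (Suc e) = L.dual\<alpha> (\<alpha> e)"
  have dr: "drinfeld (\<phi> i)" for i using tower by (auto simp: isogeny_tower_def)
  obtain z where z: "poly (\<phi> e N\<^sub>q) z = 0" "poly (\<mu> (Suc e)) (poly (\<mu> e) z) \<noteq> 0"
    using tower_noncyclic_contradiction[OF tower, of N\<^sub>q e] by auto
  have \<beta>: "\<beta> (Suc e) = L.dual\<beta> (\<alpha> e) (\<beta> e) (c e)"
    using s(1)[of "Suc e"] s(2)[of e] g[of "Suc e"] unfolding L.submodule_def eq by auto
  have "L.P_act (L.dual\<alpha> (\<alpha> e)) (L.dual\<beta> (\<alpha> e) (\<beta> e) (c e)) (c e * L.P_act (\<alpha> e) (\<beta> e) z) = 0"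
    using z(1) unfolding N\<^sub>q_action[OF dr] module_op_eq_poly[OF dr] by (intro L.dual_kernel[OF s(1) c(1)])
  then show False using z(2) unfolding c(2) eq \<beta> by simp
qed

end

section \<open>Level of degree one\<close>

text \<open>
  An isogeny \<open>c (F - d)\<close> of level \<open>T - a\<close>, with \<open>p = T - a\<close>: the operator \<open>p + g F + D F\<^sup>2\<close> kills
  its kernel, and \<open>top\<close> compares the two highest coefficients of the commutation relation.
\<close>

locale linear_level = field_hom F for F :: "'l::field \<Rightarrow> 'l" +
  fixes p g D c d g' D' :: 'l
  assumes c: "c \<noteq> 0" and d: "d \<noteq> 0" and D: "D \<noteq> 0"
    and root: "p + g * d + D * d * F d = 0"
    and top: "c * F D = D' * F (F c)" "c * (F g - d * D) = g' * F c - D' * F (F c) * F (F d)"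
begin

text \<open>On the kernel F acts as d, so the three terms of the operator become p, g d and u, with
  sum zero. Rescaling the module leaves u unchanged, as a coordinate on the curve requires.\<close>

definition u where "u = D * d * F d"

lemma nz: "F c \<noteq> 0" "F d \<noteq> 0" "F D \<noteq> 0" "F (F c) \<noteq> 0" "F (F d) \<noteq> 0" "u \<noteq> 0" "F u \<noteq> 0"
  using c d D by (simp_all add: u_def)

lemma g_eq: "g = - (p + u) / d"
proof -
  have "g * d = - (p + u)" using root unfolding u_def by (simp add: eq_neg_iff_add_eq_0 algebra_simps)
  then show ?thesis using d by (simp add: field_simps)
qed

lemma D'_eq: "D' = c * F D / F (F c)"
  using top(1) nz by (simp add: field_simps)

lemma g'_eq: "g' = - c * (F p + u) / (F c * F d)"
proof -
  have Fu: "F u = F D * F d * F (F d)" by (simp add: u_def hom_distribs)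
  have "F g = - (F p + F u) / F d" unfolding g_eq by (simp add: hom_distribs)
  also have "\<dots> = - F p / F d - F D * F (F d)" unfolding Fu using nz by (simp add: field_simps)
  finally have Fg: "F g = - F p / F d - F D * F (F d)" .
  have "g' * F c = c * (F g - d * D) + c * F D * F (F d)"
    using top(2) unfolding top(1) by (simp add: algebra_simps)
  also have "\<dots> = - c * (F p / F d + d * D)" unfolding Fg by (simp add: algebra_simps)
  also have "F p / F d + d * D = (F p + u) / F d" unfolding u_def using nz by (simp add: field_simps)
  finally show ?thesis using nz by (simp add: field_simps)
qed

lemma j_eq: "g * F g / D = (p + u) * F (p + u) / u"
proof -
  define w where "w = p + u"
  have "g * F g = w * F w / (d * F d)" unfolding g_eq w_def[symmetric] by (simp add: hom_distribs)
  then show ?thesis unfolding w_def[symmetric] by (simp add: u_def mult_ac)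
qed

lemma j'_eq: "g' * F g' / D' = (F p + u) * F (F p + u) / F u"
proof -
  define v where "v = F p + u"
  have "g' * F g' / D' = (c * v / (F c * F d)) * (F c * F v / (F (F c) * F (F d))) / (c * F D / F (F c))"
    unfolding g'_eq D'_eq v_def[symmetric] by (simp add: hom_distribs)
  also have "\<dots> = v * F v / (F D * F d * F (F d))" using c nz by (simp add: field_simps)
  finally show ?thesis by (simp add: u_def v_def hom_distribs)
qed

text \<open>p + p F(p) / u equals p (F(p) + u) / u. The factors p and u cancel, and the involution
  turns the formula of \<open>j_eq\<close> into that of \<open>j'_eq\<close>.\<close>

lemma involution_j:
  assumes p: "p \<noteq> 0"
  shows "g' * F g' / D' = (p + p * F p / u) * F (p + p * F p / u) / (p * F p / u)"
proof -
  have e: "p + p * F p / u = p * (F p + u) / u" using nz by (simp add: field_simps)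
  have "(p + p * F p / u) * F (p + p * F p / u) / (p * F p / u) =
      (p * (F p + u) / u) * (F p * F (F p + u) / F u) / (p * F p / u)"
    unfolding e by (simp add: hom_distribs)
  also have "\<dots> = (F p + u) * F (F p + u) / F u"
  proof -
    have "(p * X / u) * (Fp * Y / U) / (p * Fp / u) = X * Y / U" if "Fp \<noteq> 0" "U \<noteq> 0" for X Y Fp U
      using p nz(6) that by simp
    then show ?thesis using nz p by simp
  qed
  finally show ?thesis unfolding j'_eq by simp
qed

text \<open>
  If the parameters of consecutive steps are related by the involution, the second isogeny kills the
  image of the full \<open>p\<close>-torsion of the first module.
\<close>

lemma involution_kernel:
  assumes p: "p \<noteq> 0" and g': "g' \<noteq> 0"
    and root': "p + g' * d' + D' * d' * F d' = 0" and u': "D' * d' * F d' = p * F p / u"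
    and z: "p * z + g * F z + D * F (F z) = 0"
  shows "F (c * (F z - d * z)) = d' * (c * (F z - d * z))"
proof -
  \<comment> \<open>d' is computed as (g' d') / g', and this factor is the one that cancels.\<close>
  have Fpu: "F p + u \<noteq> 0" using g' unfolding g'_eq by auto
  have "g' * d' + p * (u + F p) / u = 0" using root' unfolding u' using nz(6) by (simp add: field_simps)
  then have "g' * d' = - (p * (u + F p) / u)" by (simp only: eq_neg_iff_add_eq_0)
  then have "d' * g' = - (p * (F p + u) / u)" by (simp add: mult.commute add.commute)
  then have "d' = - (p * (F p + u) / u) / g'" using nonzero_eq_divide_eq[OF g'] by blast
  also have "\<dots> = p * F c * F d / (u * c)"
  proof -
    have "- (p * W / u) / (- c * W / X) = p * X / (u * c)" if "W \<noteq> 0" "X \<noteq> 0" for W X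
      using that nz c by simp
    from this[OF Fpu, of "F c * F d"] show ?thesis unfolding g'_eq using nz by (simp add: mult.assoc)
  qed
  also have "\<dots> = p * F c / (c * D * d)" unfolding u_def using nz c d D by (simp add: field_simps)
  finally have d': "d' = p * F c / (c * D * d)" .
  have "D * F (F z) = - (p * z + g * F z)" using z by (simp add: eq_neg_iff_add_eq_0 algebra_simps)
  also have "\<dots> = - p * z + p * F z / d + u * F z / d" unfolding g_eq using d by (simp add: field_simps)
  also have "u * F z / d = D * F d * F z" using d by (simp add: u_def)
  finally have "D * (F (F z) - F d * F z) = p * (F z - d * z) / d" using d by (simp add: field_simps)
  then have "F (F z) - F d * F z = p * (F z - d * z) / d / D"
    using D by (simp only: nonzero_eq_divide_eq mult.commute not_False_eq_True)
  then have "F (c * (F z - d * z)) = F c * (p * (F z - d * z) / d / D)" by (simp add: hom_distribs)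
  also have "\<dots> = d' * (c * (F z - d * z))" unfolding d' using c by (simp add: mult_ac)
  finally show ?thesis .
qed

end

context drinfeld_setting
begin

text \<open>As in the quadratic case, transcendence is carried up the tower to secure g \<noteq> 0.
  Then \<open>involution_kernel\<close> applies, and a parameter equal to the involution of its
  predecessor would contradict cyclicity of the composite.\<close>

lemma linear_tower:
  assumes tower: "isogeny_tower \<gamma> [:- a, 1:] \<phi> \<mu>" and p: "p = T - \<gamma> [:a:]"
    and cover: "involutive_cover (range \<iota>) A 1 (p * F p) Q"
    and A: "\<And>x. poly A x = (p + x) * F (p + x)"
    and tr: "\<not> algebraic_in (range \<iota>) (j_invariant (\<phi> 0))"
  obtains u where "\<And>e. u e \<noteq> 0" "\<And>e. j_invariant (\<phi> e) = poly A (u e) / u e"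
    "\<And>e. j_invariant (\<phi> (Suc e)) = poly A (p * F p / u e) / (p * F p / u e)"
    "\<And>e. u (Suc e) \<noteq> p * F p / u e"
proof -
  interpret C: involutive_cover "range \<iota>" A 1 "p * F p" Q by (rule cover)
  have CJ: "C.J x = poly A x / x" for x by (simp add: C.J_def)
  have p0: "p \<noteq> 0" using C.\<kappa> by auto
  have dr: "drinfeld (\<phi> i)" and cyc: "cyclic_isogeny [:- a, 1:] (\<phi> i) (\<phi> (Suc i)) (\<mu> i)" for i
    using tower by (auto simp: isogeny_tower_def)
  have "\<exists>c d. linear_level F p (g\<^sub>\<phi> (\<phi> e)) (D\<^sub>\<phi> (\<phi> e)) c d (g\<^sub>\<phi> (\<phi> (Suc e))) (D\<^sub>\<phi> (\<phi> (Suc e))) \<and>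
      (\<forall>z. poly (\<mu> e) z = c * (F z - d * z))" for e
  proof -
    obtain c d where "c \<noteq> 0" "d \<noteq> 0" "\<And>z. poly (\<mu> e) z = c * (F z - d * z)"
      "T - \<gamma> [:a:] + g\<^sub>\<phi> (\<phi> e) * d + D\<^sub>\<phi> (\<phi> e) * d * F d = 0"
      "c * F (D\<^sub>\<phi> (\<phi> e)) = D\<^sub>\<phi> (\<phi> (Suc e)) * F (F c)"
      "c * (F (g\<^sub>\<phi> (\<phi> e)) - d * D\<^sub>\<phi> (\<phi> e)) =
         g\<^sub>\<phi> (\<phi> (Suc e)) * F c - D\<^sub>\<phi> (\<phi> (Suc e)) * F (F c) * F (F d)"
      using linear_isogeny[OF dr dr cyc, of e] by metis
    then have "linear_level F p (g\<^sub>\<phi> (\<phi> e)) (D\<^sub>\<phi> (\<phi> e)) c d (g\<^sub>\<phi> (\<phi> (Suc e))) (D\<^sub>\<phi> (\<phi> (Suc e)))"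
      unfolding p using D\<^sub>\<phi>_nz[OF dr] by unfold_locales
    then show ?thesis using \<open>\<And>z. poly (\<mu> e) z = c * (F z - d * z)\<close> by blast
  qed
  then obtain c d where lev: "\<And>e. linear_level F p (g\<^sub>\<phi> (\<phi> e)) (D\<^sub>\<phi> (\<phi> e)) (c e) (d e) (g\<^sub>\<phi> (\<phi> (Suc e))) (D\<^sub>\<phi> (\<phi> (Suc e)))"
    and \<mu>: "\<And>e z. poly (\<mu> e) z = c e * (F z - d e * z)" by metis
  define u where "u = (\<lambda>e. linear_level.u F (D\<^sub>\<phi> (\<phi> e)) (d e))"
  have u0: "u e \<noteq> 0" for e unfolding u_def using linear_level.nz(6)[OF lev] .
  have j: "j_invariant (\<phi> e) = C.J (u e)" for e
    unfolding j_invariant_eq linear_level.j_eq[OF lev] CJ A u_def by simp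
  have j': "j_invariant (\<phi> (Suc e)) = C.J (p * F p / u e)" for e
    unfolding j_invariant_eq linear_level.involution_j[OF lev p0] CJ A u_def by simp
  have jtr: "\<not> algebraic_in (range \<iota>) (j_invariant (\<phi> e))" for e
  proof (induction e)
    case (Suc e)
    then have "\<not> algebraic_in (range \<iota>) (u e)" unfolding j by (rule C.transcendental_of_J)
    then show ?case unfolding j' by (rule C.J_involution_transcendental[OF u0])
  qed (rule tr)
  have "algebraic_in (range \<iota>) 0"
    unfolding algebraic_in_def poly_over_range_iff
    by (intro exI[of _ "[:0, 1:]"]) (auto intro!: exI[of _ "[:0, 1:]"] simp: map_poly_pCons_hom)
  then have g0: "g\<^sub>\<phi> (\<phi> e) \<noteq> 0" for e using jtr[of e] by (auto simp: j_invariant_eq)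
  have "u (Suc e) \<noteq> p * F p / u e" for e
  proof
    assume eq: "u (Suc e) = p * F p / u e"
    obtain z where z: "poly (\<phi> e [:- a, 1:]) z = 0" "poly (\<mu> (Suc e)) (poly (\<mu> e) z) \<noteq> 0"
      using tower_noncyclic_contradiction[OF tower, of "[:- a, 1:]" e] by auto
    have "[:- a, 1:] = [:- a:] + [:0, 1:]" by simp
    then have "\<gamma> [:- a:] * z + (T * z + g\<^sub>\<phi> (\<phi> e) * F z + D\<^sub>\<phi> (\<phi> e) * F (F z)) = 0"
      using z(1) by (simp only: drinfeld_add[OF dr] drinfeld_const[OF dr] drinfeld_T[OF dr])
    moreover have "\<gamma> [:- a:] = - \<gamma> [:a:]" by (simp flip: \<gamma>_simps(6))
    ultimately have mz: "p * z + g\<^sub>\<phi> (\<phi> e) * F z + D\<^sub>\<phi> (\<phi> e) * F (F z) = 0"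
      unfolding p by (simp add: algebra_simps)
    have "F (c e * (F z - d e * z)) = d (Suc e) * (c e * (F z - d e * z))"
      by (rule linear_level.involution_kernel[OF lev p0 g0 linear_level.root[OF lev] _ mz])
         (use eq in \<open>simp add: u_def linear_level.u_def[OF lev]\<close>)
    then show False using z(2) unfolding \<mu> by simp
  qed
  then show ?thesis using that[of u] u0 j j' unfolding CJ by blast
qed

end

text \<open>With p = T - a one has J(X) = (X + p)^(q + 1) / X and \<kappa> = p^(q + 1). As B = 1,
  division by the diagonal already yields degree q.\<close>

lemma linear_level_statement:
  fixes P :: "'q::{finite,field} poly"
  assumes P: "P = [:- a, 1:]"
  shows "depth_one_recursion TYPE('l::alg_closed_field) P"
proof -
  define q where "q = CARD('q)"
  have q1: "q > 1" unfolding q_def by (rule card_field_gt_1)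
  define p :: "'q poly fract" where "p = to_fract [:- a, 1:]"
  have p0: "p \<noteq> 0" by (simp add: p_def)
  define A where "A = [:p, 1:] ^ (q + 1)"
  have dA: "degree A = Suc q" using degree_power_eq[of "[:p, 1:]" "q + 1"] by (simp add: A_def)
  have A0: "coeff A 0 = p ^ (q + 1)" by (simp add: A_def poly_0_coeff_0[symmetric] poly_power)
  obtain g :: "'q poly fract poly poly" where g: "degree g = q" "\<And>i. i > 0 \<Longrightarrow> coeff (coeff g i) 0 = 0"
    "coeff (coeff g 0) 0 = coeff A 0"
    "\<And>(\<iota> :: 'q poly fract \<Rightarrow> 'l) x y. field_hom \<iota> \<Longrightarrow>
       poly (map_poly \<iota> A) x * y - poly (map_poly \<iota> A) y * x = (y - x) * eval2 \<iota> g x y"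
    using division_by_diagonal[OF dA, where ?'l = 'l] q1 by (metis less_imp_le_nat)
  show ?thesis
  proof (rule statement_of_parametrization[where A = A and B = 1 and g = g and \<kappa> = "p ^ (q + 1)"
      and a = 0 and b = 1 and c = 1 and Q = q])
    fix \<iota> :: "'q poly fract \<Rightarrow> 'l" and \<phi> \<mu>
    assume hom: "field_hom \<iota>"
      and cover: "involutive_cover (range \<iota>) (map_poly \<iota> A) (map_poly \<iota> 1) (\<iota> (p ^ (q + 1))) q"
      and tower: "isogeny_tower (\<lambda>a. \<iota> (to_fract a)) P \<phi> \<mu>"
      and tr: "\<not> algebraic_in (range \<iota>) (j_invariant (\<phi> 0))"
    interpret field_hom \<iota> by (rule hom)
    interpret drinfeld_setting \<iota> q by unfold_locales (simp add: q_def)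
    have \<gamma>: "(\<lambda>a. \<iota> (to_fract a)) = \<gamma>" by (simp add: \<gamma>_def fun_eq_iff)
    have "[:- a, 1:] = [:0, 1:] - [:a:]" by simp
    then have \<iota>p: "\<iota> p = T - \<gamma> [:a:]" unfolding p_def T_def \<gamma>_def[symmetric] by (simp only: \<gamma>_simps)
    have \<kappa>: "\<iota> (p ^ (q + 1)) = \<iota> p * F (\<iota> p)" by (simp add: F_def hom_distribs)
    have m1: "map_poly \<iota> 1 = 1" by simp
    have ev: "poly (map_poly \<iota> A) x = (\<iota> p + x) * F (\<iota> p + x)" for x
      by (simp add: A_def F_def hom_distribs map_poly_pCons_hom algebra_simps)
    obtain u where u: "\<And>e. u e \<noteq> 0" "\<And>e. j_invariant (\<phi> e) = poly (map_poly \<iota> A) (u e) / u e"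
      "\<And>e. j_invariant (\<phi> (Suc e)) = poly (map_poly \<iota> A) (\<iota> p * F (\<iota> p) / u e) / (\<iota> p * F (\<iota> p) / u e)"
      "\<And>e. u (Suc e) \<noteq> \<iota> p * F (\<iota> p) / u e"
      using linear_tower[OF tower[unfolded \<gamma> P] \<iota>p cover[unfolded \<kappa> m1] ev tr] by metis
    have "eval2 \<iota> g (\<iota> p * F (\<iota> p) / u e) (u (Suc e)) = 0" for e
    proof -
      define x where "x = \<iota> p * F (\<iota> p) / u e"
      have x0: "x \<noteq> 0" using u(1) p0 by (simp add: x_def)
      have "poly (map_poly \<iota> A) x / x = poly (map_poly \<iota> A) (u (Suc e)) / u (Suc e)"
        using u(2)[of "Suc e"] u(3)[of e] by (simp add: x_def)
      then have "poly (map_poly \<iota> A) x * u (Suc e) - poly (map_poly \<iota> A) (u (Suc e)) * x = 0"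
        using x0 u(1)[of "Suc e"] by (simp add: field_simps)
      then show ?thesis using g(4)[OF hom, of x "u (Suc e)"] u(4)[of e] by (simp add: x_def)
    qed
    then show "\<exists>u. \<forall>e. u e \<noteq> 0 \<and> poly (map_poly \<iota> 1) (u e) \<noteq> 0 \<and>
         j_invariant (\<phi> e) = poly (map_poly \<iota> A) (u e) / (u e * poly (map_poly \<iota> 1) (u e)) \<and>
         j_invariant (\<phi> (Suc e)) = poly (map_poly \<iota> A) (\<iota> (p ^ (q + 1)) / u e) /
           (\<iota> (p ^ (q + 1)) / u e * poly (map_poly \<iota> 1) (\<iota> (p ^ (q + 1)) / u e)) \<and>
         eval2 \<iota> g (\<iota> (p ^ (q + 1)) / u e) (u (Suc e)) = 0"
      unfolding \<kappa> m1 using u by (intro exI[of _ u]) simp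
  next
    fix \<iota> :: "'q poly fract \<Rightarrow> 'l" and s assume "field_hom \<iota>"
    then interpret field_hom \<iota> .
    show "poly (map_poly \<iota> 1) (\<iota> (p ^ (q + 1)) / s) * s ^ degree (1 :: 'q poly fract poly) =
        \<iota> 1 * poly (map_poly \<iota> 1) s" by simp
  qed (use dA q1 p0 g A0 in \<open>auto simp: P q_def[symmetric]\<close>)
qed

section \<open>Level of degree two\<close>

definition comaximal :: "'a::comm_ring_1 \<Rightarrow> 'a \<Rightarrow> bool" where
  "comaximal f g \<longleftrightarrow> (\<exists>a b. a * f + b * g = 1)"

lemma comaximal_1: "comaximal f 1"
  unfolding comaximal_def by (intro exI[of _ 0] exI[of _ 1]) simp

lemma comaximal_sym: "comaximal f g \<Longrightarrow> comaximal g f"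
proof -
  assume "comaximal f g"
  then obtain a b where "a * f + b * g = 1" unfolding comaximal_def by blast
  then have "b * g + a * f = 1" by (simp only: add.commute)
  then show ?thesis unfolding comaximal_def by blast
qed

lemma comaximal_mult:
  assumes "comaximal f g" "comaximal f h" shows "comaximal f (g * h)"
proof -
  obtain a b c d where 1: "a * f + b * g = 1" "c * f + d * h = 1"
    using assms unfolding comaximal_def by blast
  have "(a * c * f + a * d * h + b * g * c) * f + (b * d) * (g * h) = (a * f + b * g) * (c * f + d * h)"
    by (simp add: algebra_simps)
  also have "\<dots> = 1" unfolding 1 by simp
  finally have "(a * c * f + a * d * h + b * g * c) * f + (b * d) * (g * h) = 1" .
  then show ?thesis unfolding comaximal_def by blast
qed

lemma comaximal_power: "comaximal f g \<Longrightarrow> comaximal f (g ^ n)"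
  by (induction n) (auto intro: comaximal_1 comaximal_mult)

lemma comaximal_prod: "(\<And>i. i \<in> S \<Longrightarrow> comaximal f (g i)) \<Longrightarrow> comaximal f (\<Prod>i\<in>S. g i)"
  by (induction S rule: infinite_finite_induct) (auto intro: comaximal_1 comaximal_mult)

text \<open>Division of f by X - c leaves the remainder f(c), a unit.\<close>

lemma comaximal_linear:
  fixes f :: "'a::field poly"
  assumes "poly f c \<noteq> 0" shows "comaximal f [:- c, 1:]"
proof -
  define s where "s = synthetic_div f c"
  define K where "K = [:1 / poly f c:]"
  define L where "L = [:- c, 1:]"
  have "L * s + [:poly f c:] = f" unfolding s_def L_def by (rule synthetic_div_correct')
  then have fs: "f - L * s = [:poly f c:]" by (metis add_diff_cancel_left')
  have "K * f' + (- (K * s)) * L = K * (f' - L * s)" for f' by (simp add: algebra_simps)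
  then have "K * f + (- (K * s)) * L = K * (f - L * s)" .
  also have "\<dots> = K * [:poly f c:]" unfolding fs ..
  also have "\<dots> = 1" using assms by (simp add: K_def)
  finally have "K * f + (- (K * s)) * [:- c, 1:] = 1" unfolding L_def .
  then show ?thesis unfolding comaximal_def by blast
qed

lemma choose_eq_0_poly:
  assumes "0 < i" "i < CARD('q::{finite,field})"
  shows "of_nat (CARD('q) choose i) = (0 :: 'q poly)"
  using card_choose_eq_0[OF assms] by (simp add: of_nat_poly)

lemma choose_eq_0_fract_poly:
  assumes "0 < i" "i < CARD('q::{finite,field})"
  shows "of_nat (CARD('q) choose i) = (0 :: 'q poly fract poly)"
proof -
  have "to_fract (of_nat (CARD('q) choose i) :: 'q poly) = 0" unfolding choose_eq_0_poly[OF assms] by simp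
  then have "of_nat (CARD('q) choose i) = (0 :: 'q poly fract)"
    by (simp only: to_fract_hom.hom_of_nat)
  then show ?thesis by (simp add: of_nat_poly)
qed

context field_hom
begin

lemma eval2_hom: "comm_ring_hom (\<lambda>f. eval2 hom f x y)"
proof -
  define E where "E = (\<lambda>p. poly (map_poly hom p) x)"
  interpret E: comm_ring_hom E
    by unfold_locales (simp_all add: E_def map_poly_hom.hom_mult map_poly_hom_add)
  interpret mE: map_poly_comm_ring_hom E ..
  have "(\<lambda>f. eval2 hom f x y) = (\<lambda>f. poly (map_poly E f) y)" by (simp add: eval2_def E_def fun_eq_iff)
  moreover have "comm_ring_hom (\<lambda>f. poly (map_poly E f) y)"
    by unfold_locales (simp_all add: mE.hom_mult mE.hom_add)
  ultimately show ?thesis by simp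
qed

lemma eval2_mult: "eval2 hom (f * g) x y = eval2 hom f x y * eval2 hom g x y"
  and eval2_diff: "eval2 hom (f - g) x y = eval2 hom f x y - eval2 hom g x y"
  and eval2_add: "eval2 hom (f + g) x y = eval2 hom f x y + eval2 hom g x y"
  and eval2_power: "eval2 hom (f ^ n) x y = eval2 hom f x y ^ n"
proof -
  interpret e: comm_ring_hom "\<lambda>f. eval2 hom f x y" by (rule eval2_hom)
  show "eval2 hom (f * g) x y = eval2 hom f x y * eval2 hom g x y" by (rule e.hom_mult)
  show "eval2 hom (f - g) x y = eval2 hom f x y - eval2 hom g x y" by (rule e.hom_minus)
  show "eval2 hom (f + g) x y = eval2 hom f x y + eval2 hom g x y" by (rule e.hom_add)
  show "eval2 hom (f ^ n) x y = eval2 hom f x y ^ n" by (rule e.hom_power)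
qed

lemma eval2_const: "eval2 hom [:c:] x y = poly (map_poly hom c) x"
  by (simp add: eval2_sum)

lemma eval2_linear: "eval2 hom [:c, 1:] x y = poly (map_poly hom c) x + y"
  by (simp add: eval2_sum)

end

lemma coeffs_at_zero:
  fixes g :: "'k::field poly poly"
  assumes "map_poly (\<lambda>c. poly c 0) g = [:k:]"
  shows "i > 0 \<Longrightarrow> coeff (coeff g i) 0 = 0" "coeff (coeff g 0) 0 = k"
proof -
  have c: "coeff (coeff g i) 0 = coeff [:k:] i" for i
    unfolding assms[symmetric] by (simp add: coeff_map_poly poly_0_coeff_0)
  show "i > 0 \<Longrightarrow> coeff (coeff g i) 0 = 0" "coeff (coeff g 0) 0 = k"
    unfolding c by (auto simp: coeff_pCons split: nat.splits)
qed

section \<open>Relations between consecutive parameters for a quadratic level with roots in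
  F_q\<close>

context quadratic_setting
begin

lemma F_power: "F z = z ^ (q - 1) * z"
  using q_gt_1 unfolding F_def by (metis Suc_diff_1 not_less0 not_less_iff_gr_or_eq power_Suc2 less_trans zero_less_one)

lemma eigenspace_power:
  assumes "p * F b * s * W = x * w * F W" "W \<noteq> 0"
  shows "p * F b * s = x * w * W ^ (q - 1)"
proof -
  have "(p * F b * s) * W = (x * w * W ^ (q - 1)) * W" using assms(1) by (simp add: F_power[of W] mult_ac)
  then show ?thesis using assms(2) by simp
qed

context
  fixes a a' :: 'q and p r :: 'l
  assumes tq: "t\<^sub>q = a + a'" and nq: "n\<^sub>q = a * a'"
    and p: "p = T - \<gamma> [:a:]" and r: "r = T - \<gamma> [:a':]"
begin

lemma \<gamma>_roots: "\<gamma> [:t\<^sub>q:] = \<gamma> [:a:] + \<gamma> [:a':]" "\<gamma> [:n\<^sub>q:] = \<gamma> [:a:] * \<gamma> [:a':]"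
proof -
  have "\<gamma> ([:a:] + [:a':]) = \<gamma> [:a:] + \<gamma> [:a':]" "\<gamma> ([:a:] * [:a':]) = \<gamma> [:a:] * \<gamma> [:a':]"
    by (rule \<gamma>_simps)+
  then show "\<gamma> [:t\<^sub>q:] = \<gamma> [:a:] + \<gamma> [:a':]" "\<gamma> [:n\<^sub>q:] = \<gamma> [:a:] * \<gamma> [:a':]"
    by (simp_all add: tq nq mult.commute)
qed

lemma P_split: "L.P \<alpha> = ((T - \<alpha>) - p) * ((T - \<alpha>) - r)"
  unfolding L.P_def unfolding \<gamma>_roots p r by (simp add: algebra_simps)

lemma P_T_split: "L.P T = p * r"
  unfolding P_split by simp

text \<open>The numerator of 1 + \<delta> m as a function of x = T - \<alpha>, over the denominator
  P(\<alpha>) = (x - p)(x - r).\<close>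

definition N :: "'l \<Rightarrow> 'l" where "N x = x * F (p - x) - p * (x - r)"

text \<open>p - r is a constant of F_q, so F(p) - F(r) = p - r and exchanging p with r changes
  nothing.\<close>

lemma N_sym: "N x = x * F (r - x) - r * (x - p)"
proof -
  have "F p - F r = p - r" unfolding p r by (simp add: F.hom_minus F_\<gamma>)
  then have "x * (F p - F r) = x * (p - r)" by simp
  then show ?thesis by (simp add: N_def F.hom_minus algebra_simps)
qed

lemma one_plus_\<delta>_m:
  assumes "L.P \<alpha> \<noteq> 0" shows "1 + L.\<delta> \<alpha> * L.m \<alpha> = N (T - \<alpha>) / L.P \<alpha>"
proof -
  have Fp: "F p = F T - \<gamma> [:a:]" unfolding p by (simp add: F.hom_minus F_\<gamma>)
  have "L.P \<alpha> + (T - \<alpha>) * L.m \<alpha> = N (T - \<alpha>)"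
    unfolding P_split N_def L.m_def unfolding \<gamma>_roots F.hom_minus Fp by (simp add: p r algebra_simps)
  then show ?thesis using assms by (simp add: L.\<delta>_def field_simps)
qed

text \<open>Extracts y - x from the expression that W becomes once b is eliminated; the cofactor is
  what is raised to the power q - 1 in the final equation.\<close>

lemma N_identity:
  "(x - r) * N y - (y - r) * N x = (y - x) * (r * F (y - p) - (y - r) * x * (y - x) ^ (q - 1))"
proof -
  have "(y - x) * (r * F (y - p) - (y - r) * x * (y - x) ^ (q - 1)) =
      (y - x) * r * F (y - p) - (y - r) * x * F (y - x)"
    by (simp add: F_power[of "y - x"] algebra_simps)
  also have "\<dots> = (x - r) * N y - (y - r) * N x" by (simp add: N_def F.hom_minus algebra_simps)
  finally show ?thesis ..
qed

lemma N_identity':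
  "(x - p) * N y - (y - p) * N x = (y - x) * (p * F (y - r) - (y - p) * x * (y - x) ^ (q - 1))"
proof -
  have "(y - x) * (p * F (y - r) - (y - p) * x * (y - x) ^ (q - 1)) =
      (y - x) * p * F (y - r) - (y - p) * x * F (y - x)"
    by (simp add: F_power[of "y - x"] algebra_simps)
  also have "\<dots> = (x - p) * N y - (y - p) * N x" by (simp add: N_sym F.hom_minus algebra_simps)
  finally show ?thesis ..
qed

text \<open>The unknown is b = \<beta>2 / \<beta>1. Equating the two expressions for g gives b
  rationally and turns the quantities W into multiples of (y - x) Cp and (y - x) Cr. The two
  eigenspaces then give two expressions for F(b), and comparing them removes F(b), N(y) and the
  common factor x (y - x)^(q - 1). Degree q + q (q - 1) = q^2 in y remains.\<close>

lemma split_relation: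
  assumes s1: "L.submodule g D \<alpha>1 \<beta>1" and s2: "L.submodule g D \<alpha>2 \<beta>2" and g: "g \<noteq> 0"
    and ne: "(\<gamma> [:a:] - \<alpha>1) / \<beta>1 \<noteq> (\<gamma> [:a:] - \<alpha>2) / \<beta>2"
    and ne': "(\<gamma> [:a':] - \<alpha>1) / \<beta>1 \<noteq> (\<gamma> [:a':] - \<alpha>2) / \<beta>2"
    and x: "x = T - \<alpha>1" and y: "y = T - \<alpha>2"
  shows "r * (F (y - p) * F (x - p)) * (r * F (y - p) - (y - r) * x * (y - x) ^ (q - 1)) ^ (q - 1) =
     p * (F (y - r) * F (x - r)) * (p * F (y - r) - (y - p) * x * (y - x) ^ (q - 1)) ^ (q - 1)"
proof -
  define b where "b = \<beta>2 / \<beta>1"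
  define Wp where "Wp = (y - p) - b * (x - p)"
  define Wr where "Wr = (y - r) - b * (x - r)"
  define Cp where "Cp = r * F (y - p) - (y - r) * x * (y - x) ^ (q - 1)"
  define Cr where "Cr = p * F (y - r) - (y - p) * x * (y - x) ^ (q - 1)"
  have Wp: "Wp \<noteq> 0" "p * F b * (x - r) * Wp = x * (y - p) * F Wp"
    using L.submodule_eigenspaces[OF s1 s2 F_\<gamma> \<gamma>_roots ne x y b_def p r Wp_def] by blast+
  have "\<gamma> [:t\<^sub>q:] = \<gamma> [:a':] + \<gamma> [:a:]" "\<gamma> [:n\<^sub>q:] = \<gamma> [:a':] * \<gamma> [:a:]"
    unfolding \<gamma>_roots by (simp_all add: add.commute mult.commute)
  note roots' = this
  have Wr: "Wr \<noteq> 0" "r * F b * (x - p) * Wr = x * (y - r) * F Wr"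
    using L.submodule_eigenspaces[OF s1 s2 F_\<gamma> roots' ne' x y b_def r p Wr_def] by blast+
  have P1: "L.P \<alpha>1 = (x - p) * (x - r)" and P2: "L.P \<alpha>2 = (y - p) * (y - r)"
    unfolding x y by (rule P_split)+
  have nz: "L.P \<alpha>1 \<noteq> 0" "L.P \<alpha>2 \<noteq> 0" "\<beta>1 \<noteq> 0" "x \<noteq> 0" using s1 s2 by (auto simp: L.submodule_def x)
  have g1: "g = \<beta>1 * (N x / L.P \<alpha>1)" and g2: "g = \<beta>2 * (N y / L.P \<alpha>2)"
    using s1 s2 one_plus_\<delta>_m[OF nz(1)] one_plus_\<delta>_m[OF nz(2)] by (auto simp: L.submodule_def x y)
  have "\<beta>2 * N y * L.P \<alpha>1 = \<beta>1 * N x * L.P \<alpha>2" using g1 g2 nz by (simp add: field_simps)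
  then have bN: "b * N y * ((x - p) * (x - r)) = N x * ((y - p) * (y - r))"
    using nz(3) unfolding P1 P2 b_def by (simp add: field_simps)
  have key: "p * F b * F (x - r) * N y ^ (q - 1) = x * F (y - p) * (y - x) ^ (q - 1) * Cp ^ (q - 1)"
    "y - x \<noteq> 0" if "N y \<noteq> 0" "x - r \<noteq> 0"
  proof -
    have "N y * (x - r) * Wp = (y - p) * ((x - r) * N y) - b * N y * ((x - p) * (x - r))"
      by (simp add: Wp_def algebra_simps)
    also have "\<dots> = (y - p) * ((x - r) * N y - (y - r) * N x)" unfolding bN by (simp add: algebra_simps)
    also have "\<dots> = (y - p) * (y - x) * Cp" unfolding N_identity Cp_def by simp
    finally have W: "N y * (x - r) * Wp = (y - p) * (y - x) * Cp" .
    then show "y - x \<noteq> 0" using that Wp(1) by auto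
    have "p * F b * F (x - r) * N y ^ (q - 1) = (p * F b * (x - r)) * ((x - r) ^ (q - 1) * N y ^ (q - 1))"
      by (simp add: F_power[of "x - r"] mult_ac)
    also have "p * F b * (x - r) = x * (y - p) * Wp ^ (q - 1)" by (rule eigenspace_power[OF Wp(2,1)])
    also have "x * (y - p) * Wp ^ (q - 1) * ((x - r) ^ (q - 1) * N y ^ (q - 1)) =
        x * (y - p) * (N y * (x - r) * Wp) ^ (q - 1)" by (simp add: power_mult_distrib mult_ac)
    also have "\<dots> = x * ((y - p) ^ (q - 1) * (y - p)) * (y - x) ^ (q - 1) * Cp ^ (q - 1)"
      unfolding W by (simp add: power_mult_distrib mult_ac)
    finally show "p * F b * F (x - r) * N y ^ (q - 1) = x * F (y - p) * (y - x) ^ (q - 1) * Cp ^ (q - 1)"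
      by (simp only: F_power)
  qed
  have key': "r * F b * F (x - p) * N y ^ (q - 1) = x * F (y - r) * (y - x) ^ (q - 1) * Cr ^ (q - 1)"
  proof -
    have "N y * (x - p) * Wr = (y - r) * ((x - p) * N y) - b * N y * ((x - p) * (x - r))"
      by (simp add: Wr_def algebra_simps)
    also have "\<dots> = (y - r) * ((x - p) * N y - (y - p) * N x)" unfolding bN by (simp add: algebra_simps)
    also have "\<dots> = (y - r) * (y - x) * Cr" unfolding N_identity' Cr_def by simp
    finally have W: "N y * (x - p) * Wr = (y - r) * (y - x) * Cr" .
    have "r * F b * F (x - p) * N y ^ (q - 1) = (r * F b * (x - p)) * ((x - p) ^ (q - 1) * N y ^ (q - 1))"
      by (simp add: F_power[of "x - p"] mult_ac)
    also have "r * F b * (x - p) = x * (y - r) * Wr ^ (q - 1)" by (rule eigenspace_power[OF Wr(2,1)])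
    also have "x * (y - r) * Wr ^ (q - 1) * ((x - p) ^ (q - 1) * N y ^ (q - 1)) =
        x * (y - r) * (N y * (x - p) * Wr) ^ (q - 1)" by (simp add: power_mult_distrib mult_ac)
    also have "\<dots> = x * ((y - r) ^ (q - 1) * (y - r)) * (y - x) ^ (q - 1) * Cr ^ (q - 1)"
      unfolding W by (simp add: power_mult_distrib mult_ac)
    finally show ?thesis by (simp only: F_power)
  qed
  have Ny: "N y \<noteq> 0" "x - r \<noteq> 0" using g g2 nz P1 by auto
  define E where "E = x * (y - x) ^ (q - 1)"
  have E0: "E \<noteq> 0" using key(2)[OF Ny] nz by (simp add: E_def)
  have "E * (r * (F (y - p) * F (x - p)) * Cp ^ (q - 1)) = (x * F (y - p) * (y - x) ^ (q - 1) * Cp ^ (q - 1)) * (r * F (x - p))"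
    by (simp add: E_def mult_ac)
  also have "\<dots> = (r * F b * F (x - p) * N y ^ (q - 1)) * (p * F (x - r))" unfolding key(1)[OF Ny, symmetric] by (simp add: mult_ac)
  also have "\<dots> = E * (p * (F (y - r) * F (x - r)) * Cr ^ (q - 1))" unfolding key' by (simp add: E_def mult_ac)
  finally show ?thesis using E0 unfolding Cp_def Cr_def by simp
qed

text \<open>A double root provides a single eigenspace, so a second expression for F(b) is obtained
  by applying F to the equation for b that comes from g. Here N(z) = (p - z) M(z), which cancels one
  factor of P.\<close>

lemma square_relation:
  assumes eq: "a = a'"
    and s1: "L.submodule g D \<alpha>1 \<beta>1" and s2: "L.submodule g D \<alpha>2 \<beta>2" and g: "g \<noteq> 0"
    and ne: "(\<gamma> [:a:] - \<alpha>1) / \<beta>1 \<noteq> (\<gamma> [:a:] - \<alpha>2) / \<beta>2"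
    and x: "x = T - \<alpha>1" and y: "y = T - \<alpha>2"
    and M: "\<And>z. M z = p + z * (p - z) ^ (q - 1)"
  shows "x * (x - p) ^ (q - 1) * (M y - M x) ^ (q - 1) * M y = p * F (M x)"
proof -
  have rp: "r = p" using eq by (simp add: p r)
  define b where "b = \<beta>2 / \<beta>1"
  define W where "W = (y - p) - b * (x - p)"
  have W: "W \<noteq> 0" "p * F b * (x - p) * W = x * (y - p) * F W"
    using L.submodule_eigenspaces[OF s1 s2 F_\<gamma> \<gamma>_roots ne x y b_def p r W_def] rp by auto
  have P1: "L.P \<alpha>1 = (x - p) * (x - p)" and P2: "L.P \<alpha>2 = (y - p) * (y - p)"
    unfolding x y P_split rp by simp_all
  have nz: "L.P \<alpha>1 \<noteq> 0" "L.P \<alpha>2 \<noteq> 0" "\<beta>1 \<noteq> 0" "x \<noteq> 0" using s1 s2 by (auto simp: L.submodule_def x)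
  then have xp: "x - p \<noteq> 0" "y - p \<noteq> 0" using P1 P2 by auto
  have NM: "N z = (p - z) * M z" for z
    unfolding N_def M F_power[of "p - z"] unfolding rp by (simp add: algebra_simps)
  have NM1: "(p - z) * Mz / ((z - p) * (z - p)) = - Mz / (z - p)" if "z - p \<noteq> 0" for z Mz
  proof -
    have "p - z = - (z - p)" by simp
    then show ?thesis using that by (metis mult_divide_mult_cancel_left mult_minus_left mult_minus_right)
  qed
  have g1: "g = \<beta>1 * (- M x / (x - p))" and g2: "g = \<beta>2 * (- M y / (y - p))"
    using s1 s2 one_plus_\<delta>_m[OF nz(1)] one_plus_\<delta>_m[OF nz(2)] xp
    unfolding P1 P2 NM x[symmetric] y[symmetric] NM1[OF xp(1)] NM1[OF xp(2)] L.submodule_def by simp_all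
  have "\<beta>2 * M y * (x - p) = \<beta>1 * M x * (y - p)" using g1 g2 xp by (simp add: field_simps)
  then have bM: "b * M y * (x - p) = M x * (y - p)" using nz(3) unfolding b_def by (simp add: field_simps)
  have My: "M y \<noteq> 0" using g g2 by auto
  have MW: "M y * W = (y - p) * (M y - M x)"
  proof -
    have "M y * W = M y * (y - p) - b * M y * (x - p)" by (simp add: W_def algebra_simps)
    then show ?thesis unfolding bM by (simp add: algebra_simps)
  qed
  have "p * F b * (x - p) * M y ^ (q - 1) = x * (y - p) * (M y * W) ^ (q - 1)"
    unfolding eigenspace_power[OF W(2,1)] by (simp add: power_mult_distrib mult_ac)
  also have "\<dots> = x * F (y - p) * (M y - M x) ^ (q - 1)"
    unfolding MW F_power[of "y - p"] by (simp add: power_mult_distrib mult_ac)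
  finally have e: "p * F b * (x - p) * M y ^ (q - 1) = x * F (y - p) * (M y - M x) ^ (q - 1)" .
  have "F (b * M y * (x - p)) = F (M x * (y - p))" unfolding bM ..
  then have FbM: "F b * F (M y) * F (x - p) = F (M x) * F (y - p)" by (simp only: F.hom_mult)
  have "F (y - p) * (x - p) * (p * F (M x)) = p * (F b * F (M y) * F (x - p)) * (x - p)"
    unfolding FbM by (simp add: mult_ac)
  also have "\<dots> = (p * F b * (x - p) * M y ^ (q - 1)) * M y * F (x - p)"
    unfolding F_power[of "M y"] by (simp add: mult_ac)
  also have "\<dots> = F (y - p) * (x - p) * (x * (x - p) ^ (q - 1) * (M y - M x) ^ (q - 1) * M y)"
    unfolding e F_power[of "x - p"] by (simp add: mult_ac)
  finally show ?thesis using xp by simp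
qed

end

end

lemma degree_smult_diff:
  fixes f h :: "'a::idom poly"
  assumes "degree f = n" "degree h = n" "c * coeff f n - d * coeff h n \<noteq> 0"
  shows "degree (Polynomial.smult c f - Polynomial.smult d h) = n"
    "coeff (Polynomial.smult c f - Polynomial.smult d h) n = c * coeff f n - d * coeff h n"
proof -
  show c: "coeff (Polynomial.smult c f - Polynomial.smult d h) n = c * coeff f n - d * coeff h n" by simp
  have "degree (Polynomial.smult c f - Polynomial.smult d h) \<le> n"
    using assms(1,2) by (intro degree_diff_le order.trans[OF degree_smult_le]) auto
  moreover have "n \<le> degree (Polynomial.smult c f - Polynomial.smult d h)"
    using assms(3) unfolding c[symmetric] by (rule le_degree)
  ultimately show "degree (Polynomial.smult c f - Polynomial.smult d h) = n" by simp
qed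

lemma degree_lead_power:
  fixes f :: "'a::idom poly"
  assumes "degree f = n" "coeff f n \<noteq> 0"
  shows "degree (f ^ k) = k * n" "coeff (f ^ k) (k * n) = coeff f n ^ k"
proof -
  have f: "f \<noteq> 0" using assms by auto
  show d: "degree (f ^ k) = k * n" using degree_power_eq[OF f] assms by simp
  show "coeff (f ^ k) (k * n) = coeff f n ^ k"
    using lead_coeff_power[of f k] unfolding d assms(1) .
qed

lemma degree_lead_mult:
  fixes f h :: "'a::idom poly"
  assumes "degree f = n" "coeff f n \<noteq> 0" "degree h = m" "coeff h m \<noteq> 0"
  shows "degree (f * h) = n + m" "coeff (f * h) (n + m) = coeff f n * coeff h m"
proof -
  have "f \<noteq> 0" "h \<noteq> 0" using assms by auto
  then show "degree (f * h) = n + m" using assms by (simp add: degree_mult_eq)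
  show "coeff (f * h) (n + m) = coeff f n * coeff h m"
    using coeff_mult_degree_sum[of f h] assms by simp
qed

lemma (in field_hom) eval2_smult:
  "eval2 hom (Polynomial.smult c f) x y = poly (map_poly hom c) x * eval2 hom f x y"
  using eval2_mult[of "[:c:]" f x y] by (simp add: eval2_const)

section \<open>The recursive equation for two distinct roots\<close>

definition split_numerator :: "nat \<Rightarrow> 'k::field \<Rightarrow> 'k \<Rightarrow> 'k poly" where
  "split_numerator q p r = [:0, 1:] * [:p, -1:] ^ q - Polynomial.smult p [:- r, 1:]"

text \<open>Because \<delta> = x / P(\<alpha>), one factor P(\<alpha>) cancels and J = N F(N) / (x
  F(P(\<alpha>))). This is why A is N^(q + 1) and B the q-th power of (X - p)(X - r).\<close>

definition split_denominator :: "nat \<Rightarrow> 'k::field \<Rightarrow> 'k \<Rightarrow> 'k poly" where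
  "split_denominator q p r = ([:- p, 1:] * [:- r, 1:]) ^ q"

definition split_factor :: "nat \<Rightarrow> 'k::field \<Rightarrow> 'k \<Rightarrow> 'k poly poly" where
  "split_factor q p r = Polynomial.smult [:r:] ([:[:- p:], 1:] ^ q) -
     Polynomial.smult [:0, 1:] ([:[:- r:], 1:] * [:[:0, -1:], 1:] ^ (q - 1))"

definition split_half :: "nat \<Rightarrow> 'k::field \<Rightarrow> 'k \<Rightarrow> 'k poly poly" where
  "split_half q p r = [:[:- p:], 1:] ^ q * split_factor q p r ^ (q - 1)"

definition split_equation :: "nat \<Rightarrow> 'k::field \<Rightarrow> 'k \<Rightarrow> 'k poly poly" where
  "split_equation q p r = Polynomial.smult ([:r:] * [:- p, 1:] ^ q) (split_half q p r) -
     Polynomial.smult ([:p:] * [:- r, 1:] ^ q) (split_half q r p)"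

lemma poly_split_numerator: "poly (split_numerator q p r) x = x * (p - x) ^ q - p * (x - r)"
  by (simp add: split_numerator_def poly_power algebra_simps)

context
  fixes p r :: "'k::field" and q :: nat
  assumes p: "p \<noteq> 0" and r: "r \<noteq> 0" and pr: "p \<noteq> r" and q: "q > 1"
    and choose: "\<forall>i. 0 < i \<longrightarrow> i < q \<longrightarrow> of_nat (q choose i) = (0 :: 'k poly)"
begin

lemma degree_split_numerator: "degree (split_numerator q p r) = q + 1"
proof -
  define Z where "Z = [:0, 1:] * [:p, -1:] ^ q"
  define Y where "Y = - Polynomial.smult p [:- r, 1:]"
  have "degree ([:p, -1:] ^ q) = q * 1" by (rule degree_lead_power) auto
  then have Z: "degree Z = 1 + q" unfolding Z_def by (subst degree_mult_eq) auto
  have "degree Y \<le> 1" by (simp add: Y_def)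
  then have "degree (Z + Y) = 1 + q" using Z q by (subst degree_add_eq_left) auto
  moreover have "split_numerator q p r = Z + Y"
    unfolding split_numerator_def Z_def Y_def by (rule diff_conv_add_uminus)
  ultimately show ?thesis by simp
qed

lemma split_numerator_0: "poly (split_numerator q p r) 0 = p * r"
  by (simp add: poly_split_numerator)

lemma split_numerator_roots: "poly (split_numerator q p r) p \<noteq> 0" "poly (split_numerator q p r) r \<noteq> 0"
  using p r pr q by (simp_all add: poly_split_numerator power_0_left)

lemma degree_split_denominator: "degree (split_denominator q p r) = 2 * q"
proof -
  have "degree ([:- p, 1:] * [:- r, 1:]) = 2" by (simp add: degree_mult_eq)
  then show ?thesis unfolding split_denominator_def by (subst degree_power_eq) (auto simp: mult.commute)
qed

lemma split_denominator_0: "poly (split_denominator q p r) 0 = (p * r) ^ q"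
  by (simp add: split_denominator_def poly_power mult.commute)

text \<open>The numerator takes the values - p (p - r) at p and r (p - r)^q at r, both
  nonzero.\<close>

lemma split_comaximal: "comaximal ((split_numerator q p r) ^ n) (split_denominator q p r)"
proof -
  have "comaximal (split_numerator q p r) (split_denominator q p r)" unfolding split_denominator_def
    by (rule comaximal_power, rule comaximal_mult; rule comaximal_linear, rule split_numerator_roots)
  then show ?thesis by (rule comaximal_sym[OF comaximal_power[OF comaximal_sym]])
qed

lemma split_factor_degree:
  fixes p' r' :: 'k
  shows "degree (split_factor q p' r') = q" "coeff (split_factor q p' r') q = [:r', -1:]"
proof -
  define L1 L2 L3 :: "'k poly poly" where "L1 = [:[:- p':], 1:]" and "L2 = [:[:- r':], 1:]" and "L3 = [:[:0, -1:], 1:]"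
  have l: "degree L1 = 1" "coeff L1 1 = 1" "degree L2 = 1" "coeff L2 1 = 1" "degree L3 = 1" "coeff L3 1 = 1"
    by (simp_all add: L1_def L2_def L3_def)
  have 1: "degree (L1 ^ q) = q" "coeff (L1 ^ q) q = 1"
    using degree_lead_power[of L1 1 q] l by simp_all
  have 3: "degree (L3 ^ (q - 1)) = q - 1" "coeff (L3 ^ (q - 1)) (q - 1) = 1"
    using degree_lead_power[of L3 1 "q - 1"] l by simp_all
  have 2: "degree (L2 * L3 ^ (q - 1)) = q" "coeff (L2 * L3 ^ (q - 1)) q = 1"
    using degree_lead_mult[of L2 1 "L3 ^ (q - 1)" "q - 1"] l 3 q by simp_all
  have e: "[:r':] * 1 - [:0, 1:] * 1 = [:r', -1:]"
    by (rule poly_eqI) (simp add: coeff_pCons split: nat.splits)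
  have ne: "[:r':] * coeff (L1 ^ q) q - [:0, 1:] * coeff (L2 * L3 ^ (q - 1)) q \<noteq> 0"
    unfolding 1 2 e by simp
  show "degree (split_factor q p' r') = q" "coeff (split_factor q p' r') q = [:r', -1:]"
    using degree_smult_diff[OF 1(1) 2(1) ne]
    unfolding 1 2 e split_factor_def L1_def[symmetric] L2_def[symmetric] L3_def[symmetric] by blast+
qed

lemma split_half_degree:
  fixes p' r' :: 'k
  shows "degree (split_half q p' r') = q ^ 2" "coeff (split_half q p' r') (q ^ 2) = [:r', -1:] ^ (q - 1)"
proof -
  define L1 :: "'k poly poly" where "L1 = [:[:- p':], 1:]"
  define S where "S = split_factor q p' r'"
  define l where "l = [:r', -1:]"
  have l0: "l \<noteq> 0" by (simp add: l_def)
  have S: "degree S = q" "coeff S q = l" unfolding S_def l_def by (rule split_factor_degree)+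
  have "degree L1 = 1" "coeff L1 1 = 1" by (simp_all add: L1_def)
  then have 1: "degree (L1 ^ q) = q" "coeff (L1 ^ q) q = 1"
    using degree_lead_power[of L1 1 q] by simp_all
  have 2: "degree (S ^ (q - 1)) = (q - 1) * q" "coeff (S ^ (q - 1)) ((q - 1) * q) = l ^ (q - 1)"
    using degree_lead_power[of S q "q - 1"] S l0 by simp_all
  have e: "q + (q - 1) * q = q ^ 2" using q by (cases q) (simp_all add: power2_eq_square)
  have nz: "coeff (L1 ^ q) q \<noteq> 0" "coeff (S ^ (q - 1)) ((q - 1) * q) \<noteq> 0" unfolding 1 2 using l0 by simp_all
  from degree_lead_mult[OF 1(1) nz(1) 2(1) nz(2)]
  show "degree (split_half q p' r') = q ^ 2" "coeff (split_half q p' r') (q ^ 2) = [:r', -1:] ^ (q - 1)"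
    unfolding e 1(2) 2(2) mult_1_left split_half_def S_def[symmetric] l_def[symmetric] L1_def[symmetric] by blast+
qed

text \<open>Both halves have Y-degree q^2, so cancellation of their leading coefficients must be
  excluded. Multiplied by (p - X)(r - X), the difference is r (p - X) - p (r - X) = (p - r) X up to
  sign and q-th powers.\<close>

lemma degree_split_equation: "degree (split_equation q p r) = q ^ 2"
  unfolding split_equation_def
proof (rule degree_smult_diff(1)[OF split_half_degree(1) split_half_degree(1)])
  define P R :: "'k poly" where "P = [:p, -1:]" and "R = [:r, -1:]"
  have neg: "[:- p, 1:] = - P" "[:- r, 1:] = - R" by (simp_all add: P_def R_def)
  define cr cp where "cr = [:r:]" and "cp = [:p:]"
  define E where "E = cr * (- P) ^ q * R ^ (q - 1) - cp * (- R) ^ q * P ^ (q - 1)"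
  have pow: "Z * Z ^ (q - 1) = Z ^ q" for Z :: "'k poly" using q by (cases q) auto
  have mp: "(- Z) ^ q = (- 1) ^ q * Z ^ q" for Z :: "'k poly" by (rule power_minus)
  have "E * (P * R) = (- 1) ^ q * (cr * P ^ q * (R * R ^ (q - 1)) * P - cp * R ^ q * (P * P ^ (q - 1)) * R)"
    unfolding E_def mp[of P] mp[of R] by (simp add: algebra_simps)
  also have "\<dots> = (- 1) ^ q * P ^ q * R ^ q * (cr * P - cp * R)"
    unfolding pow by (simp add: algebra_simps)
  also have "cr * P - cp * R = [:0, p - r:]" by (simp add: P_def R_def cr_def cp_def)
  finally have "E * (P * R) = (- 1) ^ q * P ^ q * R ^ q * [:0, p - r:]" .
  moreover have "(- 1) ^ q * P ^ q * R ^ q * [:0, p - r:] \<noteq> 0" using pr by (simp add: P_def R_def)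
  ultimately have "E \<noteq> 0" by auto
  then show "[:r:] * [:- p, 1:] ^ q * coeff (split_half q p r) (q ^ 2) -
      [:p:] * [:- r, 1:] ^ q * coeff (split_half q r p) (q ^ 2) \<noteq> 0"
    unfolding split_half_degree neg P_def[symmetric] R_def[symmetric] E_def cr_def cp_def .
qed

text \<open>At X = 0 the halves become the same constant K times the q^2-th powers of Y - p and of Y
  - r. By additivity of Frobenius the difference is the constant K (r - p)^(q^2).\<close>

lemma split_equation_at_zero:
  "i > 0 \<Longrightarrow> coeff (coeff (split_equation q p r) i) 0 = 0" "coeff (coeff (split_equation q p r) 0) 0 \<noteq> 0"
proof -
  define z where "z = (\<lambda>c::'k poly. poly c 0)"
  interpret E: comm_ring_hom z by unfold_locales (simp_all add: z_def)
  interpret mE: map_poly_comm_ring_hom z ..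
  define e where "e = map_poly z"
  have lin: "e [:[:b:], 1:] = [:b, 1:]" for b by (simp add: e_def E.map_poly_pCons_hom z_def)
  have sm: "e (Polynomial.smult b f) = Polynomial.smult (poly b 0) (e f)" for b f
    unfolding e_def E.map_poly_hom_smult by (simp add: z_def)
  have ed: "e (f - h) = e f - e h" and em: "e (f * h) = e f * e h" and ep: "e (f ^ n) = e f ^ n" for f h n
    unfolding e_def by (rule mE.hom_minus mE.hom_mult mE.hom_power)+
  have half: "e (split_half q p' r') = Polynomial.smult (r' ^ (q - 1)) (([:- p', 1:] ^ q) ^ q)" for p' r'
  proof -
    have "e (split_factor q p' r') = Polynomial.smult r' ([:- p', 1:] ^ q)"
      unfolding split_factor_def ed sm ep lin by simp
    then have "e (split_half q p' r') = Polynomial.smult (r' ^ (q - 1)) ([:- p', 1:] ^ q * ([:- p', 1:] ^ q) ^ (q - 1))"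
      unfolding split_half_def em ep lin by (simp add: smult_power)
    moreover have "Z * Z ^ (q - 1) = Z ^ q" for Z :: "'k poly" using q by (cases q) auto
    ultimately show ?thesis by simp
  qed
  have pow: "z * z ^ (q - 1) = z ^ q" for z :: 'k using q by (cases q) auto
  define K where "K = (- 1) ^ q * (p * r) ^ q"
  have K: "r * (- p) ^ q * r ^ (q - 1) = K" "p * (- r) ^ q * p ^ (q - 1) = K"
    using pow[of r] pow[of p] unfolding K_def power_minus[of p] power_minus[of r]
    by (simp_all add: power_mult_distrib mult_ac)
  have "e (split_equation q p r) = Polynomial.smult K (([:- p, 1:] ^ q) ^ q) - Polynomial.smult K (([:- r, 1:] ^ q) ^ q)"
    unfolding split_equation_def ed sm half using K by (simp add: poly_power mult_ac)
  also have "\<dots> = Polynomial.smult K (([:- p, 1:] ^ q) ^ q - ([:- r, 1:] ^ q) ^ q)"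
    by (simp add: smult_diff_right)
  also have "([:- p, 1:] ^ q) ^ q - ([:- r, 1:] ^ q) ^ q = (([:- p, 1:] - [:- r, 1:]) ^ q) ^ q"
  proof -
    have fr: "x ^ q - y ^ q = (x - y) ^ q" for x y :: "'k poly"
      by (rule frobenius_diff_ring[OF q, symmetric]) (use choose in blast)
    show ?thesis unfolding fr ..
  qed
  also have "\<dots> = [:((r - p) ^ q) ^ q:]" by (simp add: poly_const_pow)
  finally have "e (split_equation q p r) = [:K * ((r - p) ^ q) ^ q:]" by simp
  from coeffs_at_zero[OF this[unfolded e_def z_def]]
  show "i > 0 \<Longrightarrow> coeff (coeff (split_equation q p r) i) 0 = 0" "coeff (coeff (split_equation q p r) 0) 0 \<noteq> 0"
    using p r pr by (auto simp: K_def)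
qed

lemma eval2_split_equation:
  assumes "field_hom \<iota>"
  shows "eval2 \<iota> (split_equation q p r) x y =
    \<iota> r * ((y - \<iota> p) ^ q * (x - \<iota> p) ^ q) * (\<iota> r * (y - \<iota> p) ^ q - (y - \<iota> r) * x * (y - x) ^ (q - 1)) ^ (q - 1) -
    \<iota> p * ((y - \<iota> r) ^ q * (x - \<iota> r) ^ q) * (\<iota> p * (y - \<iota> r) ^ q - (y - \<iota> p) * x * (y - x) ^ (q - 1)) ^ (q - 1)"
proof -
  interpret field_hom \<iota> by (rule assms)
  have lin: "eval2 \<iota> [:[:- b:], 1:] x y = y - \<iota> b" for b
    unfolding eval2_linear by (simp add: map_poly_pCons_hom hom_uminus)
  have diag: "eval2 \<iota> [:[:0, -1:], 1:] x y = y - x"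
    unfolding eval2_linear by (simp add: map_poly_pCons_hom hom_uminus)
  have fac: "eval2 \<iota> (split_factor q p' r') x y = \<iota> r' * (y - \<iota> p') ^ q - (y - \<iota> r') * x * (y - x) ^ (q - 1)" for p' r'
    unfolding split_factor_def eval2_diff eval2_smult eval2_mult eval2_power lin diag
    by (simp add: map_poly_pCons_hom)
  have pw: "poly (map_poly \<iota> ([:b:] * [:- d, 1:] ^ q)) x = \<iota> b * (x - \<iota> d) ^ q" for b d
    unfolding map_poly_hom.hom_mult map_poly_hom.hom_power poly_mult poly_power map_poly_pCons_hom hom_uminus by simp
  show ?thesis
    unfolding split_equation_def eval2_diff eval2_smult split_half_def eval2_mult eval2_power lin fac pw
    by (simp add: mult_ac)
qed

end

lemma split_level_statement:
  fixes P :: "'q::{finite,field} poly"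
  assumes P: "P = [:a * a', - (a + a'), 1:]" and ne: "a \<noteq> a'"
  shows "depth_one_recursion TYPE('l::alg_closed_field) P"
proof -
  define q where "q = CARD('q)"
  have q1: "q > 1" unfolding q_def by (rule card_field_gt_1)
  define p :: "'q poly fract" where "p = to_fract [:- a, 1:]"
  define r :: "'q poly fract" where "r = to_fract [:- a', 1:]"
  have pr: "p \<noteq> 0" "r \<noteq> 0" "p \<noteq> r" using ne by (simp_all add: p_def r_def)
  have choose: "\<forall>i. 0 < i \<longrightarrow> i < q \<longrightarrow> of_nat (q choose i) = (0 :: 'q poly fract poly)"
    using choose_eq_0_fract_poly unfolding q_def by blast
  note ctx = pr q1 choose
  define Nn where "Nn = split_numerator q p r"
  define A where "A = Nn ^ (q + 1)"
  define B where "B = split_denominator q p r"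
  have dA: "degree A = q ^ 2 + 1 + degree B"
  proof -
    have "degree Nn = q + 1" unfolding Nn_def by (rule degree_split_numerator[OF ctx])
    moreover from this have "Nn \<noteq> 0" by auto
    ultimately have "degree A = (q + 1) * (q + 1)" unfolding A_def by (subst degree_power_eq) auto
    then show ?thesis unfolding B_def degree_split_denominator[OF ctx] by (simp add: power2_eq_square)
  qed
  have A0: "coeff A 0 \<noteq> 0" unfolding A_def Nn_def poly_0_coeff_0[symmetric] poly_power split_numerator_0[OF ctx]
    using pr by simp
  have B0: "coeff B 0 \<noteq> 0" unfolding B_def poly_0_coeff_0[symmetric] split_denominator_0[OF ctx] using pr by simp
  obtain c d where bez: "c * A + d * B = 1"
    using split_comaximal[OF ctx, of "q + 1"] unfolding comaximal_def A_def Nn_def B_def by blast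
  have evB: "poly (map_poly \<iota> B) s = ((s - \<iota> p) * (s - \<iota> r)) ^ q" if "field_hom \<iota>" for \<iota> :: "'q poly fract \<Rightarrow> 'l" and s
  proof -
    interpret field_hom \<iota> by (rule that)
    show ?thesis
      unfolding B_def split_denominator_def map_poly_hom.hom_power map_poly_hom.hom_mult poly_power poly_mult
      by (simp add: map_poly_pCons_hom hom_uminus)
  qed
  show ?thesis
  proof (rule statement_of_parametrization[OF A0 B0 dA _ _ bez split_equation_at_zero[OF ctx],
        where \<kappa> = "p * r" and c = "(p * r) ^ q"])
    show "q ^ 2 > 1" using q1 by (rule one_less_power) simp
    show "p * r \<noteq> 0" "(p * r) ^ q \<noteq> 0" using pr by simp_all
    show "degree (split_equation q p r) = CARD('q) ^ degree P"
      unfolding degree_split_equation[OF ctx] by (simp add: P q_def[symmetric] power2_eq_square)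
    fix \<iota> :: "'q poly fract \<Rightarrow> 'l" and s :: 'l
    assume h: "field_hom \<iota>" and s: "s \<noteq> 0"
    interpret field_hom \<iota> by (rule h)
    \<comment> \<open>The involution exchanges the two zeros of B: (p r / s - p) s = - p (s - r),
      and likewise with p and r interchanged. This gives the constant (p r)^q.\<close>
    have "(\<iota> (p * r) / s - \<iota> p) * (\<iota> (p * r) / s - \<iota> r) * s ^ 2 = \<iota> (p * r) * ((s - \<iota> p) * (s - \<iota> r))"
      using s by (simp add: hom_distribs field_simps power2_eq_square)
    then have "((\<iota> (p * r) / s - \<iota> p) * (\<iota> (p * r) / s - \<iota> r) * s ^ 2) ^ q = (\<iota> (p * r) * ((s - \<iota> p) * (s - \<iota> r))) ^ q"
      by (rule arg_cong)
    then show "poly (map_poly \<iota> B) (\<iota> (p * r) / s) * s ^ degree B = \<iota> ((p * r) ^ q) * poly (map_poly \<iota> B) s"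
      unfolding evB[OF h] degree_split_denominator[OF ctx, folded B_def] hom_power power_mult
      by (simp only: power_mult_distrib)
  next
    fix \<iota> :: "'q poly fract \<Rightarrow> 'l" and \<phi> \<mu>
    assume hom: "field_hom \<iota>"
      and cover: "involutive_cover (range \<iota>) (map_poly \<iota> A) (map_poly \<iota> B) (\<iota> (p * r)) (q ^ 2)"
      and tower: "isogeny_tower (\<lambda>a. \<iota> (to_fract a)) P \<phi> \<mu>"
      and tr: "\<not> algebraic_in (range \<iota>) (j_invariant (\<phi> 0))"
    interpret field_hom \<iota> by (rule hom)
    interpret quadratic_setting \<iota> q "a + a'" "a * a'" by unfold_locales (simp add: q_def)
    have \<gamma>: "(\<lambda>a. \<iota> (to_fract a)) = \<gamma>" by (simp add: \<gamma>_def fun_eq_iff)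
    have "[:- a, 1:] = [:0, 1:] - [:a:]" "[:- a', 1:] = [:0, 1:] - [:a':]" by simp_all
    then have \<iota>p: "\<iota> p = T - \<gamma> [:a:]" and \<iota>r: "\<iota> r = T - \<gamma> [:a':]"
      unfolding p_def r_def T_def \<gamma>_def[symmetric] by (simp_all only: \<gamma>_simps)
    note args = refl refl \<iota>p \<iota>r
    have \<kappa>: "\<iota> (p * r) = L.P T" using P_T_split[OF args] by (simp add: hom_mult)
    have evA: "poly (map_poly \<iota> A) x = N (\<iota> p) (\<iota> r) x * F (N (\<iota> p) (\<iota> r) x)" for x
    proof -
      have "poly (map_poly \<iota> Nn) x = N (\<iota> p) (\<iota> r) x"
        unfolding Nn_def split_numerator_def N_def[OF args] F_def map_poly_hom.hom_minus map_poly_hom.hom_mult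
          map_poly_hom.hom_power map_poly_hom_smult poly_diff poly_mult poly_power poly_smult
        by (simp add: map_poly_pCons_hom hom_uminus)
      then show ?thesis unfolding A_def map_poly_hom.hom_power poly_power by (simp add: F_def)
    qed
    have evB': "poly (map_poly \<iota> B) (T - \<alpha>) = F (L.P \<alpha>)" for \<alpha>
      unfolding evB[OF hom] P_split[OF args] F_def ..
    have J: "poly (map_poly \<iota> B) (T - \<alpha>) \<noteq> 0 \<and>
        poly (map_poly \<iota> A) (T - \<alpha>) / ((T - \<alpha>) * poly (map_poly \<iota> B) (T - \<alpha>)) =
        (1 + L.\<delta> \<alpha> * L.m \<alpha>) * F (1 + L.\<delta> \<alpha> * L.m \<alpha>) / L.\<delta> \<alpha>"
      if a: "T \<noteq> \<alpha>" "L.P \<alpha> \<noteq> 0" for \<alpha>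
    proof -
      define n where "n = N (\<iota> p) (\<iota> r) (T - \<alpha>)"
      have "(n / L.P \<alpha>) * (F n / F (L.P \<alpha>)) / ((T - \<alpha>) / L.P \<alpha>) = n * F n / ((T - \<alpha>) * F (L.P \<alpha>))"
        using a by (simp add: field_simps)
      then show ?thesis
        unfolding one_plus_\<delta>_m[OF args a(2)] evA evB' n_def[symmetric]
        unfolding L.\<delta>_def F.hom_div
        using a by simp
    qed
    obtain \<alpha> \<beta> c where tw:
      "\<And>e. c e \<noteq> 0" "\<And>e z. poly (\<mu> e) z = c e * L.P_act (\<alpha> e) (\<beta> e) z"
      "\<And>e. L.submodule (g\<^sub>\<phi> (\<phi> e)) (D\<^sub>\<phi> (\<phi> e)) (\<alpha> e) (\<beta> e)"
      "\<And>e. L.submodule (g\<^sub>\<phi> (\<phi> (Suc e))) (D\<^sub>\<phi> (\<phi> (Suc e))) (L.dual\<alpha> (\<alpha> e)) (L.dual\<beta> (\<alpha> e) (\<beta> e) (c e))"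
      "\<And>e. g\<^sub>\<phi> (\<phi> e) \<noteq> 0"
      "\<And>e. T - L.dual\<alpha> (\<alpha> e) = L.P T / (T - \<alpha> e)"
      "\<And>e. j_invariant (\<phi> e) = poly (map_poly \<iota> A) (T - \<alpha> e) / ((T - \<alpha> e) * poly (map_poly \<iota> B) (T - \<alpha> e))"
      "\<And>e. j_invariant (\<phi> (Suc e)) = poly (map_poly \<iota> A) (L.P T / (T - \<alpha> e)) /
          (L.P T / (T - \<alpha> e) * poly (map_poly \<iota> B) (L.P T / (T - \<alpha> e)))"
      "\<And>e. poly (map_poly \<iota> B) (T - \<alpha> e) \<noteq> 0"
      by (rule quadratic_tower[OF tower[unfolded \<gamma> P] cover[unfolded \<kappa>] J tr]) (assumption | rule that)+
    have u0: "T - \<alpha> e \<noteq> 0" for e using tw(3)[of e] by (auto simp: L.submodule_def)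
    note tower' = tower[unfolded \<gamma> P]
    have "eval2 \<iota> (split_equation q p r) (L.P T / (T - \<alpha> e)) (T - \<alpha> (Suc e)) = 0" for e
    proof -
      have n1: "(\<gamma> [:a:] - L.dual\<alpha> (\<alpha> e)) / L.dual\<beta> (\<alpha> e) (\<beta> e) (c e) \<noteq> (\<gamma> [:a:] - \<alpha> (Suc e)) / \<beta> (Suc e)"
        by (rule consecutive_eigenspaces[OF tower' tw(1-4) refl refl])
      have n2: "(\<gamma> [:a':] - L.dual\<alpha> (\<alpha> e)) / L.dual\<beta> (\<alpha> e) (\<beta> e) (c e) \<noteq> (\<gamma> [:a':] - \<alpha> (Suc e)) / \<beta> (Suc e)"
        by (rule consecutive_eigenspaces[OF tower' tw(1-4), where a = a' and a' = a]) (simp_all add: add.commute mult.commute)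
      show ?thesis
        using split_relation[OF args tw(4)[of e] tw(3)[of "Suc e"] tw(5) n1 n2 refl refl]
        unfolding eval2_split_equation[OF ctx hom] tw(6) F_def by simp
    qed
    then show "\<exists>u. \<forall>e. u e \<noteq> 0 \<and> poly (map_poly \<iota> B) (u e) \<noteq> 0 \<and>
         j_invariant (\<phi> e) = poly (map_poly \<iota> A) (u e) / (u e * poly (map_poly \<iota> B) (u e)) \<and>
         j_invariant (\<phi> (Suc e)) = poly (map_poly \<iota> A) (\<iota> (p * r) / u e) /
           (\<iota> (p * r) / u e * poly (map_poly \<iota> B) (\<iota> (p * r) / u e)) \<and>
         eval2 \<iota> (split_equation q p r) (\<iota> (p * r) / u e) (u (Suc e)) = 0"
      unfolding \<kappa> using u0 tw(7-9) by (intro exI[of _ "\<lambda>e. T - \<alpha> e"]) blast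
  qed
qed

section \<open>The recursive equation for a double root\<close>

definition square_factor :: "nat \<Rightarrow> 'k::field \<Rightarrow> 'k poly" where
  "square_factor q p = [:p:] + [:0, 1:] * [:p, -1:] ^ (q - 1)"

definition square_equation :: "nat \<Rightarrow> 'k::field \<Rightarrow> 'k poly poly" where
  "square_equation q p = (let M = [:[:p:]:] + [:0, 1:] * [:[:p:], -1:] ^ (q - 1) in
     Polynomial.smult ([:0, 1:] * [:- p, 1:] ^ (q - 1)) ((M - [:square_factor q p:]) ^ (q - 1) * M) -
     [:Polynomial.smult p (square_factor q p ^ q):])"

lemma poly_square_factor: "poly (square_factor q p) x = p + x * (p - x) ^ (q - 1)"
  by (simp add: square_factor_def poly_power)

lemma linear_tail_degree:
  fixes k c :: "'a::idom"
  assumes q: "q > 1"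
  shows "degree ([:k:] + [:0, 1:] * [:c, -1:] ^ (q - 1)) = q"
    "coeff ([:k:] + [:0, 1:] * [:c, -1:] ^ (q - 1)) q \<noteq> 0"
proof -
  define L where "L = [:c, -1:] ^ (q - 1)"
  have "degree [:c, -1:] = 1" "coeff [:c, -1:] 1 = (-1 :: 'a)" by simp_all
  then have L: "degree L = q - 1" "coeff L (q - 1) = (- 1) ^ (q - 1)"
    using degree_lead_power[of "[:c, -1:]" 1 "q - 1"] unfolding L_def by simp_all
  have L0: "coeff L (q - 1) \<noteq> 0" unfolding L by simp
  have "degree ([:0, 1:] :: 'a poly) = 1" "coeff ([:0, 1:] :: 'a poly) 1 \<noteq> 0" by simp_all
  from degree_lead_mult[OF this L(1) L0]
  have ZL: "degree ([:0, 1:] * L) = q" "coeff ([:0, 1:] * L) q \<noteq> 0" using q L0 by (simp_all add: L)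
  have "degree ([:k:] + [:0, 1:] * L) = degree ([:0, 1:] * L)"
    by (rule degree_add_eq_right) (use ZL(1) q in simp)
  then show "degree ([:k:] + [:0, 1:] * [:c, -1:] ^ (q - 1)) = q" unfolding ZL(1) unfolding L_def .
  have "coeff [:k:] q = 0" using q by (intro coeff_eq_0) simp
  then show "coeff ([:k:] + [:0, 1:] * [:c, -1:] ^ (q - 1)) q \<noteq> 0"
    using ZL(2) unfolding L_def coeff_add by (simp only: add_0 not_False_eq_True)
qed

lemma degree_square_equation:
  fixes p :: "'k::field"
  assumes q: "q > 1"
  shows "degree (square_equation q p) = q ^ 2"
proof -
  define M where "M = [:[:p:]:] + [:0, 1:] * [:[:p:], -1:] ^ (q - 1)"
  define K where "K = [:square_factor q p:]"
  have M: "degree M = q" "coeff M q \<noteq> 0" unfolding M_def by (rule linear_tail_degree[OF q])+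
  have "degree (M + - K) = q" using M(1) q by (subst degree_add_eq_left) (simp_all add: K_def)
  moreover have "coeff K q = 0" using q unfolding K_def by (intro coeff_eq_0) simp
  ultimately have MK: "degree (M - K) = q" "coeff (M - K) q \<noteq> 0" using M(2) by simp_all
  then have "degree ((M - K) ^ (q - 1)) = (q - 1) * q" "coeff ((M - K) ^ (q - 1)) ((q - 1) * q) \<noteq> 0"
    using degree_lead_power[OF MK, of "q - 1"] by simp_all
  from degree_lead_mult(1)[OF this M] have "degree ((M - K) ^ (q - 1) * M) = (q - 1) * q + q" .
  also have "(q - 1) * q + q = q ^ 2" using q by (cases q) (simp_all add: power2_eq_square)
  finally have d: "degree ((M - K) ^ (q - 1) * M) = q ^ 2" .
  define L where "L = [:0, 1:] * [:- p, 1:] ^ (q - 1)"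
  have "L \<noteq> 0" by (simp add: L_def)
  then have "degree (Polynomial.smult L ((M - K) ^ (q - 1) * M)) = q ^ 2" using d by simp
  then have "degree (Polynomial.smult L ((M - K) ^ (q - 1) * M) + - [:Polynomial.smult p (square_factor q p ^ q):]) = q ^ 2"
    using q by (subst degree_add_eq_left) simp_all
  then show ?thesis unfolding square_equation_def Let_def M_def K_def L_def diff_conv_add_uminus .
qed

text \<open>The factor X in front removes the first summand at X = 0, and the second one gives -
  p^(q + 1).\<close>

lemma square_equation_at_zero:
  fixes p :: "'k::field"
  assumes p: "p \<noteq> 0"
  shows "i > 0 \<Longrightarrow> coeff (coeff (square_equation q p) i) 0 = 0" "coeff (coeff (square_equation q p) 0) 0 \<noteq> 0"
proof -
  define S where "S = ([:[:p:]:] + [:0, 1:] * [:[:p:], -1:] ^ (q - 1) - [:square_factor q p:]) ^ (q - 1) *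
    ([:[:p:]:] + [:0, 1:] * [:[:p:], -1:] ^ (q - 1))"
  have e: "coeff (coeff (square_equation q p) i) 0 = (if i = 0 then - (p * p ^ q) else 0)" for i
    unfolding square_equation_def Let_def S_def[symmetric]
    by (cases i) (simp_all add: poly_0_coeff_0[symmetric] poly_power poly_square_factor)
  show "i > 0 \<Longrightarrow> coeff (coeff (square_equation q p) i) 0 = 0" "coeff (coeff (square_equation q p) 0) 0 \<noteq> 0"
    unfolding e using p by simp_all
qed

lemma (in field_hom) eval2_square_equation:
  "eval2 hom (square_equation q p) x y =
    x * (x - hom p) ^ (q - 1) * (((hom p + y * (hom p - y) ^ (q - 1)) - (hom p + x * (hom p - x) ^ (q - 1))) ^ (q - 1) *
      (hom p + y * (hom p - y) ^ (q - 1))) - hom p * (hom p + x * (hom p - x) ^ (q - 1)) ^ q"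
proof -
  have fac: "poly (map_poly hom (square_factor q p)) x = hom p + x * (hom p - x) ^ (q - 1)"
    unfolding square_factor_def map_poly_hom.hom_add map_poly_hom.hom_mult map_poly_hom.hom_power
    by (simp add: map_poly_pCons_hom hom_uminus)
  have Y: "eval2 hom [:0, 1:] x y = y" unfolding eval2_linear by simp
  have "eval2 hom [:[:p:], -1:] x y = hom p - y"
  proof -
    have "[:[:p:], -1:] = [:[:p:]:] - [:0, 1:]" by (rule poly_eqI) (simp add: coeff_pCons split: nat.splits)
    then show ?thesis by (simp only: eval2_diff eval2_const Y) (simp add: map_poly_pCons_hom)
  qed
  then have M: "eval2 hom ([:[:p:]:] + [:0, 1:] * [:[:p:], -1:] ^ (q - 1)) x y = hom p + y * (hom p - y) ^ (q - 1)"
    unfolding eval2_add eval2_mult eval2_power eval2_const Y by (simp add: map_poly_pCons_hom)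
  have L: "poly (map_poly hom ([:0, 1:] * [:- p, 1:] ^ (q - 1))) x = x * (x - hom p) ^ (q - 1)"
    unfolding map_poly_hom.hom_mult map_poly_hom.hom_power by (simp add: map_poly_pCons_hom hom_uminus)
  have C: "poly (map_poly hom (Polynomial.smult p (square_factor q p ^ q))) x =
      hom p * (hom p + x * (hom p - x) ^ (q - 1)) ^ q"
    unfolding map_poly_hom_smult map_poly_hom.hom_power poly_smult poly_power fac ..
  show ?thesis
    unfolding square_equation_def Let_def eval2_diff eval2_smult L eval2_mult eval2_power M eval2_const fac C ..
qed

text \<open>For p = r the factor X - p divides N, so the A and B of distinct roots would not be
  coprime. After cancellation A = M^(q + 1) and B = (X - p)^(q - 1), and again deg A = q (q + 1) =
  q^2 + 1 + deg B.\<close>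

lemma square_level_statement:
  fixes P :: "'q::{finite,field} poly"
  assumes P: "P = [:a * a, - (a + a), 1:]"
  shows "depth_one_recursion TYPE('l::alg_closed_field) P"
proof -
  define q where "q = CARD('q)"
  have q1: "q > 1" unfolding q_def by (rule card_field_gt_1)
  define p :: "'q poly fract" where "p = to_fract [:- a, 1:]"
  have p0: "p \<noteq> 0" by (simp add: p_def)
  define M where "M = square_factor q p"
  define A where "A = M ^ (q + 1)"
  define B where "B = [:- p, 1:] ^ (q - 1)"
  have dB: "degree B = q - 1" unfolding B_def by (subst degree_power_eq) auto
  have dA: "degree A = q ^ 2 + 1 + degree B"
  proof -
    have "degree M = q" "coeff M q \<noteq> 0"
      unfolding M_def square_factor_def by (rule linear_tail_degree[OF q1])+
    then have "degree A = (q + 1) * q" unfolding A_def by (rule degree_lead_power)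
    then show ?thesis using q1 unfolding dB by (simp add: power2_eq_square)
  qed
  have A0: "coeff A 0 \<noteq> 0" unfolding A_def M_def poly_0_coeff_0[symmetric] poly_power poly_square_factor
    using p0 by simp
  have B0: "coeff B 0 \<noteq> 0" unfolding B_def poly_0_coeff_0[symmetric] poly_power using p0 by simp
  have "poly M p \<noteq> 0" unfolding M_def poly_square_factor using p0 q1 by (simp add: power_0_left)
  then have "comaximal A B" unfolding A_def B_def
    by (intro comaximal_power comaximal_sym[OF comaximal_power] comaximal_sym[OF comaximal_linear])
  then obtain c d where bez: "c * A + d * B = 1" unfolding comaximal_def by blast
  have evB: "poly (map_poly \<iota> B) s = (s - \<iota> p) ^ (q - 1)" if "field_hom \<iota>" for \<iota> :: "'q poly fract \<Rightarrow> 'l" and s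
  proof -
    interpret field_hom \<iota> by (rule that)
    show ?thesis unfolding B_def map_poly_hom.hom_power poly_power by (simp add: map_poly_pCons_hom hom_uminus)
  qed
  show ?thesis
  proof (rule statement_of_parametrization[OF A0 B0 dA _ _ bez square_equation_at_zero[OF p0],
        where \<kappa> = "p * p" and c = "(- p) ^ (q - 1)"])
    show "q ^ 2 > 1" using q1 by (rule one_less_power) simp
    show "p * p \<noteq> 0" "(- p) ^ (q - 1) \<noteq> 0" using p0 by simp_all
    show "degree (square_equation q p) = CARD('q) ^ degree P"
      unfolding degree_square_equation[OF q1] by (simp add: P q_def[symmetric] power2_eq_square)
    fix \<iota> :: "'q poly fract \<Rightarrow> 'l" and s :: 'l
    assume h: "field_hom \<iota>" and s: "s \<noteq> 0"
    interpret field_hom \<iota> by (rule h)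
    \<comment> \<open>The involution fixes the zero p of B; the factor - p, raised to the power q -
      1, is the constant of reciprocity.\<close>
    have "(\<iota> (p * p) / s - \<iota> p) * s = \<iota> (- p) * (s - \<iota> p)"
      using s by (simp add: hom_distribs field_simps)
    then have "((\<iota> (p * p) / s - \<iota> p) * s) ^ (q - 1) = (\<iota> (- p) * (s - \<iota> p)) ^ (q - 1)" by (rule arg_cong)
    then show "poly (map_poly \<iota> B) (\<iota> (p * p) / s) * s ^ degree B = \<iota> ((- p) ^ (q - 1)) * poly (map_poly \<iota> B) s"
      unfolding evB[OF h] dB hom_power by (simp only: power_mult_distrib)
  next
    fix \<iota> :: "'q poly fract \<Rightarrow> 'l" and \<phi> \<mu>
    assume hom: "field_hom \<iota>"
      and cover: "involutive_cover (range \<iota>) (map_poly \<iota> A) (map_poly \<iota> B) (\<iota> (p * p)) (q ^ 2)"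
      and tower: "isogeny_tower (\<lambda>a. \<iota> (to_fract a)) P \<phi> \<mu>"
      and tr: "\<not> algebraic_in (range \<iota>) (j_invariant (\<phi> 0))"
    interpret field_hom \<iota> by (rule hom)
    interpret quadratic_setting \<iota> q "a + a" "a * a" by unfold_locales (simp add: q_def)
    have \<gamma>: "(\<lambda>a. \<iota> (to_fract a)) = \<gamma>" by (simp add: \<gamma>_def fun_eq_iff)
    have "[:- a, 1:] = [:0, 1:] - [:a:]" by simp
    then have \<iota>p: "\<iota> p = T - \<gamma> [:a:]"
      unfolding p_def T_def \<gamma>_def[symmetric] by (simp only: \<gamma>_simps)
    note args = refl refl \<iota>p \<iota>p
    have \<kappa>: "\<iota> (p * p) = L.P T" using P_T_split[OF args] by (simp add: hom_mult)
    define m where "m = (\<lambda>x. \<iota> p + x * (\<iota> p - x) ^ (q - 1))"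
    have evA: "poly (map_poly \<iota> A) x = m x * F (m x)" for x
    proof -
      have "poly (map_poly \<iota> M) x = m x"
        unfolding M_def square_factor_def m_def map_poly_hom.hom_add map_poly_hom.hom_mult map_poly_hom.hom_power
        by (simp add: map_poly_pCons_hom hom_uminus)
      then show ?thesis unfolding A_def map_poly_hom.hom_power poly_power by (simp add: F_def)
    qed
    have J: "poly (map_poly \<iota> B) (T - \<alpha>) \<noteq> 0 \<and>
        poly (map_poly \<iota> A) (T - \<alpha>) / ((T - \<alpha>) * poly (map_poly \<iota> B) (T - \<alpha>)) =
        (1 + L.\<delta> \<alpha> * L.m \<alpha>) * F (1 + L.\<delta> \<alpha> * L.m \<alpha>) / L.\<delta> \<alpha>"
      if a: "T \<noteq> \<alpha>" "L.P \<alpha> \<noteq> 0" for \<alpha>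
    proof -
      define x where "x = T - \<alpha>"
      define b where "b = (x - \<iota> p) ^ (q - 1)"
      have x: "x \<noteq> 0" using a by (simp add: x_def)
      have P\<alpha>: "L.P \<alpha> = (x - \<iota> p) * (x - \<iota> p)" unfolding P_split[OF args] x_def ..
      then have xp: "x - \<iota> p \<noteq> 0" using a by auto
      then have b: "b \<noteq> 0" by (simp add: b_def)
      have "N (\<iota> p) (\<iota> p) x = - (x - \<iota> p) * m x"
        unfolding N_def[OF args] m_def F_power[of "\<iota> p - x"] by (simp add: algebra_simps)
      then have "1 + L.\<delta> \<alpha> * L.m \<alpha> = - (x - \<iota> p) * m x / ((x - \<iota> p) * (x - \<iota> p))"
        using one_plus_\<delta>_m[OF args a(2)] unfolding P\<alpha> x_def by simp
      also have "\<dots> = - (m x / (x - \<iota> p))"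
      proof -
        have "- y * k / (y * y) = - (k / y)" if "y \<noteq> 0" for y k :: 'l using that by simp
        then show ?thesis using xp .
      qed
      finally have d: "1 + L.\<delta> \<alpha> * L.m \<alpha> = - (m x / (x - \<iota> p))" .
      have "m x * F (m x) / (x * b) =
          (m x / (x - \<iota> p)) * (F (m x) / (b * (x - \<iota> p))) / (x / ((x - \<iota> p) * (x - \<iota> p)))"
        using x xp b by simp
      moreover have "F (- (m x / (x - \<iota> p))) = - (F (m x) / (b * (x - \<iota> p)))"
        unfolding b_def F_power[symmetric] by (simp add: F.hom_uminus F.hom_div)
      ultimately show ?thesis
        unfolding d evA evB[OF hom] x_def[symmetric] b_def[symmetric]
        unfolding L.\<delta>_def P\<alpha> x_def[symmetric] using b by simp
    qed
    obtain \<alpha> \<beta> c where tw: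
      "\<And>e. c e \<noteq> 0" "\<And>e z. poly (\<mu> e) z = c e * L.P_act (\<alpha> e) (\<beta> e) z"
      "\<And>e. L.submodule (g\<^sub>\<phi> (\<phi> e)) (D\<^sub>\<phi> (\<phi> e)) (\<alpha> e) (\<beta> e)"
      "\<And>e. L.submodule (g\<^sub>\<phi> (\<phi> (Suc e))) (D\<^sub>\<phi> (\<phi> (Suc e))) (L.dual\<alpha> (\<alpha> e)) (L.dual\<beta> (\<alpha> e) (\<beta> e) (c e))"
      "\<And>e. g\<^sub>\<phi> (\<phi> e) \<noteq> 0"
      "\<And>e. T - L.dual\<alpha> (\<alpha> e) = L.P T / (T - \<alpha> e)"
      "\<And>e. j_invariant (\<phi> e) = poly (map_poly \<iota> A) (T - \<alpha> e) / ((T - \<alpha> e) * poly (map_poly \<iota> B) (T - \<alpha> e))"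
      "\<And>e. j_invariant (\<phi> (Suc e)) = poly (map_poly \<iota> A) (L.P T / (T - \<alpha> e)) /
          (L.P T / (T - \<alpha> e) * poly (map_poly \<iota> B) (L.P T / (T - \<alpha> e)))"
      "\<And>e. poly (map_poly \<iota> B) (T - \<alpha> e) \<noteq> 0"
      by (rule quadratic_tower[OF tower[unfolded \<gamma> P] cover[unfolded \<kappa>] J tr]) (assumption | rule that)+
    have u0: "T - \<alpha> e \<noteq> 0" for e using tw(3)[of e] unfolding L.submodule_def by auto
    have "eval2 \<iota> (square_equation q p) (L.P T / (T - \<alpha> e)) (T - \<alpha> (Suc e)) = 0" for e
    proof -
      have "(\<gamma> [:a:] - L.dual\<alpha> (\<alpha> e)) / L.dual\<beta> (\<alpha> e) (\<beta> e) (c e) \<noteq> (\<gamma> [:a:] - \<alpha> (Suc e)) / \<beta> (Suc e)"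
        by (rule consecutive_eigenspaces[OF tower[unfolded \<gamma> P] tw(1-4) refl refl])
      from square_relation[OF args refl tw(4)[of e] tw(3)[of "Suc e"] tw(5) this refl refl, of m]
      show ?thesis unfolding eval2_square_equation tw(6) F_def m_def by (simp add: mult.assoc)
    qed
    then show "\<exists>u. \<forall>e. u e \<noteq> 0 \<and> poly (map_poly \<iota> B) (u e) \<noteq> 0 \<and>
         j_invariant (\<phi> e) = poly (map_poly \<iota> A) (u e) / (u e * poly (map_poly \<iota> B) (u e)) \<and>
         j_invariant (\<phi> (Suc e)) = poly (map_poly \<iota> A) (\<iota> (p * p) / u e) /
           (\<iota> (p * p) / u e * poly (map_poly \<iota> B) (\<iota> (p * p) / u e)) \<and>
         eval2 \<iota> (square_equation q p) (\<iota> (p * p) / u e) (u (Suc e)) = 0"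
      unfolding \<kappa> using u0 tw(7-9) by (intro exI[of _ "\<lambda>e. T - \<alpha> e"]) blast
  qed
qed

section \<open>The level of an irreducible quadratic polynomial\<close>

lemma prod_linear_UNIV:
  "(\<Prod>c\<in>UNIV. [:- c, 1:]) = ([:0, 1:] :: 'q::{finite,field} poly) ^ CARD('q) - [:0, 1:]"
proof (rule ccontr)
  define D E :: "'q poly" where "D = (\<Prod>c\<in>UNIV. [:- c, 1:])" and "E = [:0, 1:] ^ CARD('q) - [:0, 1:]"
  assume "\<not> ?thesis"
  then have ne: "D - E \<noteq> 0" unfolding D_def E_def by simp
  have q: "CARD('q) > 1" by (rule card_field_gt_1)
  have dD: "degree D = CARD('q)" unfolding D_def by (subst degree_prod_eq_sum_degree) auto
  have "lead_coeff D = 1" unfolding D_def by (subst lead_coeff_prod) simp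
  then have D: "coeff D CARD('q) = 1" by (simp add: dD)
  have E: "E = monom 1 CARD('q) + - [:0, 1:]" by (simp add: E_def monom_altdef)
  have dE: "degree E = CARD('q)"
    unfolding E using q by (subst degree_add_eq_left) (simp_all add: degree_monom_eq)
  have "coeff [:0, 1 :: 'q:] CARD('q) = 0" using q by (intro coeff_eq_0) simp
  then have "coeff (D - E) CARD('q) = 0" unfolding E using D by (simp only: coeff_diff coeff_add coeff_minus coeff_monom) simp
  moreover have "degree (D - E) \<le> CARD('q)" using dD dE by (intro degree_diff_le) auto
  ultimately have "degree (D - E) < CARD('q)"
    using ne q by (metis le_neq_implies_less leading_coeff_0_iff)
  moreover have "poly (D - E) x = 0" for x
    by (simp add: D_def E_def poly_prod poly_power finite_field_power_card prod_zero_iff)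
  then have "{x. poly (D - E) x = 0} = UNIV" by auto
  then have "CARD('q) \<le> degree (D - E)" using card_poly_roots_bound[OF ne] by simp
  ultimately show False by simp
qed

text \<open>The Frobenius map swaps the two roots of a quadratic polynomial without rational roots, so their sum \<open>t\<close> is \<open>x + x\<^bsup>q\<^esup>\<close>.\<close>

lemma quadratic_dvd_frobenius_trace:
  fixes P :: "'q::{finite,field} poly"
  assumes P: "P = [:n, - t, 1:]" and root: "\<And>c. poly P c \<noteq> 0"
  shows "P dvd [:0, 1:] ^ CARD('q) + [:0, 1:] - [:t:]"
proof -
  define q where "q = CARD('q)"
  define X :: "'q poly" where "X = [:0, 1:]"
  define K where "K = (\<lambda>c::'q. [:c:])"
  have ch: "of_nat (q choose i) = (0 :: 'q poly)" if "0 < i" "i < q" for i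
    using that choose_eq_0_poly unfolding q_def by blast
  have q1: "q > 1" unfolding q_def by (rule card_field_gt_1)
  have add: "(x + y) ^ q = x ^ q + y ^ q" and diff: "(x - y) ^ q = x ^ q - y ^ q" for x y :: "'q poly"
    by (rule frobenius_add_ring[OF q1 ch] frobenius_diff_ring[OF q1 ch]; assumption)+
  have K: "K c ^ q = K c" for c unfolding K_def poly_const_pow q_def finite_field_power_card ..
  have PX: "P = X * X - K t * X + K n" by (simp add: P X_def K_def)
  have "P ^ q = X ^ q * X ^ q - K t * X ^ q + K n"
    unfolding PX by (simp add: add diff power_mult_distrib K)
  \<comment> \<open>The coefficients of P are constants, so P^q = P(X^q), and P(X^q) - P(X) is
    divisible by X^q - X.\<close>
  then have e: "P ^ q - P = (X ^ q - X) * (X ^ q + X - K t)"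
    unfolding PX by (simp add: algebra_simps)
  \<comment> \<open>P has no root, so it is prime to the product of all X - c, which is X^q - X.
    Dividing P^q - P, it must therefore divide the other factor.\<close>
  have "comaximal P (\<Prod>c\<in>UNIV. [:- c, 1:])" by (intro comaximal_prod comaximal_linear root)
  then obtain u v where uv: "u * P + v * (X ^ q - X) = 1"
    unfolding comaximal_def prod_linear_UNIV X_def q_def by blast
  have "X ^ q + X - K t = (u * P + v * (X ^ q - X)) * (X ^ q + X - K t)" unfolding uv by simp
  also have "\<dots> = P * (u * (X ^ q + X - K t)) + v * ((X ^ q - X) * (X ^ q + X - K t))"
    by (simp add: algebra_simps)
  also have "P dvd \<dots>"
  proof (rule dvd_add[OF dvd_triv_left dvd_mult])
    have "P dvd P ^ q" using q1 by (intro dvd_power) auto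
    then show "P dvd (X ^ q - X) * (X ^ q + X - K t)" unfolding e[symmetric] by (rule dvd_diff) simp
  qed
  finally show ?thesis unfolding X_def K_def q_def .
qed

text \<open>This is f(T - X): the parameter is T - \<alpha>, whereas P and its cofactor are
  polynomials in \<alpha>.\<close>

definition reflect_at_T :: "'q::field poly \<Rightarrow> 'q poly fract poly" where
  "reflect_at_T f = pcompose (map_poly (\<lambda>c. to_fract [:c:]) f) [:to_fract [:0, 1:], -1:]"

lemma degree_reflect_at_T: "degree (reflect_at_T f) = degree f"
  unfolding reflect_at_T_def degree_pcompose by (simp add: degree_map_poly)

lemma reflect_at_T_0: "poly (reflect_at_T f) 0 = to_fract f"
proof -
  have "poly (map_poly (\<lambda>c. to_fract [:c:]) f) (to_fract [:0, 1:]) = to_fract f"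
  proof (induction f)
    case (pCons a f)
    have "pCons a f = [:a:] + [:0, 1:] * f" by simp
    then have "to_fract (pCons a f) = to_fract [:a:] + to_fract [:0, 1:] * to_fract f"
      by (simp only: to_fract_hom.hom_add to_fract_hom.hom_mult)
    then show ?case using pCons by (simp add: map_poly_pCons)
  qed simp
  then show ?thesis by (simp add: reflect_at_T_def poly_pcompose)
qed

context drinfeld_setting
begin

lemma const_hom: "map_poly_comm_ring_hom (\<lambda>c. \<gamma> [:c:])"
proof
  fix x y :: 'q
  have "[:x + y:] = [:x:] + [:y:]" "[:x * y:] = [:x:] * [:y:]" by simp_all
  then show "\<gamma> [:x + y:] = \<gamma> [:x:] + \<gamma> [:y:]" "\<gamma> [:x * y:] = \<gamma> [:x:] * \<gamma> [:y:]"
    by (simp_all only: \<gamma>_simps)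
  have "[:1 :: 'q:] = 1" by simp
  then show "\<gamma> [:1:] = 1" by (simp only: \<gamma>_simps)
qed simp

lemma poly_reflect_at_T:
  "poly (map_poly \<iota> (reflect_at_T f)) x = poly (map_poly (\<lambda>c. \<gamma> [:c:]) f) (T - x)"
proof -
  have "map_poly \<iota> (map_poly (\<lambda>c. to_fract [:c:]) f) = map_poly (\<lambda>c. \<gamma> [:c:]) f"
    by (rule poly_eqI) (simp add: coeff_map_poly \<gamma>_def)
  then show ?thesis
    unfolding reflect_at_T_def map_poly_pcompose poly_pcompose
    by (simp add: map_poly_pCons_hom hom_uminus T_def \<gamma>_def)
qed

end

text \<open>From X^q + X - t = P k one gets m(\<alpha>) = P(\<alpha>) k(\<alpha>) and \<delta> m =
  (T - \<alpha>) k(\<alpha>). The denominator disappears, so B = 1 and A = P(T - X) (1 + X k(T -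
  X))^(q + 1), of degree 2 + (q + 1)(q - 1) = q^2 + 1; division by the diagonal gives the
  equation.\<close>

lemma irreducible_level_statement:
  fixes P :: "'q::{finite,field} poly"
  assumes P: "P = [:n, - t, 1:]" and root: "\<And>c. poly P c \<noteq> 0"
  shows "depth_one_recursion TYPE('l::alg_closed_field) P"
proof -
  define q where "q = CARD('q)"
  have q1: "q > 1" unfolding q_def by (rule card_field_gt_1)
  obtain k where k: "[:0, 1:] ^ q + [:0, 1:] - [:t:] = P * k"
    using quadratic_dvd_frobenius_trace[OF P root] unfolding q_def dvd_def by blast
  have P0: "P \<noteq> 0" and dP: "degree P = 2" by (simp_all add: P)
  define M where "M = 1 + [:0, 1:] * reflect_at_T k"
  have dM: "degree M = q - 1" and M0: "M \<noteq> 0"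
  proof -
    have E: "[:0, 1:] ^ q + [:0, 1:] - [:t:] = monom 1 q + [:- t, 1:]" by (simp add: monom_altdef)
    have dE: "degree (P * k) = q"
      unfolding k[symmetric] E using q1 by (subst degree_add_eq_left) (simp_all add: degree_monom_eq)
    then have k0: "k \<noteq> 0" using q1 by auto
    then have "degree k + 2 = q" using dE P0 by (simp add: degree_mult_eq dP)
    moreover have "reflect_at_T k \<noteq> 0" using reflect_at_T_0[of k] k0 by auto
    ultimately have d: "degree ([:0, 1:] * reflect_at_T k) = q - 1"
      by (subst degree_mult_eq) (auto simp: degree_reflect_at_T)
    then show "degree M = q - 1" unfolding M_def using q1 by (subst degree_add_eq_right) simp_all
    then show "M \<noteq> 0" using q1 by auto
  qed
  define A where "A = reflect_at_T P * M ^ (q + 1)"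
  have "reflect_at_T P \<noteq> 0" using reflect_at_T_0[of P] P0 by auto
  then have "degree A = 2 + (q + 1) * (q - 1)"
    unfolding A_def using M0 by (simp add: degree_mult_eq degree_power_eq degree_reflect_at_T dP dM)
  also have "2 + (q + 1) * (q - 1) = Suc (q ^ 2)" using q1 by (cases q) (simp_all add: power2_eq_square)
  finally have dA: "degree A = Suc (q ^ 2)" .
  have A0: "coeff A 0 = to_fract P"
    by (simp add: A_def M_def poly_0_coeff_0[symmetric] reflect_at_T_0)
  obtain g :: "'q poly fract poly poly" where g: "degree g = q ^ 2" "\<And>i. i > 0 \<Longrightarrow> coeff (coeff g i) 0 = 0"
    "coeff (coeff g 0) 0 = coeff A 0"
    "\<And>(\<iota> :: 'q poly fract \<Rightarrow> 'l) x y. field_hom \<iota> \<Longrightarrow>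
       poly (map_poly \<iota> A) x * y - poly (map_poly \<iota> A) y * x = (y - x) * eval2 \<iota> g x y"
    using division_by_diagonal[OF dA, where ?'l = 'l] q1 one_le_power[of q 2] by (metis less_imp_le_nat)
  show ?thesis
  proof (rule statement_of_parametrization[where A = A and B = 1 and g = g and \<kappa> = "to_fract P"
      and a = 0 and b = 1 and c = 1 and Q = "q ^ 2"])
    show "q ^ 2 > 1" using q1 by (rule one_less_power) simp
    fix \<iota> :: "'q poly fract \<Rightarrow> 'l" and \<phi> \<mu>
    assume hom: "field_hom \<iota>"
      and cover: "involutive_cover (range \<iota>) (map_poly \<iota> A) (map_poly \<iota> 1) (\<iota> (to_fract P)) (q ^ 2)"
      and tower: "isogeny_tower (\<lambda>a. \<iota> (to_fract a)) P \<phi> \<mu>"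
      and tr: "\<not> algebraic_in (range \<iota>) (j_invariant (\<phi> 0))"
    interpret field_hom \<iota> by (rule hom)
    interpret quadratic_setting \<iota> q t n by unfold_locales (simp add: q_def)
    interpret G: map_poly_comm_ring_hom "\<lambda>c. \<gamma> [:c:]" by (rule const_hom)
    define G where "G = map_poly (\<lambda>c. \<gamma> [:c:])"
    have \<gamma>: "(\<lambda>a. \<iota> (to_fract a)) = \<gamma>" by (simp add: \<gamma>_def fun_eq_iff)
    have m1: "map_poly \<iota> 1 = 1" by simp
    have neg: "\<gamma> [:- c:] = - \<gamma> [:c:]" for c by (simp flip: \<gamma>_simps(6))
    have one: "\<gamma> [:1:] = 1" by (simp flip: one_pCons)
    have GP: "poly (G P) x = L.P x" for x
      by (simp add: G_def P L.P_def map_poly_pCons neg one algebra_simps)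
    have "\<iota> (to_fract P) = poly (map_poly \<iota> (reflect_at_T P)) 0"
      using reflect_at_T_0[of P] by (simp add: poly_0_coeff_0)
    then have \<kappa>: "\<iota> (to_fract P) = L.P T" unfolding poly_reflect_at_T G_def[symmetric] GP by simp
    have Gk: "L.m x = L.P x * poly (G k) x" for x
    proof -
      have const: "map_poly (\<lambda>c. \<gamma> [:c:]) [:t:] = [:\<gamma> [:t:]:]"
        by (rule poly_eqI) (simp add: coeff_map_poly coeff_pCons split: nat.splits)
      have "poly (G ([:0, 1:] ^ q + [:0, 1:] - [:t:])) x = L.m x"
        unfolding G_def G.hom_minus G.hom_add G.hom_power const
        by (simp add: map_poly_pCons one L.m_def F_def algebra_simps)
      then show ?thesis unfolding k G_def G.hom_mult by (simp add: GP[unfolded G_def])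
    qed
    have evA: "poly (map_poly \<iota> A) (T - \<alpha>) =
        L.P \<alpha> * ((1 + (T - \<alpha>) * poly (G k) \<alpha>) * F (1 + (T - \<alpha>) * poly (G k) \<alpha>))" for \<alpha>
    proof -
      have "poly (map_poly \<iota> M) (T - \<alpha>) = 1 + (T - \<alpha>) * poly (G k) \<alpha>"
        unfolding M_def map_poly_hom.hom_add map_poly_hom.hom_mult poly_add poly_mult poly_reflect_at_T G_def
        by (simp add: map_poly_pCons_hom)
      then show ?thesis
        unfolding A_def map_poly_hom.hom_mult map_poly_hom.hom_power poly_mult poly_power poly_reflect_at_T
          G_def[symmetric] F_def by (simp add: GP)
    qed
    have J: "poly (1 :: 'l poly) (T - \<alpha>) \<noteq> 0 \<and>
        poly (map_poly \<iota> A) (T - \<alpha>) / ((T - \<alpha>) * poly 1 (T - \<alpha>)) =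
        (1 + L.\<delta> \<alpha> * L.m \<alpha>) * F (1 + L.\<delta> \<alpha> * L.m \<alpha>) / L.\<delta> \<alpha>"
      if a: "T \<noteq> \<alpha>" "L.P \<alpha> \<noteq> 0" for \<alpha>
    proof -
      have "1 + L.\<delta> \<alpha> * L.m \<alpha> = 1 + (T - \<alpha>) * poly (G k) \<alpha>" using a by (simp add: L.\<delta>_def Gk)
      then show ?thesis unfolding evA using a by (simp add: L.\<delta>_def mult.commute)
    qed
    obtain \<alpha> \<beta> c where tw:
      "\<And>e. c e \<noteq> 0" "\<And>e z. poly (\<mu> e) z = c e * L.P_act (\<alpha> e) (\<beta> e) z"
      "\<And>e. L.submodule (g\<^sub>\<phi> (\<phi> e)) (D\<^sub>\<phi> (\<phi> e)) (\<alpha> e) (\<beta> e)"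
      "\<And>e. L.submodule (g\<^sub>\<phi> (\<phi> (Suc e))) (D\<^sub>\<phi> (\<phi> (Suc e))) (L.dual\<alpha> (\<alpha> e)) (L.dual\<beta> (\<alpha> e) (\<beta> e) (c e))"
      "\<And>e. g\<^sub>\<phi> (\<phi> e) \<noteq> 0"
      "\<And>e. T - L.dual\<alpha> (\<alpha> e) = L.P T / (T - \<alpha> e)"
      "\<And>e. j_invariant (\<phi> e) = poly (map_poly \<iota> A) (T - \<alpha> e) / ((T - \<alpha> e) * poly 1 (T - \<alpha> e))"
      "\<And>e. j_invariant (\<phi> (Suc e)) = poly (map_poly \<iota> A) (L.P T / (T - \<alpha> e)) /
          (L.P T / (T - \<alpha> e) * poly 1 (L.P T / (T - \<alpha> e)))"
      "\<And>e. poly 1 (T - \<alpha> e) \<noteq> (0 :: 'l)"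
      by (rule quadratic_tower[OF tower[unfolded \<gamma> P] cover[unfolded \<kappa> m1] J tr]) (assumption | rule that)+
    have u0: "T - \<alpha> e \<noteq> 0" for e using tw(3)[of e] unfolding L.submodule_def by auto
    have "L.P T \<noteq> 0" unfolding \<kappa>[symmetric] using P0 by simp
    have "eval2 \<iota> g (L.P T / (T - \<alpha> e)) (T - \<alpha> (Suc e)) = 0" for e
    proof -
      define x y where "x = L.P T / (T - \<alpha> e)" and "y = T - \<alpha> (Suc e)"
      have nz: "x \<noteq> 0" "y \<noteq> 0" using u0 \<open>L.P T \<noteq> 0\<close> by (simp_all add: x_def y_def)
      have "\<alpha> (Suc e) \<noteq> L.dual\<alpha> (\<alpha> e)"
        by (rule consecutive_distinct[OF tower[unfolded \<gamma> P] tw(1-5)])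
      then have ne: "y \<noteq> x" unfolding x_def y_def tw(6)[symmetric] by simp
      have "poly (map_poly \<iota> A) x / x = poly (map_poly \<iota> A) y / y"
        using tw(7)[of "Suc e"] tw(8)[of e] by (simp add: x_def y_def)
      then have "poly (map_poly \<iota> A) x * y - poly (map_poly \<iota> A) y * x = 0"
        using nz by (simp add: field_simps)
      then show ?thesis using g(4)[OF hom, of x y] ne by (simp add: x_def y_def)
    qed
    then show "\<exists>u. \<forall>e. u e \<noteq> 0 \<and> poly (map_poly \<iota> 1) (u e) \<noteq> 0 \<and>
         j_invariant (\<phi> e) = poly (map_poly \<iota> A) (u e) / (u e * poly (map_poly \<iota> 1) (u e)) \<and>
         j_invariant (\<phi> (Suc e)) = poly (map_poly \<iota> A) (\<iota> (to_fract P) / u e) /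
           (\<iota> (to_fract P) / u e * poly (map_poly \<iota> 1) (\<iota> (to_fract P) / u e)) \<and>
         eval2 \<iota> g (\<iota> (to_fract P) / u e) (u (Suc e)) = 0"
      unfolding \<kappa> m1 using u0 tw(7-9) by (intro exI[of _ "\<lambda>e. T - \<alpha> e"]) blast
  next
    fix \<iota> :: "'q poly fract \<Rightarrow> 'l" and s assume "field_hom \<iota>"
    then interpret field_hom \<iota> .
    show "poly (map_poly \<iota> 1) (\<iota> (to_fract P) / s) * s ^ degree (1 :: 'q poly fract poly) =
        \<iota> 1 * poly (map_poly \<iota> 1) s" by simp
  qed (use dA P0 g A0 in \<open>auto simp: dP q_def[symmetric]\<close>)
qed

theorem proposition3:
  fixes P :: "'q::{finite,field} poly"
  assumes "monic P" and "degree P = 1 \<or> degree P = 2"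
  shows "\<exists>f :: 'q poly fract poly poly.
    degree f = CARD('q) ^ degree P \<and>
    (\<forall>(\<iota> :: 'q poly fract \<Rightarrow> 'l::alg_closed_field) \<phi> \<mu>.
       field_hom \<iota> \<and>
       isogeny_tower (\<lambda>a. \<iota> (to_fract a)) P \<phi> \<mu> \<and>
       transcendental_over \<iota> (j_invariant (\<phi> 0)) \<longrightarrow>
       (\<exists>u.
          (\<exists>\<rho> \<sigma>. \<forall>e.
             adjoin (range \<iota>) {u e} = adjoin (range \<iota>) {j_invariant (\<phi> e), j_invariant (\<phi> (e + 1))} \<and>
             ratfun_value \<iota> \<rho> (u e) (j_invariant (\<phi> e)) \<and>
             ratfun_value \<iota> \<sigma> (u e) (j_invariant (\<phi> (e + 1)))) \<and>
          (\<forall>n\<ge>1.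
             X0_field \<iota> (\<phi> 0) (\<phi> n) = adjoin (range \<iota>) (u ` {..<n}) \<and>
             (\<forall>e. 1 \<le> e \<and> e < n \<longrightarrow> eval2 \<iota> f (u (e - 1)) (u e) = 0)) \<and>
          X0_field \<iota> (\<phi> 0) (\<phi> 1) = adjoin (range \<iota>) {u 0} \<and>
          (\<forall>n\<ge>1.
             X0_field \<iota> (\<phi> 0) (\<phi> (n + 1)) = adjoin (X0_field \<iota> (\<phi> 0) (\<phi> n)) {u n} \<and>
             eval2 \<iota> f (u (n - 1)) (u n) = 0)))"
proof -
  have "depth_one_recursion TYPE('l) P"
    using assms(2)
  proof
    assume d: "degree P = 1"
    \<comment> \<open>The double sign brings P into the form X - a with a = - P(0).\<close>
    then have "P = [:- (- coeff P 0), 1:]"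
      using assms(1) by (intro poly_eqI) (auto simp: coeff_pCons coeff_eq_0 split: nat.splits)
    then show ?thesis by (rule linear_level_statement)
  next
    assume d: "degree P = 2"
    define n t where "n = coeff P 0" and "t = - coeff P 1"
    have P: "P = [:n, - t, 1:]"
      using assms(1) d unfolding n_def t_def
      by (intro poly_eqI) (auto simp: coeff_pCons coeff_eq_0 numeral_2_eq_2 split: nat.splits)
    show ?thesis
    proof (cases "\<exists>a. poly P a = 0")
      case True
      then obtain a where "poly P a = 0" by blast
      \<comment> \<open>The other root is t - a; whether it equals a separates the double root from
        distinct roots.\<close>
      then have "n = a * (t - a)" by (simp add: P algebra_simps)
      then have PP: "P = [:a * (t - a), - (a + (t - a)), 1:]" by (simp add: P)
      show ?thesis
      proof (cases "t - a = a")
        case True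
        show ?thesis using PP unfolding True by (rule square_level_statement)
      next
        case False
        then show ?thesis using split_level_statement[OF PP] by metis
      qed
    next
      case False
      then show ?thesis using irreducible_level_statement[OF P] by blast
    qed
  qed
  then show ?thesis unfolding depth_one_recursion_def .
qed

end
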